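(* Let $p>0$, $T>0$, $\Omega=\{(x,t):0<x<p,\ -T<t<T\}$. Let $f\in C^1(\overline\Omega)$ with $\frac{\partial^2 f}{\partial t^2}\in L_2(\Omega)$, $f(0,t)=f(p,t)=0$, and $\frac{\partial f}{\partial x}\in \mathrm{Lip}_\alpha[0,p]$ with respect to $x$, uniformly with respect to $t$, for some $0<\alpha<1$. Then: (i) the series (written out in the context) defining $u^+$, $\frac{\partial u^+}{\partial t}$, $\frac{\partial^2u^+}{\partial t^2}$, $\frac{\partial^2u^+}{\partial x^2}$ converge absolutely and uniformly in $\overline{\Omega^+}$, and the series defining $u^-$, $\frac{\partial u^-}{\partial t}$, $\frac{\partial^2u^-}{\partial x^2}$, $\frac{\partial^2u^-}{\partial t^2}$ converge absolutely and uniformly in $\overline{\Omega^-}$; (ii) the function $u$ equal to $u^+$ for $t>0$ and to $u^-$ for $t<0$ satisfies the equation $$u_{tt}-u_{xx}=f(x,t)\ \text{ in }\Omega^+,\qquad u_t+u_{xx}=f(x,t)\ \text{ in }\Omega^-,$$ the boundary conditions $u(0,t)=0$, $u(p,t)=0$ for $-T<t<T$, and the conjugation conditions $$u(x,+0)=u(x,-0),\quad u_t(x,+0)=u_t(x,-0),\quad u_{tt}(x,+0)=u_{tt}(x,-0),\qquad 0<x<p.$$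
   Context: $\Omega^+=\Omega\cap\{t>0\}$, $\Omega^-=\Omega\cap\{t<0\}$; $\pm0$ denote one-sided limits as $t\to0^\pm$. For $n=1,2,\dots$ put $$\lambda_n=\frac{n\pi}{p},\qquad X_n(x)=\sqrt{\tfrac2p}\,\sin\lambda_nx,\qquad f_n(t)=\int_0^pf(x,t)X_n(x)\,dx,$$ and let $f_n',f_n''$ be the derivatives of $f_n$ in $t$. "$\frac{\partial f}{\partial x}\in\mathrm{Lip}_\alpha[0,p]$ uniformly with respect to $t$" means that there is a constant $L$, independent of $t$, with $|f_x(x,t)-f_x(y,t)|\le L|x-y|^\alpha$ for all $x,y\in[0,p]$. The series are as follows. $$u^+(x,t)=\sum_{n=1}^\infty X_n(x)\Big[\tfrac{(1-\lambda_n^2)f_n(0)-f_n'(0)}{\lambda_n^2(\lambda_n^2+1)}\cos\lambda_nt+\tfrac{2f_n(0)-f_n'(0)}{\lambda_n(\lambda_n^2+1)}\sin\lambda_nt+\tfrac1{\lambda_n}\int_0^tf_n(\tau)\sin\lambda_n(t-\tau)\,d\tau\Big],$$ $$u^-(x,t)=\sum_{n=1}^\infty X_n(x)\Big[\tfrac{(1-\lambda_n^2)f_n(0)-f_n'(0)}{\lambda_n^2(\lambda_n^2+1)}e^{\lambda_n^2t}-\int_t^0f_n(\tau)e^{\lambda_n^2(t-\tau)}\,d\tau\Big],$$ $$\frac{\partial u^+}{\partial t}=\sum_{n=1}^\infty X_n(x)\Big[\tfrac{(\lambda_n^2-1)f_n(0)+f_n'(0)}{\lambda_n(\lambda_n^2+1)}\sin\lambda_nt+\tfrac{2f_n(0)-f_n'(0)}{\lambda_n^2+1}\cos\lambda_nt+\int_0^tf_n(\tau)\cos\lambda_n(t-\tau)\,d\tau\Big],$$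 $$\frac{\partial u^-}{\partial t}=\sum_{n=1}^\infty X_n(x)\Big[\tfrac{2f_n(0)-f_n'(0)}{\lambda_n^2+1}e^{\lambda_n^2t}-\int_t^0f_n'(\tau)e^{\lambda_n^2(t-\tau)}\,d\tau\Big],$$ $$\frac{\partial^2u^+}{\partial t^2}=\sum_{n=1}^\infty X_n(x)\Big[\tfrac{2\lambda_n^2f_n(0)+f_n'(0)}{\lambda_n^2+1}\cos\lambda_nt+\tfrac{(2\lambda_n^2+1)f_n'(0)-2\lambda_n^2f_n(0)}{\lambda_n(\lambda_n^2+1)}\sin\lambda_nt+\tfrac1{\lambda_n}\int_0^tf_n''(\tau)\sin\lambda_n(t-\tau)\,d\tau\Big],$$ $$\frac{\partial^2u^+}{\partial x^2}=\sum_{n=1}^\infty X_n(x)\Big[\tfrac{2\lambda_n^2f_n(0)+f_n'(0)}{\lambda_n^2+1}\cos\lambda_nt-f_n(t)+\tfrac{(2\lambda_n^2+1)f_n'(0)-2\lambda_n^2f_n(0)}{\lambda_n(\lambda_n^2+1)}\sin\lambda_nt+\tfrac1{\lambda_n}\int_0^tf_n''(\tau)\sin\lambda_n(t-\tau)\,d\tau\Big],$$ $$\frac{\partial^2u^-}{\partial x^2}=\sum_{n=1}^\infty X_n(x)\Big[\tfrac{f_n'(0)-2f_n(0)}{\lambda_n^2+1}e^{\lambda_n^2t}+f_n(t)+\int_t^0f_n'(\tau)e^{\lambda_n^2(t-\tau)}\,d\tau\Big],$$ $$\frac{\partial^2u^-}{\partial t^2}=\sum_{n=1}^\infty X_n(x)\Big[\tfrac{2\lambda_n^2f_n(0)+f_n'(0)}{\lambda_n^2+1}e^{\lambda_n^2t}-\int_t^0f_n''(\tau)e^{\lambda_n^2(t-\tau)}\,d\tau\Big].$$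 *)

theory Defs
  imports "HOL-Analysis.Analysis"
begin

definition Om :: "real \<Rightarrow> real \<Rightarrow> (real \<times> real) set" where
  "Om p T = {(x, t). 0 < x \<and> x < p \<and> - T < t \<and> t < T}"

definition Om_plus :: "real \<Rightarrow> real \<Rightarrow> (real \<times> real) set" where
  "Om_plus p T = Om p T \<inter> {(x, t). 0 < t}"

definition Om_minus :: "real \<Rightarrow> real \<Rightarrow> (real \<times> real) set" where
  "Om_minus p T = Om p T \<inter> {(x, t). t < 0}"

text \<open>
  \<open>f\<close> belongs to \<open>C\<^sup>1\<close> of the closure of the open set \<open>S\<close>: it is continuous there, and its partial
  derivatives on \<open>S\<close> extend continuously to the closure; \<open>fx\<close> and \<open>ft\<close> are these extensions.
\<close>

definition C1_closure ::
  "(real \<times> real) set \<Rightarrow> (real \<Rightarrow> real \<Rightarrow> real) \<Rightarrow> (real \<Rightarrow> real \<Rightarrow> real) \<Rightarrow> (real \<Rightarrow> real \<Rightarrow> real) \<Rightarrow> bool"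
where
  "C1_closure S f fx ft \<longleftrightarrow>
     continuous_on (closure S) (\<lambda>(x, t). f x t) \<and>
     continuous_on (closure S) (\<lambda>(x, t). fx x t) \<and>
     continuous_on (closure S) (\<lambda>(x, t). ft x t) \<and>
     (\<forall>(x, t)\<in>S. ((\<lambda>y. f y t) has_real_derivative fx x t) (at x) \<and>
                 ((\<lambda>s. f x s) has_real_derivative ft x t) (at t))"

primrec Ck :: "nat \<Rightarrow> (real \<times> real \<Rightarrow> real) \<Rightarrow> bool" where
  "Ck 0 \<phi> \<longleftrightarrow> continuous_on UNIV \<phi>"
| "Ck (Suc k) \<phi> \<longleftrightarrow>
     (\<exists>\<phi>x \<phi>t. (\<forall>z. (\<phi> has_derivative (\<lambda>h. fst h * \<phi>x z + snd h * \<phi>t z)) (at z)) \<and>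
              Ck k \<phi>x \<and> Ck k \<phi>t)"

definition test_function :: "(real \<times> real) set \<Rightarrow> (real \<times> real \<Rightarrow> real) \<Rightarrow> bool" where
  "test_function S \<phi> \<longleftrightarrow>
     (\<forall>k. Ck k \<phi>) \<and> compact (closure {z. \<phi> z \<noteq> 0}) \<and> closure {z. \<phi> z \<noteq> 0} \<subseteq> S"

definition L2_on :: "(real \<times> real) set \<Rightarrow> (real \<times> real \<Rightarrow> real) \<Rightarrow> bool" where
  "L2_on S g \<longleftrightarrow>
     g \<in> borel_measurable (lebesgue_on S) \<and> integrable (lebesgue_on S) (\<lambda>z. (g z)\<^sup>2)"

text \<open>
  The second \<open>t\<close>-derivative of \<open>f\<close>, in the sense of distributions on \<open>S\<close>, is the function \<open>g\<close>.
\<close>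

definition weak_tt_derivative ::
  "(real \<times> real) set \<Rightarrow> (real \<Rightarrow> real \<Rightarrow> real) \<Rightarrow> (real \<times> real \<Rightarrow> real) \<Rightarrow> bool"
where
  "weak_tt_derivative S f g \<longleftrightarrow>
     (\<forall>\<phi>. test_function S \<phi> \<longrightarrow>
        (\<integral>z. f (fst z) (snd z) * deriv (deriv (\<lambda>s. \<phi> (fst z, s))) (snd z) \<partial>lebesgue_on S) =
        (\<integral>z. g z * \<phi> z \<partial>lebesgue_on S))"

definition lam :: "real \<Rightarrow> nat \<Rightarrow> real" where
  "lam p n = real n * pi / p"

definition X :: "real \<Rightarrow> nat \<Rightarrow> real \<Rightarrow> real" where
  "X p n x = sqrt (2 / p) * sin (lam p n * x)"

definition fc :: "real \<Rightarrow> (real \<Rightarrow> real \<Rightarrow> real) \<Rightarrow> nat \<Rightarrow> real \<Rightarrow> real" where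
  "fc p f n t = integral {0..p} (\<lambda>x. f x t * X p n x)"

definition fc1 :: "real \<Rightarrow> (real \<Rightarrow> real \<Rightarrow> real) \<Rightarrow> nat \<Rightarrow> real \<Rightarrow> real" where
  "fc1 p f n = deriv (fc p f n)"

text \<open>
  When \<open>f\<close> is \<open>C\<^sup>1\<close> up to the boundary and its distributional derivative \<open>f\<^sub>t\<^sub>t\<close> is in \<open>L\<^sub>2\<close>, the
  function \<open>fc1 p f n\<close> is absolutely continuous, so its derivative exists almost everywhere.  The
  function \<open>fc2 p f n\<close> is used only under an integral sign, where the exceptional null set does not
  matter.
\<close>

definition fc2 :: "real \<Rightarrow> (real \<Rightarrow> real \<Rightarrow> real) \<Rightarrow> nat \<Rightarrow> real \<Rightarrow> real" where
  "fc2 p f n = deriv (fc1 p f n)"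

text \<open>
  The suffixes \<open>P\<close> and \<open>M\<close> refer to \<open>t > 0\<close> and \<open>t < 0\<close>.  All series are summed over \<open>n \<ge> 1\<close>; the
  terms with \<open>n = 0\<close> are never used.
\<close>

definition uP_term :: "real \<Rightarrow> (real \<Rightarrow> real \<Rightarrow> real) \<Rightarrow> nat \<Rightarrow> real \<Rightarrow> real \<Rightarrow> real" where
  "uP_term p f n x t = (let l = lam p n; a = fc p f n 0; b = fc1 p f n 0 in
     X p n x *
      (((1 - l\<^sup>2) * a - b) / (l\<^sup>2 * (l\<^sup>2 + 1)) * cos (l * t)
       + (2 * a - b) / (l * (l\<^sup>2 + 1)) * sin (l * t)
       + 1 / l * integral {0..t} (\<lambda>\<tau>. fc p f n \<tau> * sin (l * (t - \<tau>)))))"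

definition uM_term :: "real \<Rightarrow> (real \<Rightarrow> real \<Rightarrow> real) \<Rightarrow> nat \<Rightarrow> real \<Rightarrow> real \<Rightarrow> real" where
  "uM_term p f n x t = (let l = lam p n; a = fc p f n 0; b = fc1 p f n 0 in
     X p n x *
      (((1 - l\<^sup>2) * a - b) / (l\<^sup>2 * (l\<^sup>2 + 1)) * exp (l\<^sup>2 * t)
       - integral {t..0} (\<lambda>\<tau>. fc p f n \<tau> * exp (l\<^sup>2 * (t - \<tau>)))))"

definition utP_term :: "real \<Rightarrow> (real \<Rightarrow> real \<Rightarrow> real) \<Rightarrow> nat \<Rightarrow> real \<Rightarrow> real \<Rightarrow> real" where
  "utP_term p f n x t = (let l = lam p n; a = fc p f n 0; b = fc1 p f n 0 in
     X p n x *
      (((l\<^sup>2 - 1) * a + b) / (l * (l\<^sup>2 + 1)) * sin (l * t)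
       + (2 * a - b) / (l\<^sup>2 + 1) * cos (l * t)
       + integral {0..t} (\<lambda>\<tau>. fc p f n \<tau> * cos (l * (t - \<tau>)))))"

definition utM_term :: "real \<Rightarrow> (real \<Rightarrow> real \<Rightarrow> real) \<Rightarrow> nat \<Rightarrow> real \<Rightarrow> real \<Rightarrow> real" where
  "utM_term p f n x t = (let l = lam p n; a = fc p f n 0; b = fc1 p f n 0 in
     X p n x *
      ((2 * a - b) / (l\<^sup>2 + 1) * exp (l\<^sup>2 * t)
       - integral {t..0} (\<lambda>\<tau>. fc1 p f n \<tau> * exp (l\<^sup>2 * (t - \<tau>)))))"

definition uttP_term :: "real \<Rightarrow> (real \<Rightarrow> real \<Rightarrow> real) \<Rightarrow> nat \<Rightarrow> real \<Rightarrow> real \<Rightarrow> real" where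
  "uttP_term p f n x t = (let l = lam p n; a = fc p f n 0; b = fc1 p f n 0 in
     X p n x *
      ((2 * l\<^sup>2 * a + b) / (l\<^sup>2 + 1) * cos (l * t)
       + ((2 * l\<^sup>2 + 1) * b - 2 * l\<^sup>2 * a) / (l * (l\<^sup>2 + 1)) * sin (l * t)
       + 1 / l * integral {0..t} (\<lambda>\<tau>. fc2 p f n \<tau> * sin (l * (t - \<tau>)))))"

definition uxxP_term :: "real \<Rightarrow> (real \<Rightarrow> real \<Rightarrow> real) \<Rightarrow> nat \<Rightarrow> real \<Rightarrow> real \<Rightarrow> real" where
  "uxxP_term p f n x t = (let l = lam p n; a = fc p f n 0; b = fc1 p f n 0 in
     X p n x *
      ((2 * l\<^sup>2 * a + b) / (l\<^sup>2 + 1) * cos (l * t) - fc p f n t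
       + ((2 * l\<^sup>2 + 1) * b - 2 * l\<^sup>2 * a) / (l * (l\<^sup>2 + 1)) * sin (l * t)
       + 1 / l * integral {0..t} (\<lambda>\<tau>. fc2 p f n \<tau> * sin (l * (t - \<tau>)))))"

definition uxxM_term :: "real \<Rightarrow> (real \<Rightarrow> real \<Rightarrow> real) \<Rightarrow> nat \<Rightarrow> real \<Rightarrow> real \<Rightarrow> real" where
  "uxxM_term p f n x t = (let l = lam p n; a = fc p f n 0; b = fc1 p f n 0 in
     X p n x *
      ((b - 2 * a) / (l\<^sup>2 + 1) * exp (l\<^sup>2 * t) + fc p f n t
       + integral {t..0} (\<lambda>\<tau>. fc1 p f n \<tau> * exp (l\<^sup>2 * (t - \<tau>)))))"

definition uttM_term :: "real \<Rightarrow> (real \<Rightarrow> real \<Rightarrow> real) \<Rightarrow> nat \<Rightarrow> real \<Rightarrow> real \<Rightarrow> real" where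
  "uttM_term p f n x t = (let l = lam p n; a = fc p f n 0; b = fc1 p f n 0 in
     X p n x *
      ((2 * l\<^sup>2 * a + b) / (l\<^sup>2 + 1) * exp (l\<^sup>2 * t)
       - integral {t..0} (\<lambda>\<tau>. fc2 p f n \<tau> * exp (l\<^sup>2 * (t - \<tau>)))))"

definition abs_unif_convergent :: "(real \<times> real) set \<Rightarrow> (nat \<Rightarrow> real \<Rightarrow> real \<Rightarrow> real) \<Rightarrow> bool" where
  "abs_unif_convergent S a \<longleftrightarrow>
     (\<forall>(x, t)\<in>S. summable (\<lambda>n. \<bar>a (Suc n) x t\<bar>)) \<and>
     uniformly_convergent_on S (\<lambda>N (x, t). \<Sum>n=1..N. a n x t)"

definition ser :: "(nat \<Rightarrow> real \<Rightarrow> real \<Rightarrow> real) \<Rightarrow> real \<Rightarrow> real \<Rightarrow> real" where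
  "ser a x t = (\<Sum>n. a (Suc n) x t)"

text \<open>
  At \<open>t = 0\<close> the solution gets the value of the series for \<open>t > 0\<close>, so that the boundary conditions
  make sense there too; the series for \<open>t < 0\<close> has the same terms at \<open>t = 0\<close>.
\<close>

definition u :: "real \<Rightarrow> (real \<Rightarrow> real \<Rightarrow> real) \<Rightarrow> real \<Rightarrow> real \<Rightarrow> real" where
  "u p f x t = (if t < 0 then ser (uM_term p f) x t else ser (uP_term p f) x t)"

definition has_second_derivative :: "(real \<Rightarrow> real) \<Rightarrow> real \<Rightarrow> real \<Rightarrow> bool" where
  "has_second_derivative g d a \<longleftrightarrow>
     (\<forall>\<^sub>F s in nhds a. g field_differentiable at s) \<and> (deriv g has_real_derivative d) (at a)"

text \<open>
  The one-sided limits of \<open>g\<close> at \<open>0\<close> exist and \<open>g (+0) = g (-0)\<close>.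
\<close>

definition conjugate_at_0 :: "(real \<Rightarrow> real) \<Rightarrow> bool" where
  "conjugate_at_0 g \<longleftrightarrow> (\<exists>l. (g \<longlongrightarrow> l) (at_right 0) \<and> (g \<longlongrightarrow> l) (at_left 0))"

end

theory Submission
  imports Defs
begin

text \<open>
  Expansion in the sines \<open>X p n\<close> reduces the problem to one ordinary differential equation per mode:
  \<open>c'' + \<lambda>\<^sup>2 c = f\<^sub>n\<close> for \<open>t > 0\<close> and \<open>c' - \<lambda>\<^sup>2 c = f\<^sub>n\<close> for \<open>t < 0\<close>.  The coefficients in the series are those for
  which \<open>c\<close>, \<open>c'\<close> and \<open>c''\<close> agree from both sides at \<open>t = 0\<close> (\<open>modes_at_0\<close>).  The series for the derivatives of \<open>u\<close>
  arise when the Duhamel integrals are integrated by parts, so that the derivatives fall on \<open>f\<^sub>n\<close>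
  (\<open>modeP''_eq\<close>, \<open>modeM'_eq\<close>, \<open>modeM''_eq\<close>).

  Termwise differentiation is justified by a summable bound for the modes and their derivatives
  (\<open>mode_majorant\<close>).  It has three sources.  Since \<open>f\<close> vanishes at \<open>x = 0\<close> and \<open>x = p\<close> and \<open>f\<^sub>x\<close> is Hoelder
  continuous in \<open>x\<close>, the coefficients \<open>f\<^sub>n t\<close> are of order \<open>n\<close> to the power \<open>- 1 - \<alpha>\<close>, uniformly in \<open>t\<close>
  (\<open>abs_coefficient_le_Hoelder\<close>).  Bessel's inequality makes the numbers \<open>f\<^sub>n' 0\<close> square summable, and they always
  come with a factor \<open>1 / \<lambda>\<close>.  Bessel's inequality on almost every line \<open>t = const\<close>, together with Fubini's theorem,
  makes the squared \<open>L\<^sub>2\<close> norms of the functions \<open>f\<^sub>n''\<close> summable; their Duhamel integrals gain a factor \<open>1 / \<lambda>\<close> as well,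
  and products of two square summable factors are summable.

  The second derivative of \<open>f\<close> in \<open>t\<close> is given only in the sense of distributions.  Testing with products of \<open>X p n x\<close>
  and a function of \<open>t\<close>, both cut off smoothly, yields square integrable functions \<open>w n\<close> that satisfy the rule of
  integration by parts as derivatives of \<open>f\<^sub>n'\<close> (\<open>weak_tt_coefficients\<close>).  In particular \<open>f\<^sub>n'\<close> is an indefinite
  integral of \<open>w n\<close>, and by the Lebesgue differentiation theorem (\<open>negligible_not_deriv_indefinite_integral\<close>) the
  pointwise derivative \<open>f\<^sub>n''\<close> equals \<open>w n\<close> almost everywhere.

  The differential equations for the modes add up to those for \<open>u\<close> because \<open>f\<close> is the sum of its sine series.  That
  series converges uniformly, and its sum must be \<open>f\<close>, because a continuous function whose sine coefficients all
  vanish is zero (\<open>zero_if_sine_coefficients_zero\<close>).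
\<close>

section \<open>The orthonormal sine system\<close>

lemma has_integral_cos_multiple:
  fixes p :: real and m :: int
  assumes "0 < p"
  shows "((\<lambda>x. cos (of_int m * pi / p * x)) has_integral (if m = 0 then p else 0)) {0..p}"
proof (cases "m = 0")
  case True
  then show ?thesis using has_integral_const_real[of "1::real" 0 p] assms by simp
next
  case False
  define k where "k = of_int m * pi / p"
  have k: "k \<noteq> 0" using False assms by (simp add: k_def)
  have "((\<lambda>x. cos (k * x)) has_integral (sin (k * p) / k - sin (k * 0) / k)) {0..p}"
    using assms k
    by (intro fundamental_theorem_of_calculus)
      (auto intro!: derivative_eq_intros simp: has_real_derivative_iff_has_vector_derivative[symmetric])
  moreover have "sin (k * p) = 0" using assms by (simp add: k_def sin_zero_iff_int2)
  ultimately show ?thesis using False by (simp add: k_def)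
qed

lemma X_orthonormal:
  assumes p: "0 < p" and "1 \<le> n" "1 \<le> m"
  shows "((\<lambda>x. X p n x * X p m x) has_integral (if n = m then 1 else 0)) {0..p}"
proof -
  have eq: "X p n x * X p m x =
     1 / p * (cos (of_int (int n - int m) * pi / p * x) - cos (of_int (int n + int m) * pi / p * x))" for x
  proof -
    have 1: "of_int (int n - int m) * pi / p * x = lam p n * x - lam p m * x"
         "of_int (int n + int m) * pi / p * x = lam p n * x + lam p m * x"
      using p by (simp_all add: lam_def field_simps)
    have "X p n x * X p m x = (sqrt (2/p) * sqrt (2/p)) * (sin (lam p n * x) * sin (lam p m * x))"
      unfolding X_def by (simp only: mult_ac)
    also have "sqrt (2/p) * sqrt (2/p) = 2 / p" using p by simp
    finally show ?thesis unfolding 1 cos_diff cos_add by (simp add: field_simps)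
  qed
  have "((\<lambda>x. 1 / p * (cos (of_int (int n - int m) * pi / p * x) - cos (of_int (int n + int m) * pi / p * x)))
     has_integral 1 / p * ((if int n - int m = 0 then p else 0) - (if int n + int m = 0 then p else 0))) {0..p}"
    by (intro has_integral_mult_right has_integral_diff has_integral_cos_multiple p)
  moreover have "1 / p * ((if int n - int m = 0 then p else 0) - (if int n + int m = 0 then p else 0)) = (if n = m then 1 else 0)"
    using assms by auto
  ultimately show ?thesis unfolding eq by simp
qed

lemma continuous_on_X [continuous_intros]:
  assumes "continuous_on A g"
  shows "continuous_on A (\<lambda>x. X p n (g x))"
proof -
  have "continuous_on UNIV (X p n)" unfolding X_def by (intro continuous_intros)
  then show ?thesis using assms by (rule continuous_on_compose2) simp
qed

lemma borel_measurable_X [measurable]: "X p n \<in> borel_measurable borel"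
  by (intro borel_measurable_continuous_onI continuous_intros)

lemma abs_X_le: "\<bar>X p n x\<bar> \<le> sqrt \<bar>2 / p\<bar>"
proof -
  have "\<bar>X p n x\<bar> = sqrt \<bar>2 / p\<bar> * \<bar>sin (lam p n * x)\<bar>"
    by (simp add: X_def abs_mult real_sqrt_abs2 flip: real_sqrt_abs')
  also have "\<dots> \<le> sqrt \<bar>2 / p\<bar> * 1" by (intro mult_left_mono) auto
  finally show ?thesis by simp
qed

text \<open>
  The square of the distance from \<open>h\<close> to its \<open>N\<close>-th partial sum is nonnegative, and by orthonormality it
  equals \<open>\<integral> h\<^sup>2\<close> minus the sum of the squared coefficients.  Lebesgue integrals are used so that the
  inequality applies to almost every slice of a function that is merely square integrable.
\<close>

lemma Bessel_X:
  fixes h :: "real \<Rightarrow> real"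
  assumes p: "0 < p" and h [measurable]: "h \<in> borel_measurable borel"
    and supp: "\<And>x. x \<notin> {0..p} \<Longrightarrow> h x = 0" and h2: "integrable lborel (\<lambda>x. (h x)\<^sup>2)"
  shows "(\<Sum>n=1..N. (\<integral>x. h x * X p n x \<partial>lborel)\<^sup>2) \<le> (\<integral>x. (h x)\<^sup>2 \<partial>lborel)"
proof -
  define c where "c n = (\<integral>x. h x * X p n x \<partial>lborel)" for n
  have ind: "integrable lborel (\<lambda>x. indicator {0..p} x :: real)" using p by (intro integrable_real_indicator) auto
  have int_h: "integrable lborel h"
  proof (rule Bochner_Integration.integrable_bound[OF Bochner_Integration.integrable_add[OF ind h2]])
    show "AE x in lborel. norm (h x) \<le> norm (indicat_real {0..p} x + (h x)\<^sup>2)"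
    proof (rule AE_I2)
      fix x
      have "0 \<le> (\<bar>h x\<bar> - 1)\<^sup>2" by simp
      then have "2 * \<bar>h x\<bar> \<le> 1 + (h x)\<^sup>2" unfolding power2_diff by simp
      then show "norm (h x) \<le> norm (indicat_real {0..p} x + (h x)\<^sup>2)"
        using supp[of x] by (cases "x \<in> {0..p}") auto
    qed
  qed simp
  have int_hX: "integrable lborel (\<lambda>x. h x * X p n x)" for n
    by (rule Bochner_Integration.integrable_bound[OF integrable_mult_right[OF int_h, of "sqrt \<bar>2/p\<bar>"]])
      (auto intro!: AE_I2 mult_mono simp: abs_mult mult.commute abs_X_le[simplified])
  have XX: "integrable lborel (\<lambda>x. indicator {0..p} x * (X p n x * X p m x))"
    "n \<ge> 1 \<Longrightarrow> m \<ge> 1 \<Longrightarrow> (\<integral>x. indicator {0..p} x * (X p n x * X p m x) \<partial>lborel) = (if n = m then 1 else 0)" for n m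
  proof -
    have "set_integrable lborel {0..p} (\<lambda>x. X p n x * X p m x)"
      by (intro borel_integrable_atLeastAtMost' continuous_intros)
    note this set_borel_integral_eq_integral(2)[OF this]
    then show "integrable lborel (\<lambda>x. indicator {0..p} x * (X p n x * X p m x))"
      "n \<ge> 1 \<Longrightarrow> m \<ge> 1 \<Longrightarrow> (\<integral>x. indicator {0..p} x * (X p n x * X p m x) \<partial>lborel) = (if n = m then 1 else 0)"
      using integral_unique[OF X_orthonormal[OF p, of n m]]
      by (auto simp: set_integrable_def set_lebesgue_integral_def)
  qed
  let ?s = "\<lambda>x. indicator {0..p} x * (\<Sum>n=1..N. c n * X p n x)"
  have expand: "(h x - ?s x)\<^sup>2 = (h x)\<^sup>2 - 2 * (\<Sum>n=1..N. c n * (h x * X p n x))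
       + (\<Sum>n=1..N. \<Sum>m=1..N. c n * c m * (indicator {0..p} x * (X p n x * X p m x)))" for x
  proof (cases "x \<in> {0..p}")
    case True
    have "(\<Sum>n=1..N. c n * X p n x)\<^sup>2 = (\<Sum>n=1..N. \<Sum>m=1..N. c n * c m * (X p n x * X p m x))"
      unfolding power2_eq_square sum_product by (intro sum.cong refl) (simp add: mult_ac)
    moreover have "h x * (\<Sum>n=1..N. c n * X p n x) = (\<Sum>n=1..N. c n * (h x * X p n x))"
      unfolding sum_distrib_left by (intro sum.cong refl) (simp add: mult_ac)
    ultimately show ?thesis using True by (simp add: power2_diff mult.assoc)
  next
    case False
    then show ?thesis using supp[of x] by simp
  qed
  have "0 \<le> (\<integral>x. (h x - ?s x)\<^sup>2 \<partial>lborel)" by simp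
  also have "\<dots> = (\<integral>x. (h x)\<^sup>2 \<partial>lborel) - 2 * (\<Sum>n=1..N. c n * c n)
       + (\<Sum>n=1..N. \<Sum>m=1..N. c n * c m * (if n = m then 1 else 0))"
    unfolding expand using h2 int_hX XX
    by (simp add: Bochner_Integration.integral_add Bochner_Integration.integral_diff
        Bochner_Integration.integral_sum c_def[symmetric])
  also have "(\<Sum>n=1..N. \<Sum>m=1..N. c n * c m * (if n = m then 1 else 0)) = (\<Sum>n=1..N. c n * c n)"
    by (intro sum.cong refl) (simp add: if_distrib cong: if_cong)
  finally show ?thesis by (simp add: c_def power2_eq_square)
qed

text \<open>
  A shift by half a period, \<open>p / n\<close>, changes the sign of the cosine.  Averaging the integral with its
  shifted copy replaces \<open>\<phi>\<close> by the differences \<open>\<phi> x - \<phi> (x + p / n)\<close>, up to two end pieces of length \<open>p / n\<close>.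
\<close>

lemma abs_integral_cos_le_Hoelder:
  fixes \<phi> :: "real \<Rightarrow> real"
  assumes p: "0 < p" and n: "1 \<le> n" and cont: "continuous_on {0..p} \<phi>"
    and M: "\<And>x. x \<in> {0..p} \<Longrightarrow> \<bar>\<phi> x\<bar> \<le> M"
    and L: "\<And>x y. x \<in> {0..p} \<Longrightarrow> y \<in> {0..p} \<Longrightarrow> \<bar>\<phi> x - \<phi> y\<bar> \<le> L * \<bar>x - y\<bar> powr \<alpha>"
  shows "\<bar>integral {0..p} (\<lambda>x. \<phi> x * cos (lam p n * x))\<bar>
     \<le> (p / n) * M + p * (L * (p / n) powr \<alpha>)"
proof -
  define h where "h = p / n"
  have h: "0 < h" "h \<le> p" using p n by (auto simp: h_def field_simps)
  have shift: "cos (lam p n * (x + h)) = - cos (lam p n * x)" for x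
  proof -
    have "lam p n * (x + h) = lam p n * x + pi" using p n by (simp add: lam_def h_def field_simps)
    then show ?thesis by simp
  qed
  let ?g = "\<lambda>x. \<phi> x * cos (lam p n * x)"
  have cg: "continuous_on {0..p} ?g" by (intro continuous_intros cont)
  have int: "?g integrable_on {a..b}" if "0 \<le> a" "b \<le> p" for a b
    using that by (intro integrable_continuous_real continuous_on_subset[OF cg]) auto
  have sh: "continuous_on {0..p-h} (\<lambda>x. \<phi> (x + h))"
    by (rule continuous_on_compose2[OF cont]) (use h in \<open>auto intro!: continuous_intros\<close>)
  have M0: "0 \<le> M" using M[of 0] p by simp
  have L0: "0 \<le> L * h powr \<alpha>" using L[of 0 h] h by (simp add: order_trans[OF abs_ge_zero])
  have 1: "integral {0..p} ?g = integral {0..h} ?g + integral {h..p} ?g"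
    using h int by (simp add: Henstock_Kurzweil_Integration.integral_combine)
  have 2: "integral {0..p} ?g = integral {0..p-h} ?g + integral {p-h..p} ?g"
    using h int by (simp add: Henstock_Kurzweil_Integration.integral_combine)
  have "integral {h..p} ?g = integral {0..p-h} (?g \<circ> (\<lambda>x. x + h))"
    by (subst integral_shift) (use h in \<open>auto intro: continuous_on_subset[OF cg]\<close>)
  also have "\<dots> = - integral {0..p-h} (\<lambda>x. \<phi> (x + h) * cos (lam p n * x))"
    by (simp add: o_def shift)
  finally have "2 * integral {0..p} ?g = integral {0..h} ?g + integral {p-h..p} ?g
      + (integral {0..p-h} ?g - integral {0..p-h} (\<lambda>x. \<phi> (x + h) * cos (lam p n * x)))"
    using 1 2 by simp
  also have "integral {0..p-h} ?g - integral {0..p-h} (\<lambda>x. \<phi> (x + h) * cos (lam p n * x))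
     = integral {0..p-h} (\<lambda>x. (\<phi> x - \<phi> (x + h)) * cos (lam p n * x))"
    unfolding left_diff_distrib
    by (intro Henstock_Kurzweil_Integration.integral_diff[symmetric] integrable_continuous_real continuous_intros sh
        continuous_on_subset[OF cont]) (use h in auto)
  finally have eq: "2 * integral {0..p} ?g = integral {0..h} ?g + integral {p-h..p} ?g
      + integral {0..p-h} (\<lambda>x. (\<phi> x - \<phi> (x + h)) * cos (lam p n * x))" .
  have prod: "\<bar>a * cos y\<bar> \<le> B" if "\<bar>a\<bar> \<le> B" for a y B :: real
    using mult_mono[of "\<bar>a\<bar>" B "\<bar>cos y\<bar>" 1] that by (simp add: abs_mult)
  have "norm (integral {0..h} ?g) \<le> M * (h - 0)" "norm (integral {p-h..p} ?g) \<le> M * (p - (p - h))"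
    using h by (intro integral_bound continuous_on_subset[OF cg]; auto intro!: prod M)+
  moreover have "norm (integral {0..p-h} (\<lambda>x. (\<phi> x - \<phi> (x + h)) * cos (lam p n * x)))
     \<le> (L * h powr \<alpha>) * (p - h - 0)"
  proof (rule integral_bound)
    show "continuous_on {0..p-h} (\<lambda>x. (\<phi> x - \<phi> (x + h)) * cos (lam p n * x))"
      by (intro continuous_intros sh continuous_on_subset[OF cont]) (use h in auto)
    show "norm ((\<phi> t - \<phi> (t + h)) * cos (lam p n * t)) \<le> L * h powr \<alpha>" if "t \<in> {0..p-h}" for t
      using L[of t "t+h"] that h by (auto intro!: prod)
  qed (use h in auto)
  moreover have "(L * h powr \<alpha>) * (p - h - 0) \<le> 2 * (p * (L * h powr \<alpha>))"
    using h L0 p mult_right_mono[of "p - h" "2 * p" "L * h powr \<alpha>"] by (simp add: mult_ac)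
  ultimately have "2 * \<bar>integral {0..p} ?g\<bar> \<le> 2 * (h * M) + 2 * (p * (L * h powr \<alpha>))"
    using eq by (simp add: mult.commute[of M])
  then show ?thesis by (simp add: h_def)
qed

text \<open>
  With \<open>\<theta> = \<pi> x / p\<close>, the product formula for \<open>sin (n \<theta>) cos \<theta>\<close> shows that \<open>d\<close> is orthogonal to
  \<open>sin \<theta> q (cos \<theta>)\<close> for every polynomial \<open>q\<close>.  By the Weierstrass theorem, \<open>q (cos \<theta>)\<close> can be taken uniformly
  close to \<open>d\<close> itself, because \<open>cos\<close> is injective on the interval; hence \<open>\<integral> d\<^sup>2 sin \<theta> = 0\<close>.
\<close>

lemma zero_if_sine_coefficients_zero:
  fixes d :: "real \<Rightarrow> real"
  assumes p: "0 < p" and d: "continuous_on {0..p} d"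
    and zero: "\<And>n. 1 \<le> n \<Longrightarrow> integral {0..p} (\<lambda>x. d x * X p n x) = 0"
    and x: "x \<in> {0<..<p}"
  shows "d x = 0"
proof -
  let ?c = "\<lambda>x. cos (lam p 1 * x)" and ?s = "\<lambda>x. sin (lam p 1 * x)"
  have trig: "integral {0..p} (\<lambda>x. d x * sin (lam p n * x) * ?c x ^ m) = 0" for n m
  proof (induction m arbitrary: n)
    case 0
    show ?case
    proof (cases "n = 0")
      case False
      have "integral {0..p} (\<lambda>x. d x * X p n x) = sqrt (2/p) * integral {0..p} (\<lambda>x. d x * sin (lam p n * x))"
        unfolding X_def mult.left_commute[of "d _"] integral_mult_right ..
      then show ?thesis using zero[of n] False p by simp
    qed (simp add: lam_def)
  next
    case (Suc m)
    show ?case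
    proof (cases "n = 0")
      case False
      have prod: "sin (lam p n * x) * ?c x = (sin (lam p (n+1) * x) + sin (lam p (n-1) * x)) / 2" for x
      proof -
        have e: "lam p (n+1) * x = lam p n * x + lam p 1 * x" "lam p (n-1) * x = lam p n * x - lam p 1 * x"
          using False p by (auto simp: lam_def field_simps of_nat_diff)
        show ?thesis unfolding e sin_add sin_diff by simp
      qed
      have "integral {0..p} (\<lambda>x. d x * sin (lam p n * x) * ?c x ^ Suc m)
        = integral {0..p} (\<lambda>x. (1/2) * (d x * sin (lam p (n+1) * x) * ?c x ^ m + d x * sin (lam p (n-1) * x) * ?c x ^ m))"
      proof (rule integral_cong)
        fix x
        have "d x * sin (lam p n * x) * ?c x ^ Suc m = d x * (sin (lam p n * x) * ?c x) * ?c x ^ m" by simp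
        then show "d x * sin (lam p n * x) * ?c x ^ Suc m =
          (1/2) * (d x * sin (lam p (n+1) * x) * ?c x ^ m + d x * sin (lam p (n-1) * x) * ?c x ^ m)"
          unfolding prod by (simp add: field_simps)
      qed
      also have "\<dots> = (1/2) * (integral {0..p} (\<lambda>x. d x * sin (lam p (n+1) * x) * ?c x ^ m)
          + integral {0..p} (\<lambda>x. d x * sin (lam p (n-1) * x) * ?c x ^ m))"
        unfolding integral_mult_right
        by (subst Henstock_Kurzweil_Integration.integral_add)
          (intro integrable_continuous_real continuous_intros d refl)+
      also have "\<dots> = 0" unfolding Suc.IH by simp
      finally show ?thesis .
    qed (simp add: lam_def)
  qed
  have poly: "integral {0..p} (\<lambda>x. d x * ?s x * q (?c x)) = 0" if "real_polynomial_function q" for q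
  proof -
    obtain a N where q: "q = (\<lambda>y. \<Sum>i\<le>N. a i * y ^ i)" using \<open>real_polynomial_function q\<close>
      unfolding real_polynomial_function_iff_sum by blast
    have "integral {0..p} (\<lambda>x. d x * ?s x * q (?c x))
      = integral {0..p} (\<lambda>x. \<Sum>i\<le>N. a i * (d x * ?s x * ?c x ^ i))"
      unfolding q sum_distrib_left by (intro integral_cong sum.cong) auto
    also have "\<dots> = (\<Sum>i\<le>N. a i * integral {0..p} (\<lambda>x. d x * ?s x * ?c x ^ i))"
      by (subst integral_sum) (auto intro!: integrable_continuous_real continuous_intros d)
    finally show ?thesis using trig[of 1] by simp
  qed
  have arg: "0 \<le> lam p 1 * x" "lam p 1 * x \<le> pi" if "x \<in> {0..p}" for x
    using that p by (auto simp: lam_def field_simps)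
  have s0: "0 \<le> ?s x" if "x \<in> {0..p}" for x using arg[OF that] by (simp add: sin_ge_zero)
  obtain B where "\<forall>x\<in>{0..p}. \<bar>d x\<bar> \<le> B"
    using compact_imp_bounded[OF compact_continuous_image[OF d]] unfolding bounded_iff by auto
  then have B: "\<bar>d x\<bar> \<le> B" if "x \<in> {0..p}" for x using that by blast
  have B0: "0 \<le> B" using B[of 0] p by simp
  \<comment> \<open>Subtracting the vanishing integral against \<open>q (cos \<theta>)\<close> turns one factor \<open>d\<close> into the small \<open>d - q (cos \<theta>)\<close>.\<close>
  have small: "integral {0..p} (\<lambda>x. (d x)\<^sup>2 * ?s x) \<le> \<epsilon> * (B * p)" if \<epsilon>: "0 < \<epsilon>" for \<epsilon>
  proof -
    have "continuous_on {-1..1} (\<lambda>y. d (p / pi * arccos y))"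
      by (rule continuous_on_compose2[OF d])
        (use p in \<open>auto intro!: continuous_intros mult_nonneg_nonneg arccos_lbound arccos_ubound simp: field_simps\<close>)
    then obtain q where q: "real_polynomial_function q" "\<And>y. y \<in> {-1..1} \<Longrightarrow> \<bar>d (p / pi * arccos y) - q y\<bar> < \<epsilon>"
      using Stone_Weierstrass_real_polynomial_function[of "{-1..1}" _ \<epsilon>] \<epsilon> by (metis compact_Icc)
    have close: "\<bar>d x - q (?c x)\<bar> \<le> \<epsilon>" if x: "x \<in> {0..p}" for x
      using q(2)[of "?c x"] arccos_cos[OF arg[OF x]] p by (simp add: lam_def)
    have cq: "continuous_on A (\<lambda>x. q (?c x))" for A
      by (rule continuous_on_compose2[OF continuous_on_polymonial_function[of q UNIV]])
        (use q(1) in \<open>auto simp: real_polynomial_function_eq intro!: continuous_intros\<close>)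
    have "integral {0..p} (\<lambda>x. (d x)\<^sup>2 * ?s x) = integral {0..p} (\<lambda>x. (d x)\<^sup>2 * ?s x) - integral {0..p} (\<lambda>x. d x * ?s x * q (?c x))"
      using poly[OF q(1)] by simp
    also have "\<dots> = integral {0..p} (\<lambda>x. (d x)\<^sup>2 * ?s x - d x * ?s x * q (?c x))"
      by (intro Henstock_Kurzweil_Integration.integral_diff[symmetric] integrable_continuous_real continuous_intros d cq)
    also have "\<dots> = integral {0..p} (\<lambda>x. d x * ?s x * (d x - q (?c x)))"
      by (intro integral_cong) (simp add: algebra_simps power2_eq_square)
    also have "\<dots> \<le> (B * 1 * \<epsilon>) * (p - 0)"
    proof -
      have "norm (integral {0..p} (\<lambda>x. d x * ?s x * (d x - q (?c x)))) \<le> (B * 1 * \<epsilon>) * (p - 0)"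
      proof (rule integral_bound)
        show "continuous_on {0..p} (\<lambda>x. d x * ?s x * (d x - q (?c x)))"
          by (intro continuous_intros d cq)
        show "norm (d x * ?s x * (d x - q (?c x))) \<le> B * 1 * \<epsilon>" if "x \<in> {0..p}" for x
          unfolding real_norm_def abs_mult using that B0 by (intro mult_mono B close) auto
      qed (use p in auto)
      then show ?thesis by simp
    qed
    finally show ?thesis by (simp add: mult_ac)
  qed
  have cont: "continuous_on {0..p} (\<lambda>x. (d x)\<^sup>2 * ?s x)" by (intro continuous_intros d)
  have nn: "\<And>x. x \<in> {0..p} \<Longrightarrow> 0 \<le> (d x)\<^sup>2 * ?s x" using s0 by simp
  have "integral {0..p} (\<lambda>x. (d x)\<^sup>2 * ?s x) \<le> 0"
  proof (rule field_le_epsilon)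
    fix e :: real assume e: "0 < e"
    have Bp: "0 \<le> B * p" using B0 p by simp
    have "integral {0..p} (\<lambda>x. (d x)\<^sup>2 * ?s x) \<le> e / (B * p + 1) * (B * p)"
      using e Bp by (intro small) (auto intro!: divide_pos_pos add_nonneg_pos)
    also have "\<dots> \<le> e" using e Bp by (simp add: divide_le_eq)
    finally show "integral {0..p} (\<lambda>x. (d x)\<^sup>2 * ?s x) \<le> 0 + e" by simp
  qed
  moreover have "0 \<le> integral {0..p} (\<lambda>x. (d x)\<^sup>2 * ?s x)"
    by (intro Henstock_Kurzweil_Integration.integral_nonneg integrable_continuous_real cont nn)
  ultimately have "integral {0..p} (\<lambda>x. (d x)\<^sup>2 * ?s x) = 0" by simp
  then have "(d x)\<^sup>2 * ?s x = 0"
    using integral_eq_0_iff[OF cont _ nn] p x by auto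
  moreover have "0 < ?s x"
    using x p by (intro sin_gt_zero) (auto simp: lam_def field_simps)
  ultimately show ?thesis by simp
qed

section \<open>Sine coefficients of functions of two variables\<close>

lemma lam_pos: "0 < p \<Longrightarrow> 1 \<le> n \<Longrightarrow> 0 < lam p n"
  by (simp add: lam_def)

lemma abs_coefficient_le:
  assumes p: "0 < p" and g: "continuous_on {0..p} g" and M: "\<And>x. x \<in> {0..p} \<Longrightarrow> \<bar>g x\<bar> \<le> M"
  shows "\<bar>integral {0..p} (\<lambda>x. g x * X p n x)\<bar> \<le> M * sqrt \<bar>2 / p\<bar> * p"
proof -
  have M0: "0 \<le> M" using M[of 0] p by simp
  have "norm (integral {0..p} (\<lambda>x. g x * X p n x)) \<le> M * sqrt \<bar>2 / p\<bar> * (p - 0)"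
  proof (rule integral_bound)
    show "continuous_on {0..p} (\<lambda>x. g x * X p n x)" by (intro continuous_intros g)
    show "norm (g x * X p n x) \<le> M * sqrt \<bar>2 / p\<bar>" if "x \<in> {0..p}" for x
      unfolding real_norm_def abs_mult by (intro mult_mono M that abs_X_le M0) simp
  qed (use p in simp)
  then show ?thesis by simp
qed

text \<open>
  One integration by parts, with boundary terms that vanish because \<open>g\<close> does, gains a factor \<open>1 / n\<close>; the
  Hoelder continuity of \<open>g'\<close> gains another \<open>n\<close> to the power \<open>-\<alpha>\<close>.  The exponent \<open>1 + \<alpha>\<close> makes the bound summable.
\<close>

lemma abs_coefficient_le_Hoelder:
  assumes p: "0 < p" and n: "1 \<le> n" and g: "continuous_on {0..p} g" and g': "continuous_on {0..p} g'"
    and D: "\<And>x. x \<in> {0<..<p} \<Longrightarrow> (g has_real_derivative g' x) (at x)" and g0: "g 0 = 0" "g p = 0"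
    and M: "\<And>x. x \<in> {0..p} \<Longrightarrow> \<bar>g' x\<bar> \<le> M"
    and L: "\<And>x y. x \<in> {0..p} \<Longrightarrow> y \<in> {0..p} \<Longrightarrow> \<bar>g' x - g' y\<bar> \<le> L * \<bar>x - y\<bar> powr \<alpha>"
  shows "\<bar>integral {0..p} (\<lambda>x. g x * X p n x)\<bar>
     \<le> sqrt (2 / p) / lam p n * ((p / n) * M + p * (L * (p / n) powr \<alpha>))"
proof -
  let ?l = "lam p n"
  have l: "0 < ?l" using p n by (rule lam_pos)
  have I: "((\<lambda>x. g x * (- sin (?l * x) )) has_integral integral {0..p} (\<lambda>x. g x * (- sin (?l * x)))) {0..p}"
    by (intro integrable_integral integrable_continuous_real continuous_intros g)
  have P: "((\<lambda>x. g' x * (1 / ?l * cos (?l * x))) has_integral - integral {0..p} (\<lambda>x. g x * (- sin (?l * x)))) {0..p}"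
  proof (rule integration_by_parts_interior[OF bounded_bilinear_mult, where f = g and g' = "\<lambda>x. - sin (?l * x)"])
    show "((\<lambda>x. 1 / ?l * cos (?l * x)) has_vector_derivative - sin (?l * x)) (at x)" for x
      unfolding has_real_derivative_iff_has_vector_derivative[symmetric]
      using l by (auto intro!: derivative_eq_intros)
    show "((\<lambda>x. g x * - sin (?l * x)) has_integral g p * (1 / ?l * cos (?l * p)) - g 0 * (1 / ?l * cos (?l * 0))
        - - integral {0..p} (\<lambda>x. g x * - sin (?l * x))) {0..p}"
      using I g0 by simp
  qed (use p g D l in \<open>auto simp: has_real_derivative_iff_has_vector_derivative[symmetric] intro!: continuous_intros\<close>)
  have "integral {0..p} (\<lambda>x. g' x * (1 / ?l * cos (?l * x))) = - integral {0..p} (\<lambda>x. g x * (- sin (?l * x)))"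
    by (rule integral_unique[OF P])
  also have "\<dots> = integral {0..p} (\<lambda>x. g x * sin (?l * x))" by simp
  finally have "integral {0..p} (\<lambda>x. g' x * (1 / ?l * cos (?l * x))) = integral {0..p} (\<lambda>x. g x * sin (?l * x))" .
  moreover have "integral {0..p} (\<lambda>x. g' x * (1 / ?l * cos (?l * x))) = 1 / ?l * integral {0..p} (\<lambda>x. g' x * cos (?l * x))"
    unfolding mult.left_commute[of "g' _"] by (rule integral_mult_right)
  moreover have "integral {0..p} (\<lambda>x. g x * X p n x) = sqrt (2 / p) * integral {0..p} (\<lambda>x. g x * sin (?l * x))"
    unfolding X_def mult.left_commute[of "g _"] by (rule integral_mult_right)
  ultimately have "integral {0..p} (\<lambda>x. g x * X p n x) = sqrt (2 / p) * (1 / ?l * integral {0..p} (\<lambda>x. g' x * cos (?l * x)))"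
    by metis
  then have "\<bar>integral {0..p} (\<lambda>x. g x * X p n x)\<bar> = sqrt (2 / p) / ?l * \<bar>integral {0..p} (\<lambda>x. g' x * cos (?l * x))\<bar>"
    using l p by (simp add: abs_mult)
  also have "\<dots> \<le> sqrt (2 / p) / ?l * ((p / n) * M + p * (L * (p / n) powr \<alpha>))"
    using l p by (intro mult_left_mono abs_integral_cos_le_Hoelder n g' M L) auto
  finally show ?thesis .
qed

lemma summable_Hoelder_bound:
  assumes p: "0 < p" and \<alpha>: "0 < \<alpha>"
  shows "summable (\<lambda>n. sqrt (2 / p) / lam p (Suc n) * ((p / Suc n) * M + p * (L * (p / Suc n) powr \<alpha>)))"
proof -
  have "summable (\<lambda>n. real (Suc n) powr (-2))" "summable (\<lambda>n. real (Suc n) powr (- 1 - \<alpha>))"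
    using \<alpha> by (simp_all only: summable_Suc_iff[of "\<lambda>n. real n powr _"] summable_real_powr_iff)
  then have "summable (\<lambda>n. sqrt (2 / p) * (p / pi) * p * M * real (Suc n) powr (-2)
      + sqrt (2 / p) * (p / pi) * p * L * p powr \<alpha> * real (Suc n) powr (- 1 - \<alpha>))"
    by (intro summable_add summable_mult)
  moreover have "sqrt (2 / p) / lam p (Suc n) * ((p / Suc n) * M + p * (L * (p / Suc n) powr \<alpha>)) =
      sqrt (2 / p) * (p / pi) * p * M * real (Suc n) powr (-2)
      + sqrt (2 / p) * (p / pi) * p * L * p powr \<alpha> * real (Suc n) powr (- 1 - \<alpha>)" for n
  proof -
    define m where "m = real (Suc n)"
    have m: "0 < m" by (simp add: m_def)
    have e: "m powr (-2) = 1 / (m * m)" "m powr (- 1 - \<alpha>) = 1 / (m * m powr \<alpha>)"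
      using m by (simp_all add: powr_minus powr_diff power2_eq_square field_simps)
    have l: "lam p (Suc n) = m * pi / p" by (simp add: lam_def m_def)
    show ?thesis unfolding m_def[symmetric] e l powr_divide using p m by (simp add: field_simps)
  qed
  ultimately show ?thesis by simp
qed

lemma continuous_on_slice:
  assumes "continuous_on ({0..p} \<times> {-T..T}) (\<lambda>(x, t). g x t)" "t \<in> {-T..T}"
  shows "continuous_on {0..p} (\<lambda>x. g x t)"
proof -
  have "continuous_on {0..p} (\<lambda>x. (\<lambda>(x, t). g x t) (x, t))"
    using assms(2) by (intro continuous_on_compose2[OF assms(1)]) (auto intro!: continuous_intros)
  then show ?thesis by simp
qed

lemma continuous_on_coefficient:
  fixes g :: "real \<Rightarrow> real \<Rightarrow> real"
  assumes g: "continuous_on ({0..p} \<times> {-T..T}) (\<lambda>(x, t). g x t)"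
  shows "continuous_on {-T..T} (\<lambda>t. integral {0..p} (\<lambda>x. g x t * X p n x))"
proof -
  have "continuous_on ({-T..T} \<times> {0..p}) (\<lambda>z. (\<lambda>(x, t). g x t) (snd z, fst z))"
    by (rule continuous_on_compose2[OF g]) (auto intro!: continuous_intros)
  then have "continuous_on ({-T..T} \<times> {0..p}) (\<lambda>z. g (snd z) (fst z) * X p n (snd z))"
    by (auto intro!: continuous_intros)
  then have "continuous_on ({-T..T} \<times> cbox 0 p) (\<lambda>(t, x). g x t * X p n x)"
    by (simp add: case_prod_beta)
  from integral_continuous_on_param[OF this] show ?thesis by simp
qed

text \<open>
  Differentiation under the integral sign.  The \<open>t\<close>-derivative of \<open>f\<close> is given only for \<open>x\<close> inside the
  interval; at the two end points the integrand vanishes together with \<open>X p n\<close>.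
\<close>

lemma fc_has_derivative:
  assumes p: "0 < p" and f: "continuous_on ({0..p} \<times> {-T..T}) (\<lambda>(x, t). f x t)"
    and ft: "continuous_on ({0..p} \<times> {-T..T}) (\<lambda>(x, t). ft x t)"
    and D: "\<And>x t. x \<in> {0<..<p} \<Longrightarrow> t \<in> {-T<..<T} \<Longrightarrow> ((\<lambda>s. f x s) has_real_derivative ft x t) (at t)"
    and t: "t \<in> {-T<..<T}"
  shows "(fc p f n has_real_derivative integral {0..p} (\<lambda>x. ft x t * X p n x)) (at t)"
proof -
  have X0: "X p n 0 = 0" "X p n p = 0"
    using p by (simp_all add: X_def lam_def sin_npi)
  have "((\<lambda>t. integral (cbox 0 p) (\<lambda>x. f x t * X p n x)) has_field_derivative
     integral (cbox 0 p) (\<lambda>x. ft x t * X p n x)) (at t within {-T<..<T})"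
  proof (rule leibniz_rule_field_derivative[OF _ _ _ t])
    fix s x assume s: "s \<in> {-T<..<T}" and x: "x \<in> cbox 0 p"
    show "((\<lambda>s. f x s * X p n x) has_field_derivative ft x s * X p n x) (at s within {-T<..<T})"
    proof (cases "x = 0 \<or> x = p")
      case True
      then have "X p n x = 0" using X0 by auto
      then show ?thesis by simp
    next
      case False
      then have "x \<in> {0<..<p}" using x by auto
      from has_field_derivative_at_within[OF DERIV_cmult_right[OF D[OF this s]]] show ?thesis .
    qed
  next
    fix s assume s: "s \<in> {-T<..<T}"
    then have "continuous_on {0..p} (\<lambda>x. f x s)" by (intro continuous_on_slice[OF f]) auto
    then have "continuous_on {0..p} (\<lambda>x. f x s * X p n x)" by (auto intro!: continuous_intros)
    then show "(\<lambda>x. f x s * X p n x) integrable_on cbox 0 p"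
      by (simp add: integrable_continuous_real)
  next
    have "continuous_on ({-T<..<T} \<times> {0..p}) (\<lambda>z. (\<lambda>(x, t). ft x t) (snd z, fst z))"
      by (rule continuous_on_compose2[OF ft]) (auto intro!: continuous_intros)
    then have "continuous_on ({-T<..<T} \<times> {0..p}) (\<lambda>z. ft (snd z) (fst z) * X p n (snd z))"
      by (auto intro!: continuous_intros)
    then show "continuous_on ({-T<..<T} \<times> cbox 0 p) (\<lambda>(t, x). ft x t * X p n x)"
      by (simp add: case_prod_beta)
  qed auto
  then have "((\<lambda>t. integral {0..p} (\<lambda>x. f x t * X p n x)) has_field_derivative
     integral {0..p} (\<lambda>x. ft x t * X p n x)) (at t)"
    using at_within_open[OF t] by simp
  then show ?thesis by (simp add: fc_def[abs_def])
qed

lemma summable_square_coefficients: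
  assumes p: "0 < p" and g: "continuous_on {0..p} g"
  shows "summable (\<lambda>n. (integral {0..p} (\<lambda>x. g x * X p (Suc n) x))\<^sup>2)"
proof -
  define h where "h x = indicator {0..p} x * g x" for x
  have h [measurable]: "h \<in> borel_measurable borel"
    using borel_measurable_continuous_on_indicator[OF _ g] by (simp add: h_def[abs_def])
  have h2: "integrable lborel (\<lambda>x. (h x)\<^sup>2)"
  proof -
    have "integrable lborel (\<lambda>x. indicator {0..p} x *\<^sub>R (g x)\<^sup>2)"
      by (intro borel_integrable_compact continuous_intros g) auto
    moreover have "(\<lambda>x. (h x)\<^sup>2) = (\<lambda>x. indicator {0..p} x *\<^sub>R (g x)\<^sup>2)"
      by (auto simp: h_def fun_eq_iff indicator_def)
    ultimately show ?thesis by simp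
  qed
  have coeff: "(\<integral>x. h x * X p n x \<partial>lborel) = integral {0..p} (\<lambda>x. g x * X p n x)" for n
  proof -
    have "set_integrable lborel {0..p} (\<lambda>x. g x * X p n x)"
      by (intro borel_integrable_atLeastAtMost' continuous_intros g)
    from set_borel_integral_eq_integral(2)[OF this] show ?thesis
      by (simp add: set_lebesgue_integral_def h_def mult.assoc)
  qed
  show ?thesis
  proof (rule bounded_imp_summable)
    fix n
    have "(\<Sum>k\<le>n. (integral {0..p} (\<lambda>x. g x * X p (Suc k) x))\<^sup>2) = (\<Sum>k=1..Suc n. (\<integral>x. h x * X p k x \<partial>lborel)\<^sup>2)"
      unfolding coeff by (simp add: sum.atMost_shift atMost_atLeast0 sum.shift_bounds_cl_Suc_ivl del: sum.cl_ivl_Suc)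
    also have "\<dots> \<le> (\<integral>x. (h x)\<^sup>2 \<partial>lborel)"
      using p by (intro Bessel_X h h2) (auto simp: h_def)
    finally show "(\<Sum>k\<le>n. (integral {0..p} (\<lambda>x. g x * X p (Suc k) x))\<^sup>2) \<le> (\<integral>x. (h x)\<^sup>2 \<partial>lborel)" .
  qed simp
qed

lemma X_series_uniform_limit:
  assumes s: "summable (\<lambda>n. \<bar>c (Suc n)\<bar>)"
  shows "uniform_limit UNIV (\<lambda>N x. \<Sum>n<N. X p (Suc n) x * c (Suc n)) (\<lambda>x. \<Sum>n. X p (Suc n) x * c (Suc n)) sequentially"
proof (rule Weierstrass_m_test)
  show "norm (X p (Suc n) x * c (Suc n)) \<le> sqrt \<bar>2 / p\<bar> * \<bar>c (Suc n)\<bar>" for n x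
    unfolding real_norm_def abs_mult by (intro mult_right_mono abs_X_le) auto
  show "summable (\<lambda>n. sqrt \<bar>2 / p\<bar> * \<bar>c (Suc n)\<bar>)" by (intro summable_mult s)
qed

text \<open>
  The sum of the series is continuous and has the same sine coefficients as \<open>g\<close>, so the completeness of the
  sine system identifies the two.
\<close>

lemma sine_series_sums:
  fixes g :: "real \<Rightarrow> real" and p :: real
  defines "c \<equiv> \<lambda>n. integral {0..p} (\<lambda>x. g x * X p n x)"
  assumes p: "0 < p" and g: "continuous_on {0..p} g" and s: "summable (\<lambda>n. \<bar>c (Suc n)\<bar>)" and x: "x \<in> {0<..<p}"
  shows "(\<lambda>n. X p (Suc n) x * c (Suc n)) sums g x"
proof -
  define S where "S x = (\<Sum>n. X p (Suc n) x * c (Suc n))" for x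
  have ul: "uniform_limit UNIV (\<lambda>N x. \<Sum>n<N. X p (Suc n) x * c (Suc n)) S sequentially"
    using X_series_uniform_limit[OF s] unfolding S_def .
  have cS: "continuous_on A S" for A
    by (rule uniform_limit_theorem[OF _ uniform_limit_on_subset[OF ul subset_UNIV]])
      (auto intro!: always_eventually continuous_intros)
  have coeff: "integral {0..p} (\<lambda>x. S x * X p m x) = c m" if m: "1 \<le> m" for m
  proof -
    have bX: "bounded (X p m ` {0..p})"
      unfolding bounded_iff using abs_X_le[of p m] by (auto intro!: exI[of _ "sqrt \<bar>2/p\<bar>"])
    have "uniform_limit {0..p} (\<lambda>N x. (\<Sum>n<N. X p (Suc n) x * c (Suc n)) * X p m x) (\<lambda>x. S x * X p m x) sequentially"
      by (intro uniform_lim_mult uniform_limit_on_subset[OF ul] uniform_limit_const bX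
          compact_imp_bounded compact_continuous_image cS) auto
    then obtain I J where I: "\<And>N. ((\<lambda>x. (\<Sum>n<N. X p (Suc n) x * c (Suc n)) * X p m x) has_integral I N) {0..p}"
      and J: "((\<lambda>x. S x * X p m x) has_integral J) {0..p}" and IJ: "I \<longlonglongrightarrow> J"
      by (rule uniform_limit_integral) (auto intro!: continuous_intros)
    have "I N = c m" if N: "N \<ge> m" for N
    proof -
      have hi: "((\<lambda>x. \<Sum>n<N. c (Suc n) * (X p (Suc n) x * X p m x)) has_integral
         (\<Sum>n<N. c (Suc n) * (if Suc n = m then 1 else 0))) {0..p}"
        using m by (intro has_integral_sum has_integral_mult_right X_orthonormal p) auto
      have eq: "(\<lambda>x. (\<Sum>n<N. X p (Suc n) x * c (Suc n)) * X p m x) = (\<lambda>x. \<Sum>n<N. c (Suc n) * (X p (Suc n) x * X p m x))"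
        unfolding sum_distrib_right by (intro ext sum.cong refl) (simp add: mult_ac)
      have sum: "(\<Sum>n<N. c (Suc n) * (if Suc n = m then 1 else 0)) = c m"
      proof -
        have "(\<Sum>n<N. c (Suc n) * (if Suc n = m then 1 else 0)) = (\<Sum>n<N. if n = m - 1 then c m else 0)"
          using m by (intro sum.cong) auto
        then show ?thesis using N m by simp
      qed
      show ?thesis using has_integral_unique[OF I[of N, unfolded eq] hi] unfolding sum .
    qed
    then have "I \<longlonglongrightarrow> c m" by (intro tendsto_eventually eventually_sequentiallyI[of m])
    then have "J = c m" using IJ LIMSEQ_unique by blast
    then show ?thesis using integral_unique[OF J] by simp
  qed
  have "g x - S x = 0"
  proof (rule zero_if_sine_coefficients_zero[OF p _ _ x])
    show "continuous_on {0..p} (\<lambda>x. g x - S x)" by (intro continuous_intros g cS)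
    fix n :: nat assume n: "1 \<le> n"
    have "integral {0..p} (\<lambda>x. (g x - S x) * X p n x) = c n - integral {0..p} (\<lambda>x. S x * X p n x)"
      unfolding left_diff_distrib c_def
      by (intro Henstock_Kurzweil_Integration.integral_diff integrable_continuous_real continuous_intros g cS)
    then show "integral {0..p} (\<lambda>x. (g x - S x) * X p n x) = 0" using coeff[OF n] by simp
  qed
  moreover have "(\<lambda>n. X p (Suc n) x * c (Suc n)) sums S x"
    using tendsto_uniform_limitI[OF ul, of x] by (simp add: sums_def)
  ultimately show ?thesis by simp
qed

section \<open>Differentiation of indefinite integrals\<close>

text \<open>
  The exceptional set consists of the points at which the increments of the indefinite integral deviate from
  \<open>f x\<close> times the length by a proportion \<open>e\<close>, on arbitrarily short intervals.  The Vitali covering theorem covers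
  it, up to a null set, by disjoint intervals of this kind that are fine for a gauge; Henstock's lemma bounds the
  sum of their deviations, hence \<open>e\<close> times their total length.
\<close>

lemma negligible_large_increment_error:
  fixes f :: "real \<Rightarrow> real"
  assumes f: "f integrable_on {a..b}" and e: "0 < e"
  shows "negligible {x. \<forall>d>0. \<exists>w v. w \<le> x \<and> x \<le> v \<and> w < v \<and> v - w < d \<and> {w..v} \<subseteq> {a..b} \<and>
           e * (v - w) \<le> \<bar>(v - w) * f x - integral {w..v} f\<bar>}" (is "negligible ?E")
  unfolding negligible_outer_le
proof (intro allI impI)
  fix \<eta> :: real assume \<eta>: "0 < \<eta>"
  obtain \<gamma> where \<gamma>: "gauge \<gamma>"
    and fine: "\<And>q. \<lbrakk>q tagged_partial_division_of (cbox a b); \<gamma> fine q\<rbrakk> \<Longrightarrow>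
             (\<Sum>(x,k)\<in>q. norm (measure lborel k *\<^sub>R f x - integral k f)) < e * \<eta>"
    using Henstock_lemma[of f a b "e * \<eta>"] f e \<eta> by (auto simp: box_real)
  define K where "K = {(x,w,v). w \<le> x \<and> x \<le> v \<and> w < v \<and> {w..v} \<subseteq> {a..b} \<and> {w..v} \<subseteq> \<gamma> x \<and>
           e * (v - w) \<le> \<bar>(v - w) * f x - integral {w..v} f\<bar>}"
  define ctr where "ctr = (\<lambda>(x::real,w::real,v::real). (w+v)/2)"
  define rad where "rad = (\<lambda>(x::real,w::real,v::real). (v-w)/2)"
  have cb: "cball (ctr i) (rad i) = (case i of (x,w,v) \<Rightarrow> {w..v})" for i
    by (auto simp: ctr_def rad_def cball_eq_atLeastAtMost field_simps split: prod.splits)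
  have cov: "\<exists>i. i \<in> K \<and> x \<in> cball (ctr i) (rad i) \<and> rad i < d" if x: "x \<in> ?E" and d: "0 < d" for x d
  proof -
    obtain r where r: "0 < r" "ball x r \<subseteq> \<gamma> x"
      using \<gamma> by (meson gauge_def openE)
    obtain w v where wv: "w \<le> x" "x \<le> v" "w < v" "v - w < min d r" "{w..v} \<subseteq> {a..b}"
       "e * (v - w) \<le> \<bar>(v - w) * f x - integral {w..v} f\<bar>"
      using x d r by (auto dest!: spec[of _ "min d r"])
    have "{w..v} \<subseteq> ball x r" using wv by (auto simp: dist_real_def)
    moreover have "x \<in> cball (ctr (x,w,v)) (rad (x,w,v))" unfolding cb using wv by simp
    ultimately show ?thesis using wv r by (intro exI[of _ "(x,w,v)"]) (auto simp: K_def rad_def simp del: mem_cball)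
  qed
  have pos: "\<And>i. i \<in> K \<Longrightarrow> 0 < rad i" by (auto simp: K_def rad_def)
  obtain C where C: "countable C" "C \<subseteq> K"
     "pairwise (\<lambda>i j. disjnt (cball (ctr i) (rad i)) (cball (ctr j) (rad j))) C"
     "negligible (?E - (\<Union>i\<in>C. cball (ctr i) (rad i)))"
  proof (rule Vitali_covering_theorem_cballs[of K rad ?E ctr])
    show "0 < rad i" if "i \<in> K" for i using that by (rule pos)
    show "\<exists>i. i \<in> K \<and> x \<in> cball (ctr i) (rad i) \<and> rad i < d" if "x \<in> ?E" "0 < d" for x d
      using that by (rule cov)
  qed (rule that)
  let ?I = "\<lambda>i. cball (ctr i) (rad i)"
  have bound: "measure lebesgue (\<Union>i\<in>D. ?I i) \<le> \<eta>" if D: "D \<subseteq> C" "finite D" for D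
  proof -
    define q where "q = (\<lambda>(x,w,v). (x,{w..v::real})) ` D"
    have inj: "inj_on (\<lambda>(x,w,v). (x::real,{w..v::real})) D"
    proof (rule inj_onI)
      fix i j assume ij: "i \<in> D" "j \<in> D" "(\<lambda>(x,w,v). (x::real,{w..v::real})) i = (\<lambda>(x,w,v). (x,{w..v})) j"
      obtain x w v x' w' v' where eq: "i = (x,w,v)" "j = (x',w',v')" by (metis prod_cases3)
      have "(x,w,v) \<in> K" "(x',w',v') \<in> K" using ij D C(2) eq by auto
      then show "i = j" using ij(3) unfolding eq by (simp add: K_def Icc_eq_Icc)
    qed
    have disj: "{w..v} \<inter> {w'..v'} = {}" if "(x,w,v) \<in> D" "(x',w',v') \<in> D" "(x,w,v) \<noteq> (x',w',v')" for x w v x' w' v'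
    proof -
      have "disjnt (cball (ctr (x,w,v)) (rad (x,w,v))) (cball (ctr (x',w',v')) (rad (x',w',v')))"
        using C(3) by (rule pairwiseD) (use D that in blast)+
      then show ?thesis unfolding cb disjnt_def by simp
    qed
    have "q tagged_partial_division_of (cbox a b)"
      unfolding tagged_partial_division_of_def
    proof (intro conjI allI impI)
      show "finite q" using D by (simp add: q_def)
      fix x k assume xk: "(x,k) \<in> q"
      then obtain w v where wv: "(x,w,v) \<in> D" "k = {w..v}" by (auto simp: q_def)
      then have inK: "(x,w,v) \<in> K" using D C by auto
      show "x \<in> k" "k \<subseteq> cbox a b" "\<exists>a b. k = cbox a b"
        using wv inK by (auto simp: K_def box_real)
    next
      fix x k x' k' assume xk': "(x,k) \<in> q \<and> (x',k') \<in> q \<and> (x,k) \<noteq> (x',k')"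
      have inq: "(x,k) \<in> q" "(x',k') \<in> q" using xk' by simp_all
      obtain w v where wv: "(x,w,v) \<in> D" "k = {w..v}" using inq(1) by (auto simp: q_def)
      obtain w' v' where wv': "(x',w',v') \<in> D" "k' = {w'..v'}" using inq(2) by (auto simp: q_def)
      have "(x,w,v) \<noteq> (x',w',v')" using xk' wv(2) wv'(2) by simp
      then have "k \<inter> k' = {}" unfolding wv(2) wv'(2) by (rule disj[OF wv(1) wv'(1)])
      then show "interior k \<inter> interior k' = {}" using interior_subset[of k] interior_subset[of k'] by auto
    qed
    moreover have "\<gamma> fine q"
      using D C(2) by (auto simp: fine_def q_def K_def)
    ultimately have "(\<Sum>(x,k)\<in>q. norm (measure lborel k *\<^sub>R f x - integral k f)) < e * \<eta>" by (rule fine)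
    also have "(\<Sum>(x,k)\<in>q. norm (measure lborel k *\<^sub>R f x - integral k f))
        = (\<Sum>(x,w,v)\<in>D. \<bar>(v-w) * f x - integral {w..v} f\<bar>)"
      unfolding q_def sum.reindex[OF inj]
      using D C(2) by (intro sum.cong) (auto simp: K_def)
    finally have "(\<Sum>(x,w,v)\<in>D. \<bar>(v-w) * f x - integral {w..v} f\<bar>) < e * \<eta>" .
    moreover have "(\<Sum>(x,w,v)\<in>D. e * (v-w)) \<le> (\<Sum>(x,w,v)\<in>D. \<bar>(v-w) * f x - integral {w..v} f\<bar>)"
      using D C(2) by (intro sum_mono) (auto simp: K_def)
    moreover have "(\<Sum>(x,w,v)\<in>D. e * (v-w)) = e * (\<Sum>(x,w,v)\<in>D. v-w)"
      by (simp add: sum_distrib_left case_prod_beta)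
    ultimately have "e * (\<Sum>(x,w,v)\<in>D. v-w) < e * \<eta>" by linarith
    then have "(\<Sum>(x,w,v)\<in>D. v-w) < \<eta>" using e by simp
    moreover have "measure lebesgue (\<Union>i\<in>D. ?I i) \<le> (\<Sum>i\<in>D. measure lebesgue (?I i))"
      using D by (intro measure_UNION_le) auto
    moreover have "(\<Sum>i\<in>D. measure lebesgue (?I i)) = (\<Sum>(x,w,v)\<in>D. v-w)"
    proof (intro sum.cong refl)
      fix i assume "i \<in> D"
      then have "i \<in> K" using D C(2) by auto
      then show "measure lebesgue (?I i) = (case i of (x,w,v) \<Rightarrow> v - w)"
        unfolding cb by (auto simp: K_def split: prod.splits)
    qed
    ultimately show ?thesis by linarith
  qed
  have "(\<Union>i\<in>C. ?I i) \<in> lmeasurable" "measure lebesgue (\<Union>i\<in>C. ?I i) \<le> \<eta>"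
    using fmeasurable_UN_bound[OF C(1), of ?I lebesgue \<eta>] measure_UN_bound[OF C(1), of ?I lebesgue \<eta>] bound
    by auto
  moreover have "?E \<subseteq> (\<Union>i\<in>C. ?I i) \<union> (?E - (\<Union>i\<in>C. ?I i))" by blast
  moreover have "measure lebesgue ((\<Union>i\<in>C. ?I i) \<union> (?E - (\<Union>i\<in>C. ?I i))) \<le> \<eta>"
    using measure_Un_le[of "\<Union>i\<in>C. ?I i" lebesgue "?E - (\<Union>i\<in>C. ?I i)"] calculation C(4)
    by (simp add: negligible_imp_measure0 negligible_imp_sets fmeasurableD)
  ultimately show "\<exists>S. ?E \<subseteq> S \<and> S \<in> lmeasurable \<and> measure lebesgue S \<le> \<eta>"
    using negligible_imp_measurable[OF C(4)] by (meson fmeasurable.Un)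
qed

text \<open>
  The Lebesgue differentiation theorem on the line: a point outside the exceptional sets for all proportions
  \<open>e = 1, 1/2, 1/3, \<dots>\<close> is a point of differentiability.
\<close>

lemma negligible_not_deriv_indefinite_integral:
  fixes f :: "real \<Rightarrow> real"
  assumes f: "f integrable_on {a..b}"
  shows "negligible {x\<in>{a<..<b}. \<not> ((\<lambda>t. integral {a..t} f) has_real_derivative f x) (at x)}"
proof -
  define E where "E e = {x. \<forall>d>0. \<exists>w v. w \<le> x \<and> x \<le> v \<and> w < v \<and> v - w < d \<and> {w..v} \<subseteq> {a..b} \<and>
           e * (v - w) \<le> \<bar>(v - w) * f x - integral {w..v} f\<bar>}" for e :: real
  have "((\<lambda>t. integral {a..t} f) has_real_derivative f x) (at x)"
    if x: "x \<in> {a<..<b}" and nE: "\<And>n. x \<notin> E (inverse (real (Suc n)))" for x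
    unfolding has_field_derivative_def has_derivative_at_alt
  proof (intro conjI allI impI)
    show "bounded_linear ((*) (f x))" by (rule bounded_linear_mult_right)
    fix e :: real assume "0 < e"
    then obtain n where n: "inverse (real (Suc n)) < e" using reals_Archimedean by blast
    obtain d where d: "d > 0" and small: "\<And>w v. w \<le> x \<Longrightarrow> x \<le> v \<Longrightarrow> w < v \<Longrightarrow> v - w < d \<Longrightarrow> {w..v} \<subseteq> {a..b} \<Longrightarrow>
           \<bar>(v - w) * f x - integral {w..v} f\<bar> < inverse (real (Suc n)) * (v - w)"
      using nE[of n] unfolding E_def mem_Collect_eq by (metis not_le)
    define r where "r = Min {d, x - a, b - x}"
    have r: "r > 0" "r \<le> d" "r \<le> x - a" "r \<le> b - x" using d x by (auto simp: r_def)
    have "norm (integral {a..y} f - integral {a..x} f - f x * (y - x)) \<le> e * norm (y - x)"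
      if y: "norm (y - x) < r" for y
    proof (cases x y rule: linorder_cases)
      case less
      have "integral {a..x} f + integral {x..y} f = integral {a..y} f"
        using less x y r by (intro Henstock_Kurzweil_Integration.integral_combine integrable_subinterval_real[OF f]) auto
      moreover have "\<bar>(y - x) * f x - integral {x..y} f\<bar> < inverse (real (Suc n)) * (y - x)"
        using less x y r by (intro small) auto
      moreover have "inverse (real (Suc n)) * (y - x) \<le> e * (y - x)"
        using less n by (intro mult_right_mono) auto
      moreover have eq: "norm (y - x) = y - x" "f x * (y - x) = (y - x) * f x"
        using less by (simp_all add: algebra_simps)
      ultimately show ?thesis unfolding eq unfolding real_norm_def by linarith
    next
      case greater
      have "integral {a..y} f + integral {y..x} f = integral {a..x} f"
        using greater x y r by (intro Henstock_Kurzweil_Integration.integral_combine integrable_subinterval_real[OF f]) auto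
      moreover have "\<bar>(x - y) * f x - integral {y..x} f\<bar> < inverse (real (Suc n)) * (x - y)"
        using greater x y r by (intro small) auto
      moreover have "inverse (real (Suc n)) * (x - y) \<le> e * (x - y)"
        using greater n by (intro mult_right_mono) auto
      moreover have eq: "norm (y - x) = x - y" "f x * (y - x) = - ((x - y) * f x)"
        using greater by (simp_all add: algebra_simps)
      ultimately show ?thesis unfolding eq unfolding real_norm_def by linarith
    qed auto
    then show "\<exists>r>0. \<forall>y. norm (y - x) < r \<longrightarrow>
       norm (integral {a..y} f - integral {a..x} f - f x * (y - x)) \<le> e * norm (y - x)" using r(1) by blast
  qed
  then have "{x\<in>{a<..<b}. \<not> ((\<lambda>t. integral {a..t} f) has_real_derivative f x) (at x)}
      \<subseteq> (\<Union>n. E (inverse (real (Suc n))))" by blast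
  moreover have "negligible (\<Union>n. E (inverse (real (Suc n))))"
    unfolding E_def by (intro negligible_Union_nat negligible_large_increment_error[OF f]) simp
  ultimately show ?thesis by (rule negligible_subset[rotated])
qed

lemma negligible_deriv_neq_of_indefinite_integral:
  fixes w F g :: "real \<Rightarrow> real"
  assumes w: "w integrable_on {a..b}"
    and F: "\<And>t. t \<in> {a<..<b} \<Longrightarrow> integral {a..t} w = F t - c" and g: "\<And>t. t \<in> {a<..<b} \<Longrightarrow> g t = F t"
  shows "negligible {t \<in> {a<..<b}. deriv g t \<noteq> w t}"
proof (rule negligible_subset[OF negligible_not_deriv_indefinite_integral[OF w]], clarify)
  fix t assume t: "t \<in> {a<..<b}" and ne: "deriv g t \<noteq> w t"
    and d: "((\<lambda>t. integral {a..t} w) has_real_derivative w t) (at t)"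
  have "((\<lambda>t. integral {a..t} w + c) has_real_derivative w t) (at t)"
    using DERIV_add[OF d DERIV_const[of c]] by simp
  then have "(g has_real_derivative w t) (at t)"
    by (rule has_field_derivative_transform_within_open[of _ _ _ "{a<..<b}"]) (use t F g in auto)
  then show False using ne DERIV_imp_deriv by blast
qed

section \<open>Smooth cut-off functions\<close>

text \<open>
  One-dimensional counterpart of \<^const>\<open>Ck\<close>; the test functions below are products of a function of \<open>x\<close> and
  a function of \<open>t\<close>.
\<close>

primrec smooth_upto :: "nat \<Rightarrow> (real \<Rightarrow> real) \<Rightarrow> bool" where
  "smooth_upto 0 g \<longleftrightarrow> continuous_on UNIV g"
| "smooth_upto (Suc k) g \<longleftrightarrow> (\<exists>g'. (\<forall>x. (g has_real_derivative g' x) (at x)) \<and> smooth_upto k g')"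

definition smooth :: "(real \<Rightarrow> real) \<Rightarrow> bool" where
  "smooth g \<longleftrightarrow> (\<forall>k. smooth_upto k g)"

lemma smooth_upto_SucI:
  "(\<And>x. (g has_real_derivative g' x) (at x)) \<Longrightarrow> smooth_upto k g' \<Longrightarrow> smooth_upto (Suc k) g"
  by auto

lemma smooth_upto_Suc_imp: "smooth_upto (Suc k) g \<Longrightarrow> smooth_upto k g"
proof (induction k arbitrary: g)
  case 0
  then show ?case by (auto intro!: continuous_at_imp_continuous_on intro: DERIV_isCont)
next
  case (Suc k)
  obtain g' where "\<And>x. (g has_real_derivative g' x) (at x)" "smooth_upto (Suc k) g'"
    using Suc.prems by (auto simp del: smooth_upto.simps simp: smooth_upto.simps(2)[of "Suc k"])
  then show ?case using Suc.IH by (intro smooth_upto_SucI) auto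
qed

lemma smooth_upto_add:
  "smooth_upto k g \<Longrightarrow> smooth_upto k h \<Longrightarrow> smooth_upto k (\<lambda>x. g x + h x)"
proof (induction k arbitrary: g h)
  case 0
  then show ?case by (auto intro: continuous_on_add)
next
  case (Suc k)
  from Suc.prems obtain g' h' where "\<And>x. (g has_real_derivative g' x) (at x)" "smooth_upto k g'"
     "\<And>x. (h has_real_derivative h' x) (at x)" "smooth_upto k h'" by auto
  then show ?case
    by (intro smooth_upto_SucI[where g' = "\<lambda>x. g' x + h' x"] Suc.IH) (auto intro: DERIV_add)
qed

lemma smooth_upto_mult:
  "smooth_upto k g \<Longrightarrow> smooth_upto k h \<Longrightarrow> smooth_upto k (\<lambda>x. g x * h x)"
proof (induction k arbitrary: g h)
  case 0
  then show ?case by (auto intro: continuous_on_mult)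
next
  case (Suc k)
  note lower = Suc.prems[THEN smooth_upto_Suc_imp]
  from Suc.prems obtain g' h' where D: "\<And>x. (g has_real_derivative g' x) (at x)" "smooth_upto k g'"
     "\<And>x. (h has_real_derivative h' x) (at x)" "smooth_upto k h'" by auto
  show ?case
  proof (rule smooth_upto_SucI[where g' = "\<lambda>x. g' x * h x + h' x * g x"])
    show "((\<lambda>x. g x * h x) has_real_derivative g' x * h x + h' x * g x) (at x)" for x
      by (intro DERIV_mult D)
  qed (intro smooth_upto_add Suc.IH D lower)
qed

lemma smooth_upto_const: "smooth_upto k (\<lambda>x. c)"
  by (induction k arbitrary: c) (auto intro!: exI[of _ "\<lambda>x. 0"])

lemma smooth_upto_affine: "smooth_upto k g \<Longrightarrow> smooth_upto k (\<lambda>x. g (c * x + d))"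
proof (induction k arbitrary: g)
  case 0
  then show ?case
    by (auto intro!: continuous_on_compose2[of UNIV g] continuous_intros)
next
  case (Suc k)
  then obtain g' where D: "\<And>x. (g has_real_derivative g' x) (at x)" "smooth_upto k g'" by auto
  show ?case
  proof (rule smooth_upto_SucI[where g' = "\<lambda>x. c * g' (c * x + d)"])
    show "((\<lambda>x. g (c * x + d)) has_real_derivative c * g' (c * x + d)) (at x)" for x
    proof -
      have "((\<lambda>x. c * x + d) has_real_derivative c) (at x)" by (auto intro!: derivative_eq_intros)
      from DERIV_chain2[OF D(1) this] show ?thesis by (simp add: mult.commute)
    qed
  qed (intro smooth_upto_mult smooth_upto_const Suc.IH D)
qed

lemma smooth_upto_sin_cos: "smooth_upto k sin \<and> smooth_upto k cos"
proof (induction k)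
  case 0
  then show ?case by (auto intro!: continuous_intros)
next
  case (Suc k)
  have "smooth_upto (Suc k) sin"
    by (rule smooth_upto_SucI[where g' = cos]) (use Suc in \<open>auto intro!: derivative_eq_intros\<close>)
  moreover have "smooth_upto (Suc k) cos"
  proof (rule smooth_upto_SucI[where g' = "\<lambda>x. -1 * sin x"])
    show "smooth_upto k (\<lambda>x. -1 * sin x)" using Suc by (intro smooth_upto_mult smooth_upto_const) auto
  qed (auto intro!: derivative_eq_intros)
  ultimately show ?case ..
qed

lemma smooth_upto_exp: "smooth_upto k exp"
  by (induction k) (auto intro!: exI[of _ exp] continuous_intros derivative_eq_intros)

lemma smooth_mult: "smooth g \<Longrightarrow> smooth h \<Longrightarrow> smooth (\<lambda>x. g x * h x)"
  and smooth_const: "smooth (\<lambda>x. c)"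
  and smooth_affine: "smooth g \<Longrightarrow> smooth (\<lambda>x. g (a * x + b))"
  and smooth_sin: "smooth sin" and smooth_exp: "smooth exp"
  by (simp_all add: smooth_def smooth_upto_mult smooth_upto_const smooth_upto_affine
      smooth_upto_sin_cos smooth_upto_exp)

lemma smooth_deriv:
  assumes "smooth g" and d: "\<And>x. (g has_real_derivative g' x) (at x)"
  shows "smooth g'"
  unfolding smooth_def
proof
  fix k
  have "smooth_upto (Suc k) g" using assms(1) by (auto simp: smooth_def simp del: smooth_upto.simps)
  then obtain g'' where g'': "\<And>x. (g has_real_derivative g'' x) (at x)" "smooth_upto k g''" by auto
  then have "g'' = g'" using d DERIV_unique by blast
  then show "smooth_upto k g'" using g'' by simp
qed

lemma smooth_obtain_deriv:
  assumes "smooth g"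
  obtains g' where "\<And>x. (g has_real_derivative g' x) (at x)" "smooth g'"
proof -
  have "smooth_upto 1 g" using assms by (simp add: smooth_def)
  then obtain g' where "\<And>x. (g has_real_derivative g' x) (at x)" by auto
  then show ?thesis using that smooth_deriv[OF assms] by blast
qed

lemma smooth_continuous: "smooth g \<Longrightarrow> continuous_on A g"
proof -
  assume "smooth g"
  then have "smooth_upto 0 g" unfolding smooth_def by blast
  then show ?thesis by (auto intro: continuous_on_subset)
qed

lemma Ck_tensor:
  "smooth_upto k g \<Longrightarrow> smooth_upto k h \<Longrightarrow> Ck k (\<lambda>z. g (fst z) * h (snd z))"
proof (induction k arbitrary: g h)
  case 0
  then show ?case
    by (auto intro!: continuous_on_mult continuous_on_compose2[of UNIV g] continuous_on_compose2[of UNIV h] continuous_intros)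
next
  case (Suc k)
  note lower = Suc.prems[THEN smooth_upto_Suc_imp]
  from Suc.prems obtain g' h' where D: "\<And>x. (g has_real_derivative g' x) (at x)" "smooth_upto k g'"
     "\<And>x. (h has_real_derivative h' x) (at x)" "smooth_upto k h'" by auto
  have "((\<lambda>z. g (fst z) * h (snd z)) has_derivative
      (\<lambda>v. fst v * (g' (fst z) * h (snd z)) + snd v * (g (fst z) * h' (snd z)))) (at z)" for z
  proof -
    have 1: "((\<lambda>z. g (fst z)) has_derivative (\<lambda>v. g' (fst z) * fst v)) (at z)"
      using has_derivative_compose[OF bounded_linear_imp_has_derivative[OF bounded_linear_fst, of "at z"]
        D(1)[unfolded has_field_derivative_def]] by simp
    have 2: "((\<lambda>z. h (snd z)) has_derivative (\<lambda>v. h' (snd z) * snd v)) (at z)"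
      using has_derivative_compose[OF bounded_linear_imp_has_derivative[OF bounded_linear_snd, of "at z"]
        D(3)[unfolded has_field_derivative_def]] by simp
    show ?thesis
      by (rule has_derivative_eq_rhs[OF has_derivative_mult[OF 1 2]]) (auto simp: algebra_simps)
  qed
  moreover have "Ck k (\<lambda>z. g' (fst z) * h (snd z))" "Ck k (\<lambda>z. g (fst z) * h' (snd z))"
    using D lower by (auto intro!: Suc.IH)
  ultimately show ?case unfolding Ck.simps by (intro exI conjI allI)
qed

text \<open>
  The functions \<open>exp (- 1 / x) / x\<^sup>m\<close>, extended by \<open>0\<close> to \<open>x \<le> 0\<close>.  Up to linear combinations the family is closed
  under differentiation, which makes all of its members smooth.
\<close>

definition flat_exp :: "nat \<Rightarrow> real \<Rightarrow> real" where
  "flat_exp m x = (if 0 < x then (1 / x) ^ m * exp (- (1 / x)) else 0)"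

lemma flat_exp_tendsto_0: "(flat_exp m \<longlongrightarrow> 0) (at 0)"
proof (rule filterlim_split_at_real)
  show "(flat_exp m \<longlongrightarrow> 0) (at_left 0)"
    by (rule tendsto_eventually) (auto simp: flat_exp_def eventually_at_filter)
  have "((\<lambda>x::real. (inverse x) ^ m / exp (inverse x)) \<longlongrightarrow> 0) (at_right 0)"
    by (rule filterlim_compose[OF tendsto_power_div_exp_0 filterlim_inverse_at_top_right])
  moreover have "\<forall>\<^sub>F x in at_right 0. (inverse x) ^ m / exp (inverse x) = flat_exp m x"
    by (auto simp: eventually_at_filter flat_exp_def exp_minus field_simps)
  ultimately show "(flat_exp m \<longlongrightarrow> 0) (at_right 0)" by (rule Lim_transform_eventually)
qed

lemma flat_exp_deriv:
  "(flat_exp m has_real_derivative flat_exp (m + 2) x - real m * flat_exp (m + 1) x) (at x)"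
proof (cases x "0 :: real" rule: linorder_cases)
  case greater
  have "((\<lambda>x. 1 / x) has_real_derivative - ((1/x)^2)) (at x)"
    using greater by (auto intro!: derivative_eq_intros simp: power2_eq_square)
  from DERIV_mult[OF DERIV_power[OF this, of m] DERIV_fun_exp[OF DERIV_minus[OF this]]]
  have "((\<lambda>x. (1 / x) ^ m * exp (- (1 / x))) has_real_derivative
     (1/x)^(m+2) * exp (-(1/x)) - real m * ((1/x)^(m+1) * exp (-(1/x)))) (at x)"
    by (rule DERIV_cong) (cases m; simp add: power2_eq_square mult_ac)
  then have "(flat_exp m has_real_derivative
     (1/x)^(m+2) * exp (-(1/x)) - real m * ((1/x)^(m+1) * exp (-(1/x)))) (at x)"
    by (rule has_field_derivative_transform_within_open[of _ _ _ "{0<..}"]) (use greater in \<open>auto simp: flat_exp_def\<close>)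
  then show ?thesis using greater by (simp add: flat_exp_def)
next
  case less
  have "((\<lambda>x. 0) has_real_derivative 0) (at x)" by simp
  then have "(flat_exp m has_real_derivative 0) (at x)"
    by (rule has_field_derivative_transform_within_open[of _ _ _ "{..<0}"]) (use less in \<open>auto simp: flat_exp_def\<close>)
  then show ?thesis using less by (simp add: flat_exp_def)
next
  case equal
  have "(flat_exp (m + 1) \<longlongrightarrow> 0) (at 0)" by (rule flat_exp_tendsto_0)
  moreover have "flat_exp (m + 1) = (\<lambda>h. (flat_exp m (0 + h) - flat_exp m 0) / h)"
    by (rule ext) (auto simp: flat_exp_def field_simps)
  ultimately have "(flat_exp m has_real_derivative 0) (at 0)"
    unfolding DERIV_def by (simp only:)
  then show ?thesis using equal by (simp add: flat_exp_def)
qed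

lemma smooth_flat_exp: "smooth (flat_exp m)"
proof -
  have "smooth_upto k (flat_exp m)" for k
  proof (induction k arbitrary: m)
    case 0
    show ?case using flat_exp_deriv by (auto intro!: continuous_at_imp_continuous_on DERIV_isCont)
  next
    case (Suc k)
    have "smooth_upto k (\<lambda>x. flat_exp (m + 2) x + (- real m) * flat_exp (m + 1) x)"
      by (intro smooth_upto_add smooth_upto_mult smooth_upto_const Suc)
    then show ?case using flat_exp_deriv[of m] by (intro smooth_upto_SucI) auto
  qed
  then show ?thesis by (simp add: smooth_def)
qed

lemma flat_exp_nonneg: "0 \<le> flat_exp m x" and flat_exp_0_le_1: "flat_exp 0 x \<le> 1"
  by (auto simp: flat_exp_def)

lemma flat_exp_0_deriv: "(flat_exp 0 has_real_derivative flat_exp 2 x) (at x)"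
  using flat_exp_deriv[of 0 x] by (simp add: numeral_2_eq_2)

lemma flat_exp_0_at_top: "(flat_exp 0 \<longlongrightarrow> 1) at_top"
proof -
  have "((\<lambda>x::real. exp (- (inverse x))) \<longlongrightarrow> exp (-0)) at_top"
    by (intro tendsto_intros tendsto_inverse_0_at_top filterlim_ident)
  moreover have "\<forall>\<^sub>F x in at_top. exp (- (inverse x)) = flat_exp 0 x"
    using eventually_gt_at_top[of 0] by eventually_elim (simp add: flat_exp_def inverse_eq_divide)
  ultimately show ?thesis using Lim_transform_eventually by force
qed

text \<open>
  The shift by \<open>1\<close> keeps the support inside \<open>{a + 1 / k..b - 1 / k}\<close>, so that it is a compact subset of the open
  interval; for \<open>k \<rightarrow> \<infinity>\<close> the functions tend to the indicator function of that interval.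
\<close>

definition cutoff :: "real \<Rightarrow> real \<Rightarrow> nat \<Rightarrow> real \<Rightarrow> real" where
  "cutoff a b k x = flat_exp 0 (real k * (x - a) - 1) * flat_exp 0 (real k * (b - x) - 1)"

definition cutoff' :: "real \<Rightarrow> real \<Rightarrow> nat \<Rightarrow> real \<Rightarrow> real" where
  "cutoff' a b k x = real k * flat_exp 2 (real k * (x - a) - 1) * flat_exp 0 (real k * (b - x) - 1)
     - flat_exp 0 (real k * (x - a) - 1) * (real k * flat_exp 2 (real k * (b - x) - 1))"

lemma flat_exp_scaled_deriv:
  "((\<lambda>x. flat_exp 0 (c * (x - a) - 1)) has_real_derivative c * flat_exp 2 (c * (x - a) - 1)) (at x)"
  "((\<lambda>x. flat_exp 0 (c * (b - x) - 1)) has_real_derivative - (c * flat_exp 2 (c * (b - x) - 1))) (at x)"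
  by (rule DERIV_chain2[OF flat_exp_0_deriv, THEN DERIV_cong], auto intro!: derivative_eq_intros)+

lemma cutoff_deriv: "(cutoff a b k has_real_derivative cutoff' a b k x) (at x)"
  unfolding cutoff_def[abs_def] cutoff'_def
  by (rule DERIV_cong[OF DERIV_mult[OF flat_exp_scaled_deriv]]) (simp add: algebra_simps)

lemma smooth_cutoff: "smooth (cutoff a b k)"
proof -
  have "smooth (\<lambda>x. flat_exp 0 (real k * x + (- real k * a - 1)) * flat_exp 0 (- real k * x + (real k * b - 1)))"
    by (intro smooth_mult smooth_affine smooth_flat_exp)
  then show ?thesis unfolding cutoff_def[abs_def] by (simp add: algebra_simps)
qed

lemma cutoff_nonneg: "0 \<le> cutoff a b k x" and cutoff_le_1: "cutoff a b k x \<le> 1"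
  unfolding cutoff_def by (auto intro!: mult_nonneg_nonneg flat_exp_nonneg mult_le_one flat_exp_0_le_1)

lemma cutoff_nonzeroD:
  assumes "cutoff a b k x \<noteq> 0"
  shows "0 < k" "a + 1 / k \<le> x" "x \<le> b - 1 / k"
proof -
  have 1: "1 < real k * (x - a)" "1 < real k * (b - x)"
    using assms by (auto simp: cutoff_def flat_exp_def split: if_splits)
  then show "0 < k" by (cases k) auto
  then show "a + 1 / k \<le> x" "x \<le> b - 1 / k" using 1 by (auto simp: field_simps)
qed

lemma cutoff_outside: "x \<notin> {a<..<b} \<Longrightarrow> cutoff a b k x = 0"
proof (rule ccontr)
  assume "x \<notin> {a<..<b}" and nz: "cutoff a b k x \<noteq> 0"
  moreover have "0 < 1 / real k" using cutoff_nonzeroD(1)[OF nz] by simp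
  ultimately show False using cutoff_nonzeroD(2,3)[OF nz] by auto
qed

lemma cutoff_tendsto:
  assumes "x \<in> {a<..<b}"
  shows "(\<lambda>k. cutoff a b k x) \<longlonglongrightarrow> 1"
proof -
  have *: "(\<lambda>k. flat_exp 0 (real k * c - 1)) \<longlonglongrightarrow> 1" if "0 < c" for c
    by (rule filterlim_compose[OF flat_exp_0_at_top])
      (use that in \<open>auto intro!: filterlim_tendsto_add_at_top[OF tendsto_const, of _ _ "-1", simplified] filterlim_at_top_mult_tendsto_pos filterlim_real_sequentially\<close>)
  show ?thesis unfolding cutoff_def using tendsto_mult[OF *[of "x-a"] *[of "b-x"]] assms by auto
qed


section \<open>Weak derivatives on an interval\<close>

text \<open>
  Compact support in the open interval from \<open>a\<close> to \<open>b\<close>.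
\<close>

definition supported_in :: "real \<Rightarrow> real \<Rightarrow> (real \<Rightarrow> real) \<Rightarrow> bool" where
  "supported_in a b g \<longleftrightarrow> (\<exists>c d. a < c \<and> d < b \<and> (\<forall>x. x \<notin> {c..d} \<longrightarrow> g x = 0))"

lemma supported_in_mult_cutoff:
  assumes "a \<le> r" "s \<le> b"
  shows "supported_in a b (\<lambda>x. h x * cutoff r s (Suc k) x)"
proof -
  have "0 < 1 / real (Suc k)" by simp
  then have "a < r + 1 / Suc k" "s - 1 / Suc k < b" using assms by linarith+
  moreover have "h x * cutoff r s (Suc k) x = 0" if "x \<notin> {r + 1 / Suc k..s - 1 / Suc k}" for x
    using cutoff_nonzeroD[of r s "Suc k" x] that by auto
  ultimately show ?thesis unfolding supported_in_def by blast
qed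

text \<open>
  This says that \<open>F\<close> is absolutely continuous with derivative \<open>w\<close>, in the form in which it is used: as integration
  by parts against smooth functions on subintervals.  The choice \<open>h = 1\<close> gives back that \<open>F\<close> is an indefinite
  integral of \<open>w\<close>.
\<close>

definition parts_on :: "real \<Rightarrow> real \<Rightarrow> (real \<Rightarrow> real) \<Rightarrow> (real \<Rightarrow> real) \<Rightarrow> bool" where
  "parts_on a b F w \<longleftrightarrow> (\<forall>h h' r s. smooth h \<longrightarrow> (\<forall>x. (h has_real_derivative h' x) (at x)) \<longrightarrow> a \<le> r \<longrightarrow> r \<le> s \<longrightarrow> s \<le> b \<longrightarrow>
     integral {r..s} (\<lambda>t. w t * h t) = F s * h s - F r * h r - integral {r..s} (\<lambda>t. F t * h' t))"

lemma parts_onD: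
  assumes "parts_on a b F w" "smooth h" "\<And>x. (h has_real_derivative h' x) (at x)" "a \<le> r" "r \<le> s" "s \<le> b"
  shows "integral {r..s} (\<lambda>t. w t * h t) = F s * h s - F r * h r - integral {r..s} (\<lambda>t. F t * h' t)"
  using assms unfolding parts_on_def by blast

lemma cutoff'_outside: "x \<notin> {a..b} \<Longrightarrow> cutoff' a b k x = 0"
proof -
  assume "x \<notin> {a..b}"
  then have "x - a \<le> 0 \<or> b - x \<le> 0" by auto
  then have "real k * (x - a) \<le> 0 \<or> real k * (b - x) \<le> 0" by (metis mult_nonneg_nonpos of_nat_0_le_iff)
  then have "\<not> 0 < real k * (x - a) - 1 \<or> \<not> 0 < real k * (b - x) - 1" by linarith
  then show ?thesis unfolding cutoff'_def flat_exp_def by auto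
qed

lemma continuous_on_cutoff: "continuous_on A (cutoff a b k)"
  and continuous_on_cutoff': "continuous_on A (cutoff' a b k)"
  using smooth_continuous[OF smooth_cutoff] smooth_continuous[OF smooth_deriv[OF smooth_cutoff cutoff_deriv]] .

lemma absolutely_integrable_mult_continuous:
  fixes v h :: "real \<Rightarrow> real"
  assumes v: "v absolutely_integrable_on {a..b}" and h: "continuous_on {a..b} h"
  shows "(\<lambda>x. v x * h x) absolutely_integrable_on {a..b}"
proof -
  have "(\<lambda>x. h x * v x) absolutely_integrable_on {a..b}"
  proof (rule absolutely_integrable_bounded_measurable_product_real[OF _ _ _ v])
    show "h \<in> borel_measurable (lebesgue_on {a..b})"
      by (intro continuous_imp_measurable_on_sets_lebesgue h) auto
    show "bounded (h ` {a..b})"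
      by (intro compact_imp_bounded compact_continuous_image h) auto
  qed auto
  then show ?thesis by (simp add: mult.commute)
qed

lemma integral_mult_cutoff_tendsto:
  assumes v: "v absolutely_integrable_on {a..b}"
  shows "(\<lambda>k. integral {a..b} (\<lambda>x. v x * cutoff a b k x)) \<longlonglongrightarrow> integral {a..b} v"
proof -
  let ?g = "\<lambda>x. if x \<in> {a<..<b} then v x else 0"
  have "(\<lambda>k. integral {a..b} (\<lambda>x. v x * cutoff a b k x)) \<longlonglongrightarrow> integral {a..b} ?g"
  proof (rule dominated_convergence(2)[where h = "\<lambda>x. \<bar>v x\<bar>"])
    show "(\<lambda>x. v x * cutoff a b k x) integrable_on {a..b}" for k
    proof -
      have "(\<lambda>x. v x * cutoff a b k x) absolutely_integrable_on {a..b}"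
        by (intro absolutely_integrable_mult_continuous v continuous_on_cutoff)
      then show ?thesis by (simp add: absolutely_integrable_on_def)
    qed
    show "(\<lambda>x. \<bar>v x\<bar>) integrable_on {a..b}" using v by (simp add: absolutely_integrable_on_def)
    show "norm (v x * cutoff a b k x) \<le> \<bar>v x\<bar>" for k x
      using mult_left_mono[OF cutoff_le_1[of a b k x], of "\<bar>v x\<bar>"] cutoff_nonneg[of a b k x] by (simp add: abs_mult)
    show "(\<lambda>k. v x * cutoff a b k x) \<longlonglongrightarrow> ?g x" for x
      using tendsto_mult[OF tendsto_const[of "v x"] cutoff_tendsto[of x a b]] cutoff_outside[of x a b] by auto
  qed
  also have "integral {a..b} ?g = integral {a..b} v"
    by (rule integral_spike[of "{a,b}"]) auto
  finally show ?thesis .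
qed

lemma integral_mult_cutoff'_smooth:
  assumes ab: "a \<le> b" and P: "\<And>x. x \<in> {a..b} \<Longrightarrow> (P has_real_derivative P' x) (at x)" and P': "continuous_on {a..b} P'"
  shows "integral {a..b} (\<lambda>x. P x * cutoff' a b k x) = - integral {a..b} (\<lambda>x. P' x * cutoff a b k x)"
proof -
  have cP: "continuous_on {a..b} P" by (intro continuous_at_imp_continuous_on ballI DERIV_isCont[OF P])
  have "((\<lambda>x. P' x * cutoff a b k x + cutoff' a b k x * P x) has_integral
      (P b * cutoff a b k b - P a * cutoff a b k a)) {a..b}"
  proof (rule fundamental_theorem_of_calculus[OF ab])
    fix x assume x: "x \<in> {a..b}"
    show "((\<lambda>x. P x * cutoff a b k x) has_vector_derivative P' x * cutoff a b k x + cutoff' a b k x * P x) (at x within {a..b})"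
      unfolding has_real_derivative_iff_has_vector_derivative[symmetric]
      by (rule has_field_derivative_at_within[OF DERIV_mult[OF P[OF x] cutoff_deriv]])
  qed
  moreover have "cutoff a b k a = 0" "cutoff a b k b = 0" by (simp_all add: cutoff_outside)
  ultimately have "integral {a..b} (\<lambda>x. P' x * cutoff a b k x + cutoff' a b k x * P x) = 0"
    by (metis integral_unique mult_zero_right diff_zero)
  moreover have "integral {a..b} (\<lambda>x. P' x * cutoff a b k x + cutoff' a b k x * P x) =
     integral {a..b} (\<lambda>x. P' x * cutoff a b k x) + integral {a..b} (\<lambda>x. cutoff' a b k x * P x)"
    by (intro Henstock_Kurzweil_Integration.integral_add integrable_continuous_real continuous_intros P' cP
        continuous_on_cutoff continuous_on_cutoff')
  ultimately show ?thesis by (simp add: mult.commute)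
qed

lemma integral_abs_cutoff'_le:
  assumes ab: "a \<le> b"
  shows "integral {a..b} (\<lambda>x. \<bar>cutoff' a b k x\<bar>) \<le> 2"
proof -
  let ?up = "\<lambda>x. real k * flat_exp 2 (real k * (x - a) - 1)" and ?dn = "\<lambda>x. real k * flat_exp 2 (real k * (b - x) - 1)"
  have up: "(?up has_integral (flat_exp 0 (real k * (b - a) - 1) - flat_exp 0 (real k * (a - a) - 1))) {a..b}"
    using ab by (intro fundamental_theorem_of_calculus)
      (auto simp: has_real_derivative_iff_has_vector_derivative[symmetric]
        intro!: has_field_derivative_at_within[OF flat_exp_scaled_deriv(1)] has_field_derivative_at_within[OF flat_exp_scaled_deriv(2)])
  have dn: "((\<lambda>x. - ?dn x) has_integral (flat_exp 0 (real k * (b - b) - 1) - flat_exp 0 (real k * (b - a) - 1))) {a..b}"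
    using ab by (intro fundamental_theorem_of_calculus)
      (auto simp: has_real_derivative_iff_has_vector_derivative[symmetric]
        intro!: has_field_derivative_at_within[OF flat_exp_scaled_deriv(1)] has_field_derivative_at_within[OF flat_exp_scaled_deriv(2)])
  have sum: "((\<lambda>x. ?up x + ?dn x) has_integral (2 * flat_exp 0 (real k * (b - a) - 1))) {a..b}"
    using has_integral_diff[OF up dn] by (simp add: flat_exp_def)
  have "integral {a..b} (\<lambda>x. \<bar>cutoff' a b k x\<bar>) \<le> integral {a..b} (\<lambda>x. ?up x + ?dn x)"
  proof (rule integral_le)
    show "(\<lambda>x. \<bar>cutoff' a b k x\<bar>) integrable_on {a..b}"
      by (intro integrable_continuous_real continuous_intros continuous_on_cutoff')
    show "(\<lambda>x. ?up x + ?dn x) integrable_on {a..b}" using sum by blast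
    fix x
    have "\<bar>cutoff' a b k x\<bar> \<le> \<bar>?up x * flat_exp 0 (real k * (b - x) - 1)\<bar> + \<bar>flat_exp 0 (real k * (x - a) - 1) * ?dn x\<bar>"
      unfolding cutoff'_def by (rule abs_triangle_ineq4)
    also have "\<dots> \<le> ?up x + ?dn x"
      unfolding abs_mult
      by (intro add_mono) (auto simp: flat_exp_nonneg flat_exp_0_le_1 intro!: mult_left_le mult_left_le_one_le)
    finally show "\<bar>cutoff' a b k x\<bar> \<le> ?up x + ?dn x" .
  qed
  also have "\<dots> \<le> 2" using sum flat_exp_0_le_1[of "real k * (b - a) - 1"] by (simp add: integral_unique)
  finally show ?thesis .
qed

text \<open>
  The derivatives of the cut-off functions act in the limit as the difference of the point masses at \<open>a\<close> and
  \<open>b\<close>.  For polynomials this follows by parts; since the derivatives are bounded in \<open>L\<^sub>1\<close>, the Weierstrass theorem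
  extends it to continuous functions.
\<close>

lemma integral_mult_cutoff'_tendsto:
  fixes F :: "real \<Rightarrow> real"
  assumes ab: "a < b" and F: "continuous_on {a..b} F"
  shows "(\<lambda>k. integral {a..b} (\<lambda>x. F x * cutoff' a b k x)) \<longlonglongrightarrow> F a - F b"
proof (rule LIMSEQ_I)
  fix e :: real assume e: "0 < e"
  obtain P where P: "real_polynomial_function P" "\<And>x. x \<in> {a..b} \<Longrightarrow> \<bar>F x - P x\<bar> < e / 5"
    using Stone_Weierstrass_real_polynomial_function[OF compact_Icc F, of "e/5"] e by auto
  obtain P' where P': "polynomial_function P'" "\<And>x. (P has_vector_derivative P' x) (at x)"
    using has_vector_derivative_polynomial_function[of P] P(1) real_polynomial_function_eq by blast
  have cP': "continuous_on A P'" and cP: "continuous_on A P" for A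
    using P(1) P'(1) by (simp_all add: continuous_on_polymonial_function real_polynomial_function_eq)
  have "(\<lambda>k. - integral {a..b} (\<lambda>x. P' x * cutoff a b k x)) \<longlonglongrightarrow> - integral {a..b} P'"
    by (intro tendsto_minus integral_mult_cutoff_tendsto absolutely_integrable_continuous_real cP')
  moreover have "integral {a..b} P' = P b - P a"
    using ab P'(2) by (intro integral_unique fundamental_theorem_of_calculus) (auto intro: has_vector_derivative_at_within)
  moreover have "integral {a..b} (\<lambda>x. P x * cutoff' a b k x) = - integral {a..b} (\<lambda>x. P' x * cutoff a b k x)" for k
    using ab P'(2) by (intro integral_mult_cutoff'_smooth cP') (auto simp: has_real_derivative_iff_has_vector_derivative)
  ultimately have "(\<lambda>k. integral {a..b} (\<lambda>x. P x * cutoff' a b k x)) \<longlonglongrightarrow> P a - P b" by simp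
  then obtain N where N: "\<And>k. k \<ge> N \<Longrightarrow> \<bar>integral {a..b} (\<lambda>x. P x * cutoff' a b k x) - (P a - P b)\<bar> < e / 5"
    using LIMSEQ_D[of _ "P a - P b" "e/5"] e by auto
  have "norm (integral {a..b} (\<lambda>x. F x * cutoff' a b k x) - (F a - F b)) < e" if k: "k \<ge> N" for k
  proof -
    have "integral {a..b} (\<lambda>x. F x * cutoff' a b k x) - integral {a..b} (\<lambda>x. P x * cutoff' a b k x)
       = integral {a..b} (\<lambda>x. (F x - P x) * cutoff' a b k x)"
      unfolding left_diff_distrib
      by (intro Henstock_Kurzweil_Integration.integral_diff[symmetric] integrable_continuous_real continuous_intros F cP continuous_on_cutoff')
    moreover have "norm (integral {a..b} (\<lambda>x. (F x - P x) * cutoff' a b k x))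
       \<le> integral {a..b} (\<lambda>x. e / 5 * \<bar>cutoff' a b k x\<bar>)"
      by (intro integral_norm_bound_integral integrable_continuous_real continuous_intros F cP continuous_on_cutoff')
        (auto simp: abs_mult intro!: mult_right_mono less_imp_le[OF P(2)] simp del: times_divide_eq_left)
    moreover have "integral {a..b} (\<lambda>x. e / 5 * \<bar>cutoff' a b k x\<bar>) \<le> e / 5 * 2"
      using integral_abs_cutoff'_le[of a b k] ab e unfolding integral_mult_right by (intro mult_left_mono) auto
    moreover have "\<bar>F a - P a\<bar> < e / 5" "\<bar>F b - P b\<bar> < e / 5" using P(2) ab by auto
    ultimately show ?thesis using N[OF k] unfolding real_norm_def by linarith
  qed
  then show "\<exists>N. \<forall>k\<ge>N. norm (integral {a..b} (\<lambda>x. F x * cutoff' a b k x) - (F a - F b)) < e" by blast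
qed

lemma integral_eq_on_subset:
  fixes f :: "real \<Rightarrow> real"
  assumes "S \<subseteq> T" "\<And>x. x \<in> T - S \<Longrightarrow> f x = 0"
  shows "integral T f = integral S f"
proof -
  have "integral T f = integral UNIV (\<lambda>x. if x \<in> T then f x else 0)" by (rule integral_restrict_UNIV[symmetric])
  also have "(\<lambda>x. if x \<in> T then f x else 0) = (\<lambda>x. if x \<in> S then f x else 0)"
    by (rule ext) (use assms in \<open>auto simp: subset_iff\<close>)
  also have "integral UNIV \<dots> = integral S f" by (rule integral_restrict_UNIV)
  finally show ?thesis .
qed

text \<open>
  A weak derivative that is known on compactly supported functions satisfies the formula with boundary terms: test
  with \<open>h\<close> times a cut-off function of \<open>{r..s}\<close> and let the cut-off tend to the indicator function.  The derivative
  of the cut-off produces the boundary values of \<open>F h\<close>.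
\<close>

lemma parts_on_if_weak_derivative:
  fixes F w :: "real \<Rightarrow> real"
  assumes F: "continuous_on {a..b} F" and w: "w absolutely_integrable_on {a..b}"
    and weak: "\<And>\<psi> \<psi>'. smooth \<psi> \<Longrightarrow> (\<And>x. (\<psi> has_real_derivative \<psi>' x) (at x)) \<Longrightarrow> supported_in a b \<psi> \<Longrightarrow>
        integral {a..b} (\<lambda>t. F t * \<psi>' t) = - integral {a..b} (\<lambda>t. w t * \<psi> t)"
  shows "parts_on a b F w"
  unfolding parts_on_def
proof (intro allI impI)
  fix h h' :: "real \<Rightarrow> real" and r s
  assume h: "smooth h" "\<forall>x. (h has_real_derivative h' x) (at x)" and s: "a \<le> r" "r \<le> s" "s \<le> b"
  note h = h(1) h(2)[rule_format]
  show "integral {r..s} (\<lambda>t. w t * h t) = F s * h s - F r * h r - integral {r..s} (\<lambda>t. F t * h' t)"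
  proof (cases "r < s")
    case True
    have sub: "{r..s} \<subseteq> {a..b}" using s by auto
    have ch: "continuous_on A h" and ch': "continuous_on A h'" for A
      using smooth_continuous[OF h(1)] smooth_continuous[OF smooth_deriv[OF h]] .
    have cF: "continuous_on {r..s} F" by (rule continuous_on_subset[OF F sub])
    have wh: "(\<lambda>t. w t * h t) absolutely_integrable_on {r..s}"
      using absolutely_integrable_on_subinterval[OF w] sub
      by (intro absolutely_integrable_mult_continuous ch) simp
    have key: "integral {r..s} (\<lambda>t. F t * h' t * cutoff r s (Suc k) t) + integral {r..s} (\<lambda>t. F t * h t * cutoff' r s (Suc k) t)
       = - integral {r..s} (\<lambda>t. w t * h t * cutoff r s (Suc k) t)" for k
    proof -
      let ?\<psi>' = "\<lambda>t. h' t * cutoff r s (Suc k) t + cutoff' r s (Suc k) t * h t"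
      have "integral {a..b} (\<lambda>t. F t * ?\<psi>' t) = - integral {a..b} (\<lambda>t. w t * (h t * cutoff r s (Suc k) t))"
      proof (rule weak)
        show "smooth (\<lambda>t. h t * cutoff r s (Suc k) t)" by (intro smooth_mult h smooth_cutoff)
        show "((\<lambda>t. h t * cutoff r s (Suc k) t) has_real_derivative ?\<psi>' x) (at x)" for x
          by (intro DERIV_mult h cutoff_deriv)
        show "supported_in a b (\<lambda>t. h t * cutoff r s (Suc k) t)" using s by (intro supported_in_mult_cutoff)
      qed
      moreover have "integral {a..b} (\<lambda>t. F t * ?\<psi>' t) = integral {r..s} (\<lambda>t. F t * ?\<psi>' t)"
        by (rule integral_eq_on_subset[OF sub]) (auto simp: cutoff_outside cutoff'_outside)
      moreover have "integral {a..b} (\<lambda>t. w t * (h t * cutoff r s (Suc k) t)) = integral {r..s} (\<lambda>t. w t * (h t * cutoff r s (Suc k) t))"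
        by (rule integral_eq_on_subset[OF sub]) (auto simp: cutoff_outside)
      moreover have "integral {r..s} (\<lambda>t. F t * ?\<psi>' t) = integral {r..s} (\<lambda>t. F t * h' t * cutoff r s (Suc k) t)
          + integral {r..s} (\<lambda>t. F t * h t * cutoff' r s (Suc k) t)"
      proof -
        have "integral {r..s} (\<lambda>t. F t * ?\<psi>' t) =
           integral {r..s} (\<lambda>t. F t * h' t * cutoff r s (Suc k) t + F t * h t * cutoff' r s (Suc k) t)"
          by (intro integral_cong) (simp add: algebra_simps)
        also have "\<dots> = integral {r..s} (\<lambda>t. F t * h' t * cutoff r s (Suc k) t)
          + integral {r..s} (\<lambda>t. F t * h t * cutoff' r s (Suc k) t)"
          by (intro Henstock_Kurzweil_Integration.integral_add integrable_continuous_real continuous_intros cF ch ch'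
            continuous_on_cutoff continuous_on_cutoff')
        finally show ?thesis .
      qed
      ultimately show ?thesis by (simp add: mult.assoc)
    qed
    have "(\<lambda>k. integral {r..s} (\<lambda>t. F t * h' t * cutoff r s (Suc k) t) + integral {r..s} (\<lambda>t. F t * h t * cutoff' r s (Suc k) t))
       \<longlonglongrightarrow> integral {r..s} (\<lambda>t. F t * h' t) + (F r * h r - F s * h s)"
      by (intro tendsto_add LIMSEQ_Suc[OF integral_mult_cutoff_tendsto] LIMSEQ_Suc[OF integral_mult_cutoff'_tendsto] True
        absolutely_integrable_continuous_real continuous_intros cF ch ch')
    moreover have "(\<lambda>k. - integral {r..s} (\<lambda>t. w t * h t * cutoff r s (Suc k) t)) \<longlonglongrightarrow> - integral {r..s} (\<lambda>t. w t * h t)"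
      by (intro tendsto_minus LIMSEQ_Suc[OF integral_mult_cutoff_tendsto] wh)
    ultimately have "integral {r..s} (\<lambda>t. F t * h' t) + (F r * h r - F s * h s) = - integral {r..s} (\<lambda>t. w t * h t)"
      unfolding key by (rule LIMSEQ_unique)
    then show ?thesis by simp
  next
    case False
    then have "r = s" using s by simp
    then show ?thesis by simp
  qed
qed

section \<open>Sine coefficients of the weak second time derivative\<close>

lemma Om_eq_Times: "Om p T = {0<..<p} \<times> {-T<..<T}"
  by (auto simp: Om_def)

lemma open_Om: "open (Om p T)"
  unfolding Om_eq_Times by (intro open_Times) auto

lemma closure_Om: "0 < p \<Longrightarrow> 0 < T \<Longrightarrow> closure (Om p T) = {0..p} \<times> {-T..T}"
  unfolding Om_eq_Times by (simp add: closure_Times)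

lemma integral_lborel_open_interval:
  fixes v :: "real \<Rightarrow> real"
  assumes v: "continuous_on {a..b} v"
  shows "(\<integral>t. indicator {a<..<b} t * v t \<partial>lborel) = integral {a..b} v"
proof -
  have "set_integrable lborel {a<..<b} v"
    by (rule set_integrable_subset[OF borel_integrable_atLeastAtMost'[OF v]]) auto
  from set_borel_integral_eq_integral(2)[OF this]
  have "(\<integral>t. indicator {a<..<b} t * v t \<partial>lborel) = integral {a<..<b} v"
    by (simp add: set_lebesgue_integral_def)
  then show ?thesis by (simp add: integral_open_interval_real)
qed

lemma lborel_integral_supported:
  fixes v :: "real \<Rightarrow> real"
  assumes v: "integrable lborel v" and supp: "\<And>x. x \<notin> {a..b} \<Longrightarrow> v x = 0"
  shows "v absolutely_integrable_on {a..b}" and "integral {a..b} v = (\<integral>x. v x \<partial>lborel)"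
proof -
  have eq: "(\<lambda>x. indicator {a..b} x *\<^sub>R v x) = v"
    using supp by (auto simp: indicator_def fun_eq_iff)
  have "set_integrable lborel {a..b} v" unfolding set_integrable_def eq by (rule v)
  from set_borel_integral_eq_integral(2)[OF this]
  show "integral {a..b} v = (\<integral>x. v x \<partial>lborel)" unfolding set_lebesgue_integral_def eq by simp
  show "v absolutely_integrable_on {a..b}"
    unfolding set_integrable_def eq using v integrable_completion[of v lborel] by auto
qed

lemma deriv_zero_at_ends:
  assumes \<psi>: "\<And>x. (\<psi> has_real_derivative \<psi>' x) (at x)" and supp: "supported_in a b \<psi>"
  shows "\<psi>' a = 0" "\<psi>' b = 0"
proof -
  from supp obtain c d where cd: "a < c" "d < b" and out: "\<And>x. x \<notin> {c..d} \<Longrightarrow> \<psi> x = 0"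
    unfolding supported_in_def by blast
  have "\<psi>' x = 0" if "x \<notin> {c..d}" for x
  proof -
    have "((\<lambda>x. 0) has_real_derivative 0) (at x)" by simp
    then have "(\<psi> has_real_derivative 0) (at x)"
      by (rule has_field_derivative_transform_within_open[of _ _ _ "- {c..d}"])
        (use out that in \<open>auto simp: open_Compl\<close>)
    then show ?thesis using \<psi> DERIV_unique by blast
  qed
  then show "\<psi>' a = 0" "\<psi>' b = 0" using cd by auto
qed

lemma test_function_tensor:
  assumes "smooth \<eta>" "smooth \<psi>" and supp: "supported_in 0 p \<eta>" "supported_in (-T) T \<psi>"
  shows "test_function (Om p T) (\<lambda>z. \<eta> (fst z) * \<psi> (snd z))"
proof -
  from supp obtain c d c' d' where c: "0 < c" "d < p" "\<And>x. x \<notin> {c..d} \<Longrightarrow> \<eta> x = 0"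
    and c': "-T < c'" "d' < T" "\<And>x. x \<notin> {c'..d'} \<Longrightarrow> \<psi> x = 0" unfolding supported_in_def by blast
  let ?S = "{z. \<eta> (fst z) * \<psi> (snd z) \<noteq> 0}"
  have "?S \<subseteq> {c..d} \<times> {c'..d'}"
  proof
    fix z assume "z \<in> ?S"
    then have "\<eta> (fst z) \<noteq> 0" "\<psi> (snd z) \<noteq> 0" by auto
    then show "z \<in> {c..d} \<times> {c'..d'}" using c(3) c'(3) by (cases z) auto
  qed
  moreover have K: "compact ({c..d} \<times> {c'..d'})" by (intro compact_Times) auto
  ultimately have cl: "closure ?S \<subseteq> {c..d} \<times> {c'..d'}" by (intro closure_minimal compact_imp_closed)
  moreover have "{c..d} \<times> {c'..d'} \<subseteq> Om p T" using c c' by (auto simp: Om_def)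
  moreover have "compact (closure ?S)"
    using cl compact_imp_bounded[OF K] bounded_subset closed_closure compact_eq_bounded_closed by blast
  moreover have "Ck k (\<lambda>z. \<eta> (fst z) * \<psi> (snd z))" for k
    using assms(1,2) by (intro Ck_tensor) (auto simp: smooth_def)
  ultimately show ?thesis unfolding test_function_def by blast
qed

lemma borel_measurable_fst_snd:
  fixes g :: "real \<Rightarrow> real"
  assumes "g \<in> borel_measurable borel"
  shows "(\<lambda>z::real\<times>real. g (fst z)) \<in> borel_measurable borel" "(\<lambda>z::real\<times>real. g (snd z)) \<in> borel_measurable borel"
  by (rule measurable_compose[OF _ assms], intro borel_measurable_continuous_onI continuous_intros)+

text \<open>
  The identity \<open>\<integral> f \<phi>\<^sub>t\<^sub>t = \<integral> G \<phi>\<close> for \<open>\<phi> (x, t) = \<eta> x \<psi> t\<close>, where \<open>\<psi>2\<close> stands for the second derivative of \<open>\<psi>\<close>.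
\<close>

abbreviation weak_pairing where
  "weak_pairing p T f G \<eta> \<psi> \<psi>2 \<equiv>
     (\<integral>z. indicator (Om p T) z * f (fst z) (snd z) * (\<eta> (fst z) * \<psi>2 (snd z)) \<partial>lborel)
       = (\<integral>z. G z * (\<eta> (fst z) * \<psi> (snd z)) \<partial>lborel :: real)"

text \<open>
  Fubini's theorem is applied to Borel functions; the Lebesgue measurable weak derivative is therefore replaced
  by a Borel function that agrees with it almost everywhere and vanishes outside the domain.
\<close>

lemma weak_tt_derivative_borel:
  assumes pT: "0 < p" "0 < T" and f: "continuous_on (closure (Om p T)) (\<lambda>(x, t). f x t)"
    and g: "L2_on (Om p T) g" and weak: "weak_tt_derivative (Om p T) f g"
  obtains G where "G \<in> borel_measurable borel" "\<And>z. z \<notin> Om p T \<Longrightarrow> G z = 0" "integrable lborel (\<lambda>z. (G z)\<^sup>2)"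
    "\<And>\<eta> \<psi> \<psi>1 \<psi>2. smooth \<eta> \<Longrightarrow> smooth \<psi> \<Longrightarrow> (\<And>x. (\<psi> has_real_derivative \<psi>1 x) (at x)) \<Longrightarrow>
       (\<And>x. (\<psi>1 has_real_derivative \<psi>2 x) (at x)) \<Longrightarrow>
       supported_in 0 p \<eta> \<Longrightarrow> supported_in (-T) T \<psi> \<Longrightarrow>
       weak_pairing p T f G \<eta> \<psi> \<psi>2"
proof -
  let ?S = "Om p T"
  have S [measurable]: "?S \<in> sets borel" using open_Om by auto
  have S': "?S \<inter> space lebesgue \<in> sets lebesgue" by simp
  have gm: "(\<lambda>z. indicator ?S z *\<^sub>R g z) \<in> borel_measurable lebesgue"
    using g unfolding L2_on_def borel_measurable_restrict_space_iff[OF S'] by blast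
  from completion_ex_borel_measurable_real[OF gm] obtain G' where G' [measurable]: "G' \<in> borel_measurable lborel"
    and eqG': "AE z in lborel. indicator ?S z *\<^sub>R g z = G' z"
    by blast
  define G where "G z = indicator ?S z * G' z" for z
  have G [measurable]: "G \<in> borel_measurable borel" unfolding G_def by measurable
  have eqG: "AE z in lebesgue. indicator ?S z * g z = G z"
    using AE_completion[OF eqG'] by eventually_elim (auto simp: G_def indicator_def split: if_splits)
  have f' [measurable]: "(\<lambda>z. indicator ?S z * f (fst z) (snd z)) \<in> borel_measurable borel"
    using borel_measurable_continuous_on_indicator[of ?S "\<lambda>z. f (fst z) (snd z)"]
      continuous_on_subset[OF f closure_subset] by (simp add: case_prod_beta)
  show ?thesis
  proof (rule that)
    show "G \<in> borel_measurable borel" by simp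
    show "G z = 0" if "z \<notin> ?S" for z using that by (simp add: G_def)
    have "integrable lebesgue (\<lambda>z. indicator ?S z *\<^sub>R (g z)\<^sup>2)"
      using g unfolding L2_on_def integrable_restrict_space[OF S'] by blast
    also have "integrable lebesgue (\<lambda>z. indicator ?S z *\<^sub>R (g z)\<^sup>2) \<longleftrightarrow> integrable lebesgue (\<lambda>z. (G z)\<^sup>2)"
    proof (rule integrable_cong_AE)
      show "(\<lambda>z. indicator ?S z *\<^sub>R (g z)\<^sup>2) \<in> borel_measurable lebesgue"
        using g unfolding L2_on_def integrable_restrict_space[OF S'] by (auto intro: borel_measurable_integrable)
      show "(\<lambda>z. (G z)\<^sup>2) \<in> borel_measurable lebesgue" by (intro measurable_completion) simp
      show "AE z in lebesgue. indicator ?S z *\<^sub>R (g z)\<^sup>2 = (G z)\<^sup>2"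
        using eqG by eventually_elim (auto simp: indicator_def power2_eq_square split: if_splits)
    qed
    also have "\<dots> \<longleftrightarrow> integrable lborel (\<lambda>z. (G z)\<^sup>2)" by (intro integrable_completion) simp
    finally show "integrable lborel (\<lambda>z. (G z)\<^sup>2)" .
    fix \<eta> \<psi> \<psi>1 \<psi>2 :: "real \<Rightarrow> real"
    assume sm: "smooth \<eta>" "smooth \<psi>" and D: "\<And>x. (\<psi> has_real_derivative \<psi>1 x) (at x)"
       "\<And>x. (\<psi>1 has_real_derivative \<psi>2 x) (at x)"
      and supp: "supported_in 0 p \<eta>" "supported_in (-T) T \<psi>"
    have \<eta> [measurable]: "\<eta> \<in> borel_measurable borel"
      by (intro borel_measurable_continuous_onI smooth_continuous sm)
    have \<psi> [measurable]: "\<psi> \<in> borel_measurable borel"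
      by (intro borel_measurable_continuous_onI smooth_continuous sm)
    have \<psi>2 [measurable]: "\<psi>2 \<in> borel_measurable borel"
      by (intro borel_measurable_continuous_onI smooth_continuous smooth_deriv[OF smooth_deriv[OF sm(2) D(1)] D(2)])
    note [measurable] = borel_measurable_fst_snd[OF \<eta>] borel_measurable_fst_snd[OF \<psi>]
    let ?\<phi> = "\<lambda>z. \<eta> (fst z) * \<psi> (snd z)"
    have dd: "deriv (deriv (\<lambda>s. ?\<phi> (x, s))) t = \<eta> x * \<psi>2 t" for x t
    proof -
      have "deriv (\<lambda>s. ?\<phi> (x, s)) = (\<lambda>s. \<eta> x * \<psi>1 s)"
        by (rule ext, rule DERIV_imp_deriv) (use DERIV_cmult[OF D(1)] in simp)
      then show ?thesis by (simp add: DERIV_imp_deriv[OF DERIV_cmult[OF D(2)]])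
    qed
    have "test_function ?S ?\<phi>" by (rule test_function_tensor[OF sm supp])
    then have w: "(\<integral>z. f (fst z) (snd z) * (\<eta> (fst z) * \<psi>2 (snd z)) \<partial>lebesgue_on ?S) =
       (\<integral>z. g z * (\<eta> (fst z) * \<psi> (snd z)) \<partial>lebesgue_on ?S)"
      using weak[unfolded weak_tt_derivative_def, rule_format, of ?\<phi>] unfolding dd by blast
    have "(\<integral>z. indicator ?S z * f (fst z) (snd z) * (\<eta> (fst z) * \<psi>2 (snd z)) \<partial>lborel)
       = (\<integral>z. indicator ?S z * f (fst z) (snd z) * (\<eta> (fst z) * \<psi>2 (snd z)) \<partial>lebesgue)"
      using borel_measurable_times[OF f' borel_measurable_times[OF borel_measurable_fst_snd(1)[OF \<eta>] borel_measurable_fst_snd(2)[OF \<psi>2]]]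
      by (intro integral_completion[symmetric]) simp
    also have "\<dots> = (\<integral>z. f (fst z) (snd z) * (\<eta> (fst z) * \<psi>2 (snd z)) \<partial>lebesgue_on ?S)"
      unfolding integral_restrict_space[OF S'] by (simp add: mult.assoc)
    also note w
    also have "(\<integral>z. g z * (\<eta> (fst z) * \<psi> (snd z)) \<partial>lebesgue_on ?S)
       = (\<integral>z. indicator ?S z * g z * (\<eta> (fst z) * \<psi> (snd z)) \<partial>lebesgue)"
      unfolding integral_restrict_space[OF S'] by (simp add: mult.assoc)
    also have "\<dots> = (\<integral>z. G z * (\<eta> (fst z) * \<psi> (snd z)) \<partial>lebesgue)"
    proof (rule integral_cong_AE)
      have m: "(\<lambda>z. \<eta> (fst z) * \<psi> (snd z)) \<in> borel_measurable lebesgue"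
        by (intro measurable_completion) simp
      show "(\<lambda>z. indicator ?S z * g z * (\<eta> (fst z) * \<psi> (snd z))) \<in> borel_measurable lebesgue"
        using borel_measurable_times[OF gm m] by (simp only: real_scaleR_def)
      show "(\<lambda>z. G z * (\<eta> (fst z) * \<psi> (snd z))) \<in> borel_measurable lebesgue"
        by (intro measurable_completion) simp
      show "AE z in lebesgue. indicator ?S z * g z * (\<eta> (fst z) * \<psi> (snd z)) = G z * (\<eta> (fst z) * \<psi> (snd z))"
        using eqG by eventually_elim simp
    qed
    also have "\<dots> = (\<integral>z. G z * (\<eta> (fst z) * \<psi> (snd z)) \<partial>lborel)"
      by (rule integral_completion) simp
    finally show "(\<integral>z. indicator ?S z * f (fst z) (snd z) * (\<eta> (fst z) * \<psi>2 (snd z)) \<partial>lborel)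
       = (\<integral>z. G z * (\<eta> (fst z) * \<psi> (snd z)) \<partial>lborel)" .
  qed
qed


lemma integrable_of_square_bounded_support:
  assumes pT: "0 < p" "0 < T" and G [measurable]: "G \<in> borel_measurable borel" and supp: "\<And>z. z \<notin> Om p T \<Longrightarrow> G z = (0::real)"
    and G2: "integrable lborel (\<lambda>z. (G z)\<^sup>2)"
  shows "integrable lborel G"
proof (rule Bochner_Integration.integrable_bound)
  show "integrable lborel (\<lambda>z. indicator ({0..p} \<times> {-T..T}) z *\<^sub>R 1 + (G z)\<^sup>2)"
    by (intro Bochner_Integration.integrable_add G2 borel_integrable_compact compact_Times) auto
  show "AE z in lborel. norm (G z) \<le> norm (indicator ({0..p} \<times> {-T..T}) z *\<^sub>R 1 + (G z)\<^sup>2)"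
  proof (rule AE_I2)
    fix z
    have "0 \<le> (\<bar>G z\<bar> - 1)\<^sup>2" by simp
    then have "2 * \<bar>G z\<bar> \<le> 1 + (G z)\<^sup>2" unfolding power2_diff by simp
    moreover have "z \<in> {0..p} \<times> {-T..T}" if "G z \<noteq> 0"
    proof -
      have "z \<in> Om p T" using that supp by blast
      then show ?thesis by (auto simp: Om_def)
    qed
    ultimately show "norm (G z) \<le> norm (indicator ({0..p} \<times> {-T..T}) z *\<^sub>R 1 + (G z)\<^sup>2)"
      by (cases "G z = 0") (auto simp: indicator_def)
  qed
qed simp

lemma smooth_X: "smooth (X p n)"
proof -
  have "smooth (\<lambda>x. sqrt (2 / p) * sin (lam p n * x + 0))"
    by (intro smooth_mult smooth_const smooth_affine smooth_sin)
  then show ?thesis by (simp add: X_def[abs_def])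
qed

text \<open>
  The function \<open>X p n\<close> is not compactly supported in the open interval; it is approximated by its products with
  cut-off functions, and both integrals converge by dominated convergence.
\<close>

lemma weak_identity_X:
  assumes pT: "0 < p" "0 < T" and f: "continuous_on (closure (Om p T)) (\<lambda>(x, t). f x t)"
    and G [measurable]: "G \<in> borel_measurable borel" and supp: "\<And>z. z \<notin> Om p T \<Longrightarrow> G z = 0"
    and G2: "integrable lborel (\<lambda>z. (G z)\<^sup>2)"
    and weak: "\<And>\<eta>. smooth \<eta> \<Longrightarrow> supported_in 0 p \<eta> \<Longrightarrow>
       weak_pairing p T f G \<eta> \<psi> \<psi>2"
    and c: "continuous_on UNIV \<psi>" "continuous_on UNIV \<psi>2"
  shows "weak_pairing p T f G (X p n) \<psi> \<psi>2"
    and "integrable lborel (\<lambda>z. indicator (Om p T) z * f (fst z) (snd z) * (X p n (fst z) * \<psi>2 (snd z)))"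
    and "integrable lborel (\<lambda>z. G z * (X p n (fst z) * \<psi> (snd z)))"
proof -
  let ?S = "Om p T"
  have S [measurable]: "?S \<in> sets borel" using open_Om by auto
  have [measurable]: "\<psi> \<in> borel_measurable borel" "\<psi>2 \<in> borel_measurable borel"
    using c by (auto intro: borel_measurable_continuous_onI)
  define H where "H z = indicator ?S z * f (fst z) (snd z)" for z
  have H [measurable]: "H \<in> borel_measurable borel"
    using borel_measurable_continuous_on_indicator[of ?S "\<lambda>z. f (fst z) (snd z)"]
      continuous_on_subset[OF f closure_subset] by (simp add: case_prod_beta H_def[abs_def])
  have Hsupp: "H z = 0" if "z \<notin> ?S" for z using that by (simp add: H_def)
  have "integrable lborel (\<lambda>z. indicator (closure ?S) z *\<^sub>R f (fst z) (snd z))"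
    using f by (intro borel_integrable_compact) (auto simp: closure_Om pT case_prod_beta intro: compact_Times)
  then have int_H: "integrable lborel H"
    by (rule Bochner_Integration.integrable_bound)
      (use closure_subset[of ?S] in \<open>auto simp: H_def indicator_def\<close>)
  have int_G: "integrable lborel G" by (rule integrable_of_square_bounded_support[OF pT G supp G2])
  have lim: "(\<lambda>k. \<integral>z. v z * (X p n (fst z) * cutoff 0 p (Suc k) (fst z) * w (snd z)) \<partial>lborel)
       \<longlonglongrightarrow> (\<integral>z. v z * (X p n (fst z) * w (snd z)) \<partial>lborel) \<and>
     integrable lborel (\<lambda>z. v z * (X p n (fst z) * w (snd z)))"
    if v: "integrable lborel v" and vsupp: "\<And>z. z \<notin> ?S \<Longrightarrow> v z = 0" and w: "continuous_on UNIV w"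
    for v :: "real \<times> real \<Rightarrow> real" and w
  proof -
    have [measurable]: "v \<in> borel_measurable borel" using borel_measurable_integrable[OF v] by simp
    have [measurable]: "(\<lambda>z::real\<times>real. w (snd z)) \<in> borel_measurable borel"
      using w by (intro borel_measurable_fst_snd borel_measurable_continuous_onI)
    have [measurable]: "(\<lambda>z::real\<times>real. cutoff 0 p (Suc k) (fst z)) \<in> borel_measurable borel" for k
      by (intro borel_measurable_fst_snd borel_measurable_continuous_onI continuous_on_cutoff)
    note [measurable] = borel_measurable_fst_snd[OF borel_measurable_X]
    have "bounded (w ` {-T..T})"
      by (intro compact_imp_bounded compact_continuous_image continuous_on_subset[OF w]) auto
    then obtain B where B: "\<forall>t\<in>{-T..T}. \<bar>w t\<bar> \<le> B" unfolding bounded_iff by auto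
    let ?C = "sqrt \<bar>2 / p\<bar> * B"
    have bound: "norm (v z * (X p n (fst z) * r * w (snd z))) \<le> \<bar>v z\<bar> * ?C" if "0 \<le> r" "r \<le> 1" for z and r :: real
    proof (cases "z \<in> ?S")
      case True
      then have "\<bar>w (snd z)\<bar> \<le> B" using B by (auto simp: Om_def)
      moreover have "\<bar>X p n (fst z) * r\<bar> \<le> sqrt \<bar>2 / p\<bar>"
        using mult_mono[OF abs_X_le[of p n "fst z"], of "\<bar>r\<bar>" 1] that by (simp add: abs_mult)
      ultimately have "\<bar>X p n (fst z) * r * w (snd z)\<bar> \<le> ?C"
        unfolding abs_mult[of "X p n (fst z) * r"] by (intro mult_mono) auto
      then show ?thesis unfolding real_norm_def abs_mult[of "v z"] by (intro mult_left_mono) auto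
    qed (simp add: vsupp)
    have wint: "integrable lborel (\<lambda>z. \<bar>v z\<bar> * ?C)" using v by (intro integrable_mult_left) auto
    have "(\<lambda>k. \<integral>z. v z * (X p n (fst z) * cutoff 0 p (Suc k) (fst z) * w (snd z)) \<partial>lborel)
       \<longlonglongrightarrow> (\<integral>z. v z * (X p n (fst z) * w (snd z)) \<partial>lborel)"
    proof (rule integral_dominated_convergence[OF _ _ wint])
      show "AE z in lborel. norm (v z * (X p n (fst z) * cutoff 0 p (Suc k) (fst z) * w (snd z))) \<le> \<bar>v z\<bar> * ?C" for k
        by (intro AE_I2 bound cutoff_nonneg cutoff_le_1)
      show "AE z in lborel. (\<lambda>k. v z * (X p n (fst z) * cutoff 0 p (Suc k) (fst z) * w (snd z)))
           \<longlonglongrightarrow> v z * (X p n (fst z) * w (snd z))"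
      proof (rule AE_I2)
        fix z
        show "(\<lambda>k. v z * (X p n (fst z) * cutoff 0 p (Suc k) (fst z) * w (snd z)))
           \<longlonglongrightarrow> v z * (X p n (fst z) * w (snd z))"
        proof (cases "z \<in> ?S")
          case True
          then have "(\<lambda>k. cutoff 0 p (Suc k) (fst z)) \<longlonglongrightarrow> 1"
            by (intro LIMSEQ_Suc cutoff_tendsto) (auto simp: Om_def)
          then have "(\<lambda>k. v z * (X p n (fst z) * cutoff 0 p (Suc k) (fst z) * w (snd z)))
           \<longlonglongrightarrow> v z * (X p n (fst z) * 1 * w (snd z))" by (intro tendsto_intros)
          then show ?thesis by simp
        qed (simp add: vsupp)
      qed
    qed simp_all
    moreover have "integrable lborel (\<lambda>z. v z * (X p n (fst z) * w (snd z)))"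
      by (rule Bochner_Integration.integrable_bound[OF wint]) (use bound[of 1] in \<open>auto intro!: AE_I2 intro: order_trans[OF _ abs_ge_self]\<close>)
    ultimately show ?thesis by blast
  qed
  have eq: "(\<integral>z. H z * (X p n (fst z) * cutoff 0 p (Suc k) (fst z) * \<psi>2 (snd z)) \<partial>lborel)
      = (\<integral>z. G z * (X p n (fst z) * cutoff 0 p (Suc k) (fst z) * \<psi> (snd z)) \<partial>lborel)" for k
    unfolding H_def
    by (rule weak) (intro smooth_mult smooth_X smooth_cutoff supported_in_mult_cutoff order_refl)+
  note limH = lim[OF int_H Hsupp c(2)] and limG = lim[OF int_G supp c(1)]
  show "weak_pairing p T f G (X p n) \<psi> \<psi>2"
    using LIMSEQ_unique[OF limH[THEN conjunct1, unfolded eq] limG[THEN conjunct1]] by (simp add: H_def)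
  show "integrable lborel (\<lambda>z. indicator (Om p T) z * f (fst z) (snd z) * (X p n (fst z) * \<psi>2 (snd z)))"
    using limH by (simp add: H_def)
  show "integrable lborel (\<lambda>z. G z * (X p n (fst z) * \<psi> (snd z)))" using limG by blast
qed


text \<open>
  The function \<open>w n\<close> plays the role of \<open>f\<^sub>n''\<close>: it is the \<open>n\<close>-th sine coefficient of \<open>f\<^sub>t\<^sub>t\<close> on almost every
  horizontal line.  Testing with \<open>X p n x \<psi> t\<close> and integrating over \<open>x\<close> first shows that it is the weak derivative
  of \<open>F n = f\<^sub>n'\<close>.  Bessel's inequality on almost every line, integrated over \<open>t\<close>, bounds the sum of the squared
  \<open>L\<^sub>2\<close> norms by that of \<open>f\<^sub>t\<^sub>t\<close>.
\<close>

lemma weak_tt_coefficients: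
  assumes pT: "0 < p" "0 < T" and f: "continuous_on (closure (Om p T)) (\<lambda>(x, t). f x t)"
    and g: "\<exists>g. L2_on (Om p T) g \<and> weak_tt_derivative (Om p T) f g"
    and fc: "\<And>n. continuous_on {-T..T} (fc p f n)"
    and F: "\<And>n. continuous_on {-T..T} (F n)"
    and D: "\<And>n t. t \<in> {-T<..<T} \<Longrightarrow> (fc p f n has_real_derivative F n t) (at t)"
  obtains w :: "nat \<Rightarrow> real \<Rightarrow> real" where
    "\<And>n. w n absolutely_integrable_on {-T..T}"
    "\<And>n. (\<lambda>t. (w n t)\<^sup>2) integrable_on {-T..T}"
    "summable (\<lambda>n. integral {-T..T} (\<lambda>t. (w (Suc n) t)\<^sup>2))"
    "\<And>n. parts_on (-T) T (F n) (w n)"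
proof -
  from g obtain g where g: "L2_on (Om p T) g" "weak_tt_derivative (Om p T) f g" by blast
  obtain G where G [measurable]: "G \<in> borel_measurable borel" and supp: "\<And>z. z \<notin> Om p T \<Longrightarrow> G z = 0"
    and G2: "integrable lborel (\<lambda>z. (G z)\<^sup>2)"
    and weak: "\<And>\<eta> \<psi> \<psi>1 \<psi>2. smooth \<eta> \<Longrightarrow> smooth \<psi> \<Longrightarrow> (\<And>x. (\<psi> has_real_derivative \<psi>1 x) (at x)) \<Longrightarrow>
       (\<And>x. (\<psi>1 has_real_derivative \<psi>2 x) (at x)) \<Longrightarrow>
       supported_in 0 p \<eta> \<Longrightarrow> supported_in (-T) T \<psi> \<Longrightarrow>
       weak_pairing p T f G \<eta> \<psi> \<psi>2"
    using weak_tt_derivative_borel[OF pT f g] by blast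
  define w where "w n t = (\<integral>x. G (x, t) * X p n x \<partial>lborel)" for n t
  define Q where "Q t = (\<integral>x. (G (x, t))\<^sup>2 \<partial>lborel)" for t
  have Fubini: "(\<integral>t. \<integral>x. H (x, t) \<partial>lborel \<partial>lborel) = integral\<^sup>L lborel H"
      "integrable lborel (\<lambda>t. \<integral>x. H (x, t) \<partial>lborel)" "AE t in lborel. integrable lborel (\<lambda>x. H (x, t))"
    if "integrable lborel H" for H :: "real \<times> real \<Rightarrow> real"
    using that lborel_pair.integral_snd[of "\<lambda>x t. H (x, t)"] lborel_pair.integrable_snd[of "\<lambda>x t. H (x, t)"]
      lborel_pair.AE_integrable_snd[of "\<lambda>x t. H (x, t)"]
    by (simp_all add: lborel_prod case_prod_eta)
  have w0: "w n t = 0" if "t \<notin> {-T..T}" for n t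
  proof -
    have "G (x, t) = 0" for x using that by (intro supp) (auto simp: Om_def)
    then show ?thesis by (simp add: w_def)
  qed
  have fX: "continuous_on {0..p} (\<lambda>x. f x t * X p n x)" if "t \<in> {-T..T}" for t n
  proof -
    have "continuous_on {0..p} (\<lambda>x. (\<lambda>(x, t). f x t) (x, t))"
      using that by (intro continuous_on_compose2[OF f]) (auto simp: closure_Om pT intro!: continuous_intros)
    then show ?thesis by (auto intro!: continuous_intros)
  qed
  have identity: "integral {-T..T} (\<lambda>t. fc p f n t * \<psi>2 t) = (\<integral>t. w n t * \<psi> t \<partial>lborel) \<and>
       integrable lborel (\<lambda>t. w n t * \<psi> t)"
    if \<psi>: "smooth \<psi>" "smooth \<psi>2" and weak': "\<And>\<eta>. smooth \<eta> \<Longrightarrow> supported_in 0 p \<eta> \<Longrightarrow>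
       weak_pairing p T f G \<eta> \<psi> \<psi>2" for n \<psi> \<psi>2
  proof -
    note W = weak_identity_X[where n = n, OF pT f G _ G2 _ smooth_continuous[OF \<psi>(1)] smooth_continuous[OF \<psi>(2)]]
    have W1: "weak_pairing p T f G (X p n) \<psi> \<psi>2"
      by (rule W(1)) (erule supp, erule (1) weak')
    have W2: "integrable lborel (\<lambda>z. indicator (Om p T) z * f (fst z) (snd z) * (X p n (fst z) * \<psi>2 (snd z)))"
      by (rule W(2)) (erule supp, erule (1) weak')
    have W3: "integrable lborel (\<lambda>z. G z * (X p n (fst z) * \<psi> (snd z)))"
      by (rule W(3)) (erule supp, erule (1) weak')
    have w\<psi>: "w n t * \<psi> t = (\<integral>x. G (x, t) * (X p n x * \<psi> t) \<partial>lborel)" for t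
      unfolding w_def mult.assoc[symmetric] by (rule integral_mult_left_zero[symmetric])
    have "(\<integral>t. w n t * \<psi> t \<partial>lborel) = (\<integral>t. \<integral>x. G (x, t) * (X p n x * \<psi> t) \<partial>lborel \<partial>lborel)"
      unfolding w\<psi> ..
    also have "\<dots> = (\<integral>z. G z * (X p n (fst z) * \<psi> (snd z)) \<partial>lborel)"
      using Fubini(1)[OF W3] unfolding fst_conv snd_conv .
    also have "\<dots> = (\<integral>z. indicator (Om p T) z * f (fst z) (snd z) * (X p n (fst z) * \<psi>2 (snd z)) \<partial>lborel)"
      by (rule W1[symmetric])
    also have "\<dots> = (\<integral>t. \<integral>x. indicator (Om p T) (x, t) * f x t * (X p n x * \<psi>2 t) \<partial>lborel \<partial>lborel)"
      using Fubini(1)[OF W2] unfolding fst_conv snd_conv by (rule sym)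
    also have "\<dots> = (\<integral>t. indicator {-T<..<T} t * (fc p f n t * \<psi>2 t) \<partial>lborel)"
    proof (rule Bochner_Integration.integral_cong[OF refl])
      fix t
      have "(\<integral>x. indicator (Om p T) (x, t) * f x t * (X p n x * \<psi>2 t) \<partial>lborel)
         = (\<integral>x. (indicator {0<..<p} x * (f x t * X p n x)) * (indicator {-T<..<T} t * \<psi>2 t) \<partial>lborel)"
        by (intro Bochner_Integration.integral_cong) (auto simp: indicator_def Om_def)
      also have "\<dots> = (\<integral>x. indicator {0<..<p} x * (f x t * X p n x) \<partial>lborel) * (indicator {-T<..<T} t * \<psi>2 t)"
        by simp
      also have "\<dots> = fc p f n t * (indicator {-T<..<T} t * \<psi>2 t)"
        using integral_lborel_open_interval[OF fX[of t n]] by (cases "t \<in> {-T<..<T}") (auto simp: fc_def)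
      finally show "(\<integral>x. indicator (Om p T) (x, t) * f x t * (X p n x * \<psi>2 t) \<partial>lborel)
        = indicator {-T<..<T} t * (fc p f n t * \<psi>2 t)" by simp
    qed
    also have "\<dots> = integral {-T..T} (\<lambda>t. fc p f n t * \<psi>2 t)"
      by (intro integral_lborel_open_interval continuous_intros fc smooth_continuous \<psi>)
    finally have "integral {-T..T} (\<lambda>t. fc p f n t * \<psi>2 t) = (\<integral>t. w n t * \<psi> t \<partial>lborel)" by (rule sym)
    moreover have "integrable lborel (\<lambda>t. w n t * \<psi> t)"
      using Fubini(2)[OF W3] unfolding w\<psi> fst_conv snd_conv .
    ultimately show ?thesis by blast
  qed
  have int_G: "integrable lborel G" by (rule integrable_of_square_bounded_support[OF pT G supp G2])
  have GX: "integrable lborel (\<lambda>z. G z * X p n (fst z))" for n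
  proof (rule Bochner_Integration.integrable_bound[OF integrable_mult_left[OF integrable_abs[OF int_G], of "sqrt \<bar>2/p\<bar>"]])
    note [measurable] = borel_measurable_fst_snd[OF borel_measurable_X]
    show "(\<lambda>z. G z * X p n (fst z)) \<in> borel_measurable lborel" by simp
    show "AE z in lborel. norm (G z * X p n (fst z)) \<le> norm (\<bar>G z\<bar> * sqrt \<bar>2/p\<bar>)"
      unfolding real_norm_def abs_mult by (intro AE_I2 mult_mono) (auto intro: abs_X_le[simplified])
  qed
  have int_w: "integrable lborel (w n)" for n
    using Fubini(2)[OF GX[of n]] by (simp add: w_def[abs_def])
  have [measurable]: "w n \<in> borel_measurable borel" for n using borel_measurable_integrable[OF int_w[of n]] by simp
  have int_Q: "integrable lborel Q" using Fubini(2)[OF G2] by (simp add: Q_def[abs_def])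
  have Bessel: "AE t in lborel. (\<Sum>n=1..N. (w n t)\<^sup>2) \<le> Q t" for N
    using Fubini(3)[OF G2]
  proof eventually_elim
    case (elim t)
    have "(\<lambda>x. G (x, t)) \<in> borel_measurable borel"
      by (rule measurable_compose[OF _ G]) (intro borel_measurable_continuous_onI continuous_intros)
    moreover have "G (x, t) = 0" if "x \<notin> {0..p}" for x using that by (intro supp) (auto simp: Om_def)
    ultimately show ?case unfolding w_def Q_def using elim pT by (intro Bessel_X)
  qed
  have w2: "integrable lborel (\<lambda>t. (w n t)\<^sup>2)" for n
  proof (cases "n = 0")
    case True
    then show ?thesis by (simp add: w_def X_def lam_def)
  next
    case False
    show ?thesis
    proof (rule Bochner_Integration.integrable_bound[OF int_Q])
      show "AE t in lborel. norm ((w n t)\<^sup>2) \<le> norm (Q t)" using Bessel[of n]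
      proof eventually_elim
        case (elim t)
        have "(w n t)\<^sup>2 \<le> (\<Sum>n=1..n. (w n t)\<^sup>2)" using False by (intro member_le_sum) auto
        then show ?case using elim by simp
      qed
    qed simp
  qed
  have conv: "integral {-T..T} (\<lambda>t. (w n t)\<^sup>2) = (\<integral>t. (w n t)\<^sup>2 \<partial>lborel)"
     "(\<lambda>t. (w n t)\<^sup>2) integrable_on {-T..T}" for n
    using lborel_integral_supported[OF w2[of n], of "-T" T] w0 by (auto simp: absolutely_integrable_on_def)
  show ?thesis
  proof (rule that)
    show abs_w: "w n absolutely_integrable_on {-T..T}" for n
      using lborel_integral_supported(1)[OF int_w w0] .
    show "(\<lambda>t. (w n t)\<^sup>2) integrable_on {-T..T}" for n by (rule conv)
    show "summable (\<lambda>n. integral {-T..T} (\<lambda>t. (w (Suc n) t)\<^sup>2))"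
    proof (rule bounded_imp_summable)
      show "0 \<le> integral {-T..T} (\<lambda>t. (w (Suc n) t)\<^sup>2)" for n unfolding conv by simp
      show "(\<Sum>k\<le>n. integral {-T..T} (\<lambda>t. (w (Suc k) t)\<^sup>2)) \<le> (\<integral>t. Q t \<partial>lborel)" for n
      proof -
        have "(\<Sum>k\<le>n. integral {-T..T} (\<lambda>t. (w (Suc k) t)\<^sup>2)) = (\<Sum>k=1..Suc n. \<integral>t. (w k t)\<^sup>2 \<partial>lborel)"
          unfolding conv by (simp add: sum.atMost_shift atMost_atLeast0 sum.shift_bounds_cl_Suc_ivl del: sum.cl_ivl_Suc)
        also have "\<dots> = (\<integral>t. (\<Sum>k=1..Suc n. (w k t)\<^sup>2) \<partial>lborel)"
          by (intro Bochner_Integration.integral_sum[symmetric] w2)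
        also have "\<dots> \<le> (\<integral>t. Q t \<partial>lborel)"
          by (intro integral_mono_AE int_Q Bochner_Integration.integrable_sum w2 Bessel)
        finally show ?thesis .
      qed
    qed
    show "parts_on (-T) T (F n) (w n)" for n
    proof (rule parts_on_if_weak_derivative[OF F abs_w])
      fix \<psi> \<psi>1 :: "real \<Rightarrow> real"
      assume \<psi>: "smooth \<psi>" "\<And>x. (\<psi> has_real_derivative \<psi>1 x) (at x)" and supp: "supported_in (-T) T \<psi>"
      have \<psi>1: "smooth \<psi>1" by (rule smooth_deriv[OF \<psi>])
      obtain \<psi>2 where \<psi>2: "\<And>x. (\<psi>1 has_real_derivative \<psi>2 x) (at x)" "smooth \<psi>2"
        using smooth_obtain_deriv[OF \<psi>1] by blast
      have id: "integral {-T..T} (\<lambda>t. fc p f n t * \<psi>2 t) = (\<integral>t. w n t * \<psi> t \<partial>lborel) \<and>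
        integrable lborel (\<lambda>t. w n t * \<psi> t)"
      proof (rule identity[OF \<psi>(1) \<psi>2(2)])
        fix \<eta> assume e: "smooth \<eta>" "supported_in 0 p \<eta>"
        show "weak_pairing p T f G \<eta> \<psi> \<psi>2"
          by (rule weak[of \<eta> \<psi> \<psi>1 \<psi>2]; fact e \<psi> \<psi>2 supp)
      qed
      have "integral {-T..T} (\<lambda>t. w n t * \<psi> t) = integral {-T..T} (\<lambda>t. fc p f n t * \<psi>2 t)"
        using lborel_integral_supported(2)[OF id[THEN conjunct2], of "-T" T] w0 id by simp
      moreover have "((\<lambda>t. F n t * \<psi>1 t) has_integral - integral {-T..T} (\<lambda>t. fc p f n t * \<psi>2 t)) {-T..T}"
      proof (rule integration_by_parts_interior[OF bounded_bilinear_mult, where f = "fc p f n" and g' = \<psi>2])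
        have "\<psi>1 T = 0" "\<psi>1 (-T) = 0" using deriv_zero_at_ends[OF \<psi>(2) supp] by auto
        moreover have "(\<lambda>t. fc p f n t * \<psi>2 t) integrable_on {-T..T}"
          by (intro integrable_continuous_real continuous_intros fc smooth_continuous \<psi>2)
        ultimately show "((\<lambda>t. fc p f n t * \<psi>2 t) has_integral fc p f n T * \<psi>1 T - fc p f n (-T) * \<psi>1 (-T)
            - - integral {-T..T} (\<lambda>t. fc p f n t * \<psi>2 t)) {-T..T}"
          by (simp add: integrable_integral)
      qed (use pT fc D smooth_continuous[OF \<psi>1] \<psi>2 in \<open>auto simp: has_real_derivative_iff_has_vector_derivative[symmetric]\<close>)
      ultimately show "integral {-T..T} (\<lambda>t. F n t * \<psi>1 t) = - integral {-T..T} (\<lambda>t. w n t * \<psi> t)"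
        by (simp add: integral_unique)
    qed
  qed
qed

section \<open>The modes\<close>

lemma integral_by_parts_interior:
  fixes \<phi> \<phi>1 h h' :: "real \<Rightarrow> real"
  assumes rs: "r \<le> s" and \<phi>: "continuous_on {r..s} \<phi>" and D: "\<And>t. t \<in> {r<..<s} \<Longrightarrow> (\<phi> has_real_derivative \<phi>1 t) (at t)"
    and h: "\<And>t. (h has_real_derivative h' t) (at t)" and h': "continuous_on {r..s} h'"
  shows "integral {r..s} (\<lambda>t. \<phi>1 t * h t) = \<phi> s * h s - \<phi> r * h r - integral {r..s} (\<lambda>t. \<phi> t * h' t)"
proof (rule integral_unique, rule integration_by_parts_interior[OF bounded_bilinear_mult rs \<phi>])
  show "continuous_on {r..s} h" by (intro continuous_at_imp_continuous_on ballI DERIV_isCont[OF h])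
  have "(\<lambda>t. \<phi> t * h' t) integrable_on {r..s}"
    by (intro integrable_continuous_real continuous_intros \<phi> h')
  then show "((\<lambda>t. \<phi> t * h' t) has_integral \<phi> s * h s - \<phi> r * h r
      - (\<phi> s * h s - \<phi> r * h r - integral {r..s} (\<lambda>t. \<phi> t * h' t))) {r..s}"
    by (simp add: integrable_integral)
qed (use D h in \<open>auto simp: has_real_derivative_iff_has_vector_derivative[symmetric]\<close>)

abbreviation sin_conv :: "real \<Rightarrow> (real \<Rightarrow> real) \<Rightarrow> real \<Rightarrow> real" where
  "sin_conv l g t \<equiv> integral {0..t} (\<lambda>\<tau>. g \<tau> * sin (l * (t - \<tau>)))"

abbreviation cos_conv :: "real \<Rightarrow> (real \<Rightarrow> real) \<Rightarrow> real \<Rightarrow> real" where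
  "cos_conv l g t \<equiv> integral {0..t} (\<lambda>\<tau>. g \<tau> * cos (l * (t - \<tau>)))"

abbreviation exp_conv :: "real \<Rightarrow> (real \<Rightarrow> real) \<Rightarrow> real \<Rightarrow> real" where
  "exp_conv k g t \<equiv> integral {t..0} (\<lambda>\<tau>. g \<tau> * exp (k * (t - \<tau>)))"

text \<open>
  The factors of \<open>X p n x\<close> in the series for \<open>u\<close>, \<open>u\<^sub>t\<close> and \<open>u\<^sub>t\<^sub>t\<close>, with \<open>P\<close> for \<open>t > 0\<close> and \<open>M\<close> for \<open>t < 0\<close>.  Here
  \<open>l\<close> is the frequency, \<open>a = f\<^sub>n 0\<close>, \<open>b = f\<^sub>n' 0\<close>, and the last functional argument is \<open>f\<^sub>n\<close> or one of its
  derivatives.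
\<close>

definition modeP :: "real \<Rightarrow> real \<Rightarrow> real \<Rightarrow> (real \<Rightarrow> real) \<Rightarrow> real \<Rightarrow> real" where
  "modeP l a b \<phi> t = ((1 - l\<^sup>2) * a - b) / (l\<^sup>2 * (l\<^sup>2 + 1)) * cos (l * t)
     + (2 * a - b) / (l * (l\<^sup>2 + 1)) * sin (l * t) + 1 / l * sin_conv l \<phi> t"

definition modeP' :: "real \<Rightarrow> real \<Rightarrow> real \<Rightarrow> (real \<Rightarrow> real) \<Rightarrow> real \<Rightarrow> real" where
  "modeP' l a b \<phi> t = ((l\<^sup>2 - 1) * a + b) / (l * (l\<^sup>2 + 1)) * sin (l * t)
     + (2 * a - b) / (l\<^sup>2 + 1) * cos (l * t) + cos_conv l \<phi> t"

definition modeP'' :: "real \<Rightarrow> real \<Rightarrow> real \<Rightarrow> (real \<Rightarrow> real) \<Rightarrow> real \<Rightarrow> real" where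
  "modeP'' l a b \<phi>2 t = (2 * l\<^sup>2 * a + b) / (l\<^sup>2 + 1) * cos (l * t)
     + ((2 * l\<^sup>2 + 1) * b - 2 * l\<^sup>2 * a) / (l * (l\<^sup>2 + 1)) * sin (l * t)
     + 1 / l * sin_conv l \<phi>2 t"

definition modeM :: "real \<Rightarrow> real \<Rightarrow> real \<Rightarrow> (real \<Rightarrow> real) \<Rightarrow> real \<Rightarrow> real" where
  "modeM l a b \<phi> t = ((1 - l\<^sup>2) * a - b) / (l\<^sup>2 * (l\<^sup>2 + 1)) * exp (l\<^sup>2 * t)
     - exp_conv (l\<^sup>2) \<phi> t"

definition modeM' :: "real \<Rightarrow> real \<Rightarrow> real \<Rightarrow> (real \<Rightarrow> real) \<Rightarrow> real \<Rightarrow> real" where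
  "modeM' l a b \<phi>1 t = (2 * a - b) / (l\<^sup>2 + 1) * exp (l\<^sup>2 * t)
     - exp_conv (l\<^sup>2) \<phi>1 t"

definition modeM'' :: "real \<Rightarrow> real \<Rightarrow> real \<Rightarrow> (real \<Rightarrow> real) \<Rightarrow> real \<Rightarrow> real" where
  "modeM'' l a b \<phi>2 t = (2 * l\<^sup>2 * a + b) / (l\<^sup>2 + 1) * exp (l\<^sup>2 * t)
     - exp_conv (l\<^sup>2) \<phi>2 t"

text \<open>
  The addition theorems split the integrand into products of a function of \<open>t\<close> and a function of \<open>\<tau>\<close>, to which the
  fundamental theorem of calculus applies.
\<close>

lemma Duhamel_sin_cos_deriv:
  fixes \<phi> :: "real \<Rightarrow> real"
  assumes \<phi>: "continuous_on {0..T} \<phi>" and t: "t \<in> {0..T}"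
  shows "((\<lambda>t. sin_conv l \<phi> t) has_real_derivative
      l * cos_conv l \<phi> t) (at t within {0..T})"
    and "((\<lambda>t. cos_conv l \<phi> t) has_real_derivative
      \<phi> t - l * sin_conv l \<phi> t) (at t within {0..T})"
proof -
  let ?C = "\<lambda>t. integral {0..t} (\<lambda>\<tau>. \<phi> \<tau> * cos (l * \<tau>))" and ?S = "\<lambda>t. integral {0..t} (\<lambda>\<tau>. \<phi> \<tau> * sin (l * \<tau>))"
  have cC: "continuous_on {0..T} (\<lambda>\<tau>. \<phi> \<tau> * cos (l * \<tau>))" and cS: "continuous_on {0..T} (\<lambda>\<tau>. \<phi> \<tau> * sin (l * \<tau>))"
    by (intro continuous_intros \<phi>)+
  have dC: "(?C has_real_derivative \<phi> t * cos (l * t)) (at t within {0..T})"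
    and dS: "(?S has_real_derivative \<phi> t * sin (l * t)) (at t within {0..T})"
    using integral_has_real_derivative[OF cC t] integral_has_real_derivative[OF cS t] by auto
  have sin_eq: "sin_conv l \<phi> s = sin (l * s) * ?C s - cos (l * s) * ?S s"
    and cos_eq: "cos_conv l \<phi> s = cos (l * s) * ?C s + sin (l * s) * ?S s" if "s \<in> {0..T}" for s
  proof -
    have int: "(\<lambda>\<tau>. \<phi> \<tau> * cos (l * \<tau>)) integrable_on {0..s}" "(\<lambda>\<tau>. \<phi> \<tau> * sin (l * \<tau>)) integrable_on {0..s}"
      using that by (auto intro!: integrable_continuous_real continuous_on_subset[OF cC] continuous_on_subset[OF cS])
    have "sin_conv l \<phi> s
       = integral {0..s} (\<lambda>\<tau>. sin (l * s) * (\<phi> \<tau> * cos (l * \<tau>)) - cos (l * s) * (\<phi> \<tau> * sin (l * \<tau>)))"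
      by (intro integral_cong) (simp add: right_diff_distrib sin_diff algebra_simps)
    also have "\<dots> = sin (l * s) * ?C s - cos (l * s) * ?S s"
      by (subst Henstock_Kurzweil_Integration.integral_diff) (auto intro!: integrable_on_mult_right int)
    finally show "sin_conv l \<phi> s = sin (l * s) * ?C s - cos (l * s) * ?S s" .
    have "cos_conv l \<phi> s
       = integral {0..s} (\<lambda>\<tau>. cos (l * s) * (\<phi> \<tau> * cos (l * \<tau>)) + sin (l * s) * (\<phi> \<tau> * sin (l * \<tau>)))"
      by (intro integral_cong) (simp add: right_diff_distrib cos_diff algebra_simps)
    also have "\<dots> = cos (l * s) * ?C s + sin (l * s) * ?S s"
      by (subst Henstock_Kurzweil_Integration.integral_add) (auto intro!: integrable_on_mult_right int)
    finally show "cos_conv l \<phi> s = cos (l * s) * ?C s + sin (l * s) * ?S s" .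
  qed
  have trig: "((\<lambda>s. sin (l * s)) has_real_derivative l * cos (l * t)) (at t within {0..T})"
     "((\<lambda>s. cos (l * s)) has_real_derivative - l * sin (l * t)) (at t within {0..T})"
    by (auto intro!: derivative_eq_intros)
  have "((\<lambda>s. sin (l * s) * ?C s - cos (l * s) * ?S s) has_real_derivative
      l * (cos (l * t) * ?C t + sin (l * t) * ?S t)) (at t within {0..T})"
    by (rule DERIV_cong[OF DERIV_diff[OF DERIV_mult[OF trig(1) dC] DERIV_mult[OF trig(2) dS]]]) (simp add: algebra_simps)
  then show "((\<lambda>t. sin_conv l \<phi> t) has_real_derivative
      l * cos_conv l \<phi> t) (at t within {0..T})"
    unfolding cos_eq[OF t] by (rule has_field_derivative_transform_within[OF _ zero_less_one t]) (simp add: sin_eq)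
  have one: "\<phi> t * (cos (l * t) * cos (l * t)) + \<phi> t * (sin (l * t) * sin (l * t)) = \<phi> t"
    by (simp only: distrib_left[symmetric] sin_cos_squared_add3 mult_1_right)
  have "((\<lambda>s. cos (l * s) * ?C s + sin (l * s) * ?S s) has_real_derivative
      \<phi> t - l * (sin (l * t) * ?C t - cos (l * t) * ?S t)) (at t within {0..T})"
    by (rule DERIV_cong[OF DERIV_add[OF DERIV_mult[OF trig(2) dC] DERIV_mult[OF trig(1) dS]]])
      (use one in \<open>simp add: algebra_simps\<close>)
  then show "((\<lambda>t. cos_conv l \<phi> t) has_real_derivative
      \<phi> t - l * sin_conv l \<phi> t) (at t within {0..T})"
    unfolding sin_eq[OF t] by (rule has_field_derivative_transform_within[OF _ zero_less_one t]) (simp add: cos_eq)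
qed

lemma Duhamel_exp_deriv:
  fixes \<phi> :: "real \<Rightarrow> real"
  assumes \<phi>: "continuous_on {-T..0} \<phi>" and t: "t \<in> {-T..0}"
  shows "((\<lambda>t. exp_conv L \<phi> t) has_real_derivative
      L * exp_conv L \<phi> t - \<phi> t) (at t within {-T..0})"
proof -
  let ?E = "\<lambda>t. integral {t..0} (\<lambda>\<tau>. \<phi> \<tau> * exp (- (L * \<tau>)))"
  have eq: "exp_conv L \<phi> s = exp (L * s) * ?E s" for s
  proof -
    have "\<phi> \<tau> * exp (L * (s - \<tau>)) = exp (L * s) * (\<phi> \<tau> * exp (- (L * \<tau>)))" for \<tau>
      by (simp add: right_diff_distrib exp_diff exp_minus field_simps)
    then show ?thesis by (simp only: integral_mult_right)
  qed
  have "continuous_on {-T..0} (\<lambda>\<tau>. \<phi> \<tau> * exp (- (L * \<tau>)))" by (intro continuous_intros \<phi>)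
  from integral_has_real_derivative'[OF this t]
  have dE: "(?E has_real_derivative - (\<phi> t * exp (- (L * t)))) (at t within {-T..0})" .
  have de: "((\<lambda>s. exp (L * s)) has_real_derivative L * exp (L * t)) (at t within {-T..0})"
    by (auto intro!: derivative_eq_intros)
  show ?thesis unfolding eq
    by (rule DERIV_cong[OF DERIV_mult[OF de dE]]) (simp add: exp_minus field_simps)
qed

text \<open>
  The mode solves the oscillator equation \<open>c'' + l\<^sup>2 c = \<phi>\<close>.
\<close>

lemma modeP_deriv:
  assumes l: "0 < l" and \<phi>: "continuous_on {0..T} \<phi>" and t: "t \<in> {0..T}"
  shows "(modeP l a b \<phi> has_real_derivative modeP' l a b \<phi> t) (at t within {0..T})"
    and "(modeP' l a b \<phi> has_real_derivative - l\<^sup>2 * modeP l a b \<phi> t + \<phi> t) (at t within {0..T})"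
proof -
  have trig: "((\<lambda>s. sin (l * s)) has_real_derivative l * cos (l * t)) (at t within {0..T})"
     "((\<lambda>s. cos (l * s)) has_real_derivative - l * sin (l * t)) (at t within {0..T})"
    by (auto intro!: derivative_eq_intros)
  define A D where "A = ((1 - l\<^sup>2) * a - b) / (l\<^sup>2 * (l\<^sup>2 + 1))" and "D = (2 * a - b) / (l * (l\<^sup>2 + 1))"
  have pos: "l\<^sup>2 + 1 \<noteq> 0" using zero_le_power2[of l] by linarith
  have "((l\<^sup>2 - 1) * a + b) / (l * (l\<^sup>2 + 1)) = - l * A" "(2 * a - b) / (l\<^sup>2 + 1) = l * D"
    unfolding A_def D_def using l pos by (auto simp: divide_simps power2_eq_square) (auto simp: algebra_simps)
  then have P: "modeP l a b \<phi> = (\<lambda>t. A * cos (l * t) + D * sin (l * t) + 1 / l * sin_conv l \<phi> t)"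
    and P': "modeP' l a b \<phi> = (\<lambda>t. - l * A * sin (l * t) + l * D * cos (l * t) + cos_conv l \<phi> t)"
    by (simp_all add: modeP_def modeP'_def A_def D_def fun_eq_iff)
  show "(modeP l a b \<phi> has_real_derivative modeP' l a b \<phi> t) (at t within {0..T})"
    unfolding P P'
    by (rule DERIV_cong[OF DERIV_add[OF DERIV_add[OF DERIV_cmult[OF trig(2)] DERIV_cmult[OF trig(1)]]
          DERIV_cmult[OF Duhamel_sin_cos_deriv(1)[OF \<phi> t]]]]) (use l in simp)
  show "(modeP' l a b \<phi> has_real_derivative - l\<^sup>2 * modeP l a b \<phi> t + \<phi> t) (at t within {0..T})"
    unfolding P P'
    by (rule DERIV_cong[OF DERIV_add[OF DERIV_add[OF DERIV_cmult[OF trig(1)] DERIV_cmult[OF trig(2)]]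
          Duhamel_sin_cos_deriv(2)[OF \<phi> t]]]) (use l in \<open>simp add: algebra_simps power2_eq_square\<close>)
qed

text \<open>
  The mode solves the backward heat equation \<open>c' - l\<^sup>2 c = \<phi>\<close>.
\<close>

lemma modeM_deriv:
  assumes \<phi>: "continuous_on {-T..0} \<phi>" and t: "t \<in> {-T..0}"
  shows "(modeM l a b \<phi> has_real_derivative l\<^sup>2 * modeM l a b \<phi> t + \<phi> t) (at t within {-T..0})"
proof -
  have de: "((\<lambda>s. exp (l\<^sup>2 * s)) has_real_derivative l\<^sup>2 * exp (l\<^sup>2 * t)) (at t within {-T..0})"
    by (auto intro!: derivative_eq_intros)
  show ?thesis unfolding modeM_def[abs_def]
    by (rule DERIV_cong[OF DERIV_diff[OF DERIV_cmult[OF de] Duhamel_exp_deriv[OF \<phi> t]]]) (simp add: right_diff_distrib)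
qed

text \<open>
  Two integrations by parts, stated as hypotheses, move two derivatives onto \<open>\<phi>\<close> in the Duhamel integral of
  \<open>modeP\<close>.  The boundary terms change the coefficients of \<open>cos\<close> and \<open>sin\<close> into those of \<open>modeP''\<close>.
\<close>

lemma modeP''_eq:
  assumes l: "0 < l"
    and parts1: "cos_conv l \<phi>1 t = \<phi> t - a * cos (l * t) - l * sin_conv l \<phi> t"
    and parts2: "sin_conv l \<phi>2 t = - b * sin (l * t) + l * cos_conv l \<phi>1 t"
  shows "modeP'' l a b \<phi>2 t = - l\<^sup>2 * modeP l a b \<phi> t + \<phi> t"
proof -
  define I where "I = sin_conv l \<phi> t"
  define A D where "A = ((1 - l\<^sup>2) * a - b) / (l\<^sup>2 * (l\<^sup>2 + 1))" and "D = (2 * a - b) / (l * (l\<^sup>2 + 1))"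
  have pos: "l\<^sup>2 + 1 \<noteq> 0" using zero_le_power2[of l] by linarith
  have c: "(2 * l\<^sup>2 * a + b) / (l\<^sup>2 + 1) - a = - l\<^sup>2 * A"
     "((2 * l\<^sup>2 + 1) * b - 2 * l\<^sup>2 * a) / (l * (l\<^sup>2 + 1)) - b / l = - l\<^sup>2 * D"
    unfolding A_def D_def using l pos by (auto simp: divide_simps power2_eq_square) (auto simp: algebra_simps)
  have "modeP'' l a b \<phi>2 t = ((2 * l\<^sup>2 * a + b) / (l\<^sup>2 + 1) - a) * cos (l * t)
     + (((2 * l\<^sup>2 + 1) * b - 2 * l\<^sup>2 * a) / (l * (l\<^sup>2 + 1)) - b / l) * sin (l * t) + \<phi> t - l * I"
    unfolding modeP''_def parts2 parts1 I_def[symmetric] using l by (simp add: algebra_simps)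
  also have "\<dots> = - l\<^sup>2 * modeP l a b \<phi> t + \<phi> t"
    unfolding c modeP_def I_def[symmetric] A_def[symmetric] D_def[symmetric] using l by (simp add: algebra_simps power2_eq_square)
  finally show ?thesis .
qed

lemma modeM'_eq:
  assumes l: "0 < l"
    and parts: "exp_conv (l\<^sup>2) \<phi>1 t = a * exp (l\<^sup>2 * t) - \<phi> t + l\<^sup>2 * exp_conv (l\<^sup>2) \<phi> t"
  shows "modeM' l a b \<phi>1 t = l\<^sup>2 * modeM l a b \<phi> t + \<phi> t"
proof -
  define A where "A = ((1 - l\<^sup>2) * a - b) / (l\<^sup>2 * (l\<^sup>2 + 1))"
  have pos: "l\<^sup>2 + 1 \<noteq> 0" using zero_le_power2[of l] by linarith
  have c: "(2 * a - b) / (l\<^sup>2 + 1) - a = l\<^sup>2 * A"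
    unfolding A_def using l pos by (auto simp: divide_simps power2_eq_square) (auto simp: algebra_simps)
  have "modeM' l a b \<phi>1 t = ((2 * a - b) / (l\<^sup>2 + 1) - a) * exp (l\<^sup>2 * t) + \<phi> t
      - l\<^sup>2 * exp_conv (l\<^sup>2) \<phi> t"
    unfolding modeM'_def parts by (simp add: left_diff_distrib)
  also have "\<dots> = l\<^sup>2 * modeM l a b \<phi> t + \<phi> t" unfolding c modeM_def A_def[symmetric] by (simp add: right_diff_distrib)
  finally show ?thesis .
qed

lemma modeM''_eq:
  assumes parts: "exp_conv (l\<^sup>2) \<phi>2 t = b * exp (l\<^sup>2 * t) - \<phi>1 t + l\<^sup>2 * exp_conv (l\<^sup>2) \<phi>1 t"
  shows "modeM'' l a b \<phi>2 t = l\<^sup>2 * modeM' l a b \<phi>1 t + \<phi>1 t"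
proof -
  have pos: "l\<^sup>2 + 1 \<noteq> 0" using zero_le_power2[of l] by linarith
  have c: "(2 * l\<^sup>2 * a + b) / (l\<^sup>2 + 1) - b = l\<^sup>2 * ((2 * a - b) / (l\<^sup>2 + 1))"
    using pos by (auto simp: divide_simps) (auto simp: algebra_simps)
  have "modeM'' l a b \<phi>2 t = ((2 * l\<^sup>2 * a + b) / (l\<^sup>2 + 1) - b) * exp (l\<^sup>2 * t) + \<phi>1 t
      - l\<^sup>2 * exp_conv (l\<^sup>2) \<phi>1 t"
    unfolding modeM''_def parts by (simp add: left_diff_distrib)
  also have "\<dots> = l\<^sup>2 * modeM' l a b \<phi>1 t + \<phi>1 t" unfolding c modeM'_def by (simp add: right_diff_distrib)
  finally show ?thesis .
qed


text \<open>
  The denominators are bounded below by \<open>l (l\<^sup>2 + 1) \<ge> 2 l\<^sup>2\<close>.  In the last coefficient the term \<open>2 \<bar>b\<bar> / l\<close> is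
  bounded by \<open>b\<^sup>2 + 1 / l\<^sup>2\<close>, because the numbers \<open>b = f\<^sub>n' 0\<close> are only known to be square summable.
\<close>

lemma mode_coefficient_bounds:
  fixes a b l M B :: real
  assumes l: "0 < l" and a: "\<bar>a\<bar> \<le> M" and b: "\<bar>b\<bar> \<le> B"
  shows "\<bar>((1 - l\<^sup>2) * a - b) / (l\<^sup>2 * (l\<^sup>2 + 1))\<bar> \<le> (M + B) / l\<^sup>2" (is ?c1)
    and "\<bar>(2 * a - b) / (l * (l\<^sup>2 + 1))\<bar> \<le> (M + B) / l\<^sup>2" (is ?c2)
    and "\<bar>((l\<^sup>2 - 1) * a + b) / (l * (l\<^sup>2 + 1))\<bar> \<le> M / l + B / l\<^sup>2" (is ?c3)
    and "\<bar>(2 * a - b) / (l\<^sup>2 + 1)\<bar> \<le> 2 * M + B / l\<^sup>2" (is ?c4)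
    and "\<bar>(2 * l\<^sup>2 * a + b) / (l\<^sup>2 + 1)\<bar> \<le> 2 * M + B / l\<^sup>2" (is ?c5)
    and "\<bar>((2 * l\<^sup>2 + 1) * b - 2 * l\<^sup>2 * a) / (l * (l\<^sup>2 + 1))\<bar> \<le> b\<^sup>2 + 1 / l\<^sup>2 + M" (is ?c6)
proof -
  define k where "k = l\<^sup>2"
  have k: "0 < k" using l by (simp add: k_def)
  have M0: "0 \<le> M" and B0: "0 \<le> B" using a b by linarith+
  have "0 \<le> l * (l - 1)\<^sup>2" using l by simp
  then have lk: "2 * k \<le> l * (k + 1)" by (simp add: k_def power2_eq_square algebra_simps)
  have pos: "0 < l * (k + 1)" "0 < k * (k + 1)" using l k by simp_all
  have absd: "\<bar>l * (k + 1)\<bar> = l * (k + 1)" using pos by simp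
  have prod: "\<bar>c * a\<bar> \<le> c' * M" if "\<bar>c\<bar> \<le> c'" for c c' :: real
    using mult_mono[OF that a] that by (simp add: abs_mult)
  have n1: "\<bar>(1 - k) * a\<bar> \<le> (k + 1) * M" "\<bar>(k - 1) * a\<bar> \<le> (k + 1) * M" "\<bar>2 * k * a\<bar> \<le> 2 * k * M"
    using k by (intro prod; simp)+
  have kB: "0 \<le> k * B" "0 \<le> k * M" using k B0 M0 by simp_all
  have "\<bar>(1 - k) * a - b\<bar> \<le> (M + B) * (k + 1)" using n1 b kB by (simp add: algebra_simps)
  then have "\<bar>(1 - k) * a - b\<bar> / (k * (k + 1)) \<le> (M + B) * (k + 1) / (k * (k + 1))"
    using pos by (intro divide_right_mono) auto
  then show ?c1 unfolding k_def[symmetric] abs_divide using k by simp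
  have "\<bar>2 * a - b\<bar> / (l * (k + 1)) \<le> 2 * (M + B) / (2 * k)"
    using a b lk k B0 M0 by (intro frac_le) auto
  then show ?c2 unfolding k_def[symmetric] abs_divide absd by (subst (asm) mult_divide_mult_cancel_left) auto
  have "\<bar>(k - 1) * a + b\<bar> \<le> (k + 1) * M + B" using n1 b by linarith
  then have "\<bar>(k - 1) * a + b\<bar> / (l * (k + 1)) \<le> ((k + 1) * M + B) / (l * (k + 1))"
    using pos by (intro divide_right_mono) auto
  also have "\<dots> = M / l + B / (l * (k + 1))" using k l by (simp add: add_divide_distrib)
  also have "\<dots> \<le> M / l + B / k" using lk k B0 by (intro add_left_mono frac_le) auto
  finally show ?c3 unfolding k_def[symmetric] abs_divide absd .
  have "\<bar>2 * a - b\<bar> / (k + 1) \<le> (2 * M + B) / (k + 1)" using a b k by (intro divide_right_mono) auto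
  also have "\<dots> \<le> 2 * M / 1 + B / k"
    unfolding add_divide_distrib using k M0 B0 by (intro add_mono frac_le) auto
  finally show ?c4 unfolding k_def[symmetric] abs_divide using k by simp
  have "\<bar>2 * k * a + b\<bar> / (k + 1) \<le> (2 * k * M + B) / (k + 1)" using n1 b k by (intro divide_right_mono) auto
  also have "\<dots> \<le> 2 * M + B / k"
  proof -
    have "2 * k * M / (k + 1) \<le> 2 * M" using k M0 by (simp add: divide_le_eq algebra_simps)
    moreover have "B / (k + 1) \<le> B / k" using k B0 by (intro frac_le) auto
    ultimately show ?thesis unfolding add_divide_distrib by linarith
  qed
  finally show ?c5 unfolding k_def[symmetric] abs_divide using k by simp
  have "\<bar>(2 * k + 1) * b - 2 * k * a\<bar> \<le> 2 * (k + 1) * \<bar>b\<bar> + 2 * k * M"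
  proof -
    have "\<bar>(2 * k + 1) * b\<bar> \<le> 2 * (k + 1) * \<bar>b\<bar>" using k by (simp add: abs_mult mult_right_mono)
    then show ?thesis using n1(3) by linarith
  qed
  then have "\<bar>(2 * k + 1) * b - 2 * k * a\<bar> / (l * (k + 1)) \<le> (2 * (k + 1) * \<bar>b\<bar> + 2 * k * M) / (l * (k + 1))"
    using pos by (intro divide_right_mono) auto
  also have "\<dots> = 2 * \<bar>b\<bar> / l + 2 * k * M / (l * (k + 1))"
  proof -
    have "2 * (k + 1) * \<bar>b\<bar> / (l * (k + 1)) = 2 * \<bar>b\<bar> / l"
      using mult_divide_mult_cancel_right[of "k + 1" "2 * \<bar>b\<bar>" l] k by (simp only: mult_ac)
    then show ?thesis by (simp only: add_divide_distrib)
  qed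
  also have "\<dots> \<le> b\<^sup>2 + 1 / k + M"
  proof (rule add_mono)
    have "0 \<le> (\<bar>b\<bar> - 1 / l)\<^sup>2" by simp
    then show "2 * \<bar>b\<bar> / l \<le> b\<^sup>2 + 1 / k" using l by (simp add: power2_diff k_def power_divide)
    show "2 * k * M / (l * (k + 1)) \<le> M"
      using pos mult_right_mono[OF lk M0] by (simp add: divide_le_eq mult.commute)
  qed
  finally show ?c6 unfolding k_def[symmetric] abs_divide absd .
qed

lemma abs_mult_sin_cos_le: "\<bar>y\<bar> \<le> M \<Longrightarrow> \<bar>y * sin z\<bar> \<le> M" "\<bar>y\<bar> \<le> M \<Longrightarrow> \<bar>y * cos z\<bar> \<le> (M::real)"
  using mult_mono[of "\<bar>y\<bar>" M "\<bar>sin z\<bar>" 1] mult_mono[of "\<bar>y\<bar>" M "\<bar>cos z\<bar>" 1] by (simp_all add: abs_mult)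

lemma abs_add3_le: "\<bar>x\<bar> \<le> A \<Longrightarrow> \<bar>y\<bar> \<le> B \<Longrightarrow> \<bar>z\<bar> \<le> C \<Longrightarrow> A + B + C = D \<Longrightarrow> \<bar>x + y + z\<bar> \<le> (D::real)"
  by linarith

text \<open>
  Used instead of the Cauchy-Schwarz inequality to bound integrals of \<open>f\<^sub>n''\<close> by those of its square.
\<close>

lemma abs_le_square_plus: "0 < l \<Longrightarrow> \<bar>y\<bar> \<le> l * y\<^sup>2 + 1 / (l::real)"
proof -
  assume l: "0 < l"
  have "0 \<le> (l * \<bar>y\<bar> - 1)\<^sup>2 / l" using l by simp
  also have "\<dots> = l * y\<^sup>2 - 2 * \<bar>y\<bar> + 1 / l" using l by (simp add: power2_diff field_simps power2_eq_square)
  finally show ?thesis using abs_ge_zero[of y] by linarith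
qed

lemma modeP_bounds:
  assumes l: "0 < l" and \<phi>: "continuous_on {0..T} \<phi>" and M: "\<And>\<tau>. \<tau> \<in> {0..T} \<Longrightarrow> \<bar>\<phi> \<tau>\<bar> \<le> M"
    and a: "\<bar>a\<bar> \<le> M" and b: "\<bar>b\<bar> \<le> B"
    and v: "v absolutely_integrable_on {0..T}" and v2: "(\<lambda>t. (v t)\<^sup>2) integrable_on {0..T}"
    and G: "integral {0..T} (\<lambda>t. (v t)\<^sup>2) \<le> G" and t: "t \<in> {0..T}"
  shows "\<bar>modeP l a b \<phi> t\<bar> \<le> 2 * ((M + B) / l\<^sup>2) + T * (M / l)"
    and "\<bar>modeP' l a b \<phi> t\<bar> \<le> M / l + 2 * (B / l\<^sup>2) + (2 + T) * M"
    and "\<bar>modeP'' l a b v t\<bar> \<le> 3 * M + (B + 1 + T) / l\<^sup>2 + b\<^sup>2 + G"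
proof -
  note c = mode_coefficient_bounds[OF l a b]
  have M0: "0 \<le> M" using a by linarith
  have \<phi>t: "continuous_on {0..t} \<phi>" by (rule continuous_on_subset[OF \<phi>]) (use t in auto)
  have MT: "M * (t - 0) \<le> T * M" using t mult_right_mono[OF _ M0, of t T] by (simp add: mult.commute)
  have "norm (sin_conv l \<phi> t) \<le> M * (t - 0)"
    using t by (intro integral_bound continuous_intros \<phi>t) (auto intro!: abs_mult_sin_cos_le M)
  then have "\<bar>sin_conv l \<phi> t\<bar> \<le> T * M" using MT by simp
  then have I1: "\<bar>1 / l * sin_conv l \<phi> t\<bar> \<le> T * (M / l)"
    using l by (simp add: abs_mult divide_right_mono)
  show "\<bar>modeP l a b \<phi> t\<bar> \<le> 2 * ((M + B) / l\<^sup>2) + T * (M / l)"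
    unfolding modeP_def
    by (rule abs_add3_le[OF abs_mult_sin_cos_le(2)[OF c(1)] abs_mult_sin_cos_le(1)[OF c(2)] I1]) simp
  have "norm (cos_conv l \<phi> t) \<le> M * (t - 0)"
    using t by (intro integral_bound continuous_intros \<phi>t) (auto intro!: abs_mult_sin_cos_le M)
  then have I2: "\<bar>cos_conv l \<phi> t\<bar> \<le> T * M" using MT by simp
  show "\<bar>modeP' l a b \<phi> t\<bar> \<le> M / l + 2 * (B / l\<^sup>2) + (2 + T) * M"
    unfolding modeP'_def
    by (rule abs_add3_le[OF abs_mult_sin_cos_le(1)[OF c(3)] abs_mult_sin_cos_le(2)[OF c(4)] I2]) (simp add: algebra_simps)
  have sub: "{0..t} \<subseteq> {0..T}" using t by auto
  have v2t: "(\<lambda>t. (v t)\<^sup>2) integrable_on {0..t}" by (rule integrable_on_subinterval[OF v2 sub])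
  have "norm (sin_conv l v t) \<le> integral {0..t} (\<lambda>\<tau>. l * (v \<tau>)\<^sup>2 + 1 / l)"
  proof (rule integral_norm_bound_integral)
    have "v absolutely_integrable_on {0..t}" using absolutely_integrable_on_subinterval[OF v sub] .
    then have "(\<lambda>\<tau>. v \<tau> * sin (l * (t - \<tau>))) absolutely_integrable_on {0..t}"
      by (rule absolutely_integrable_mult_continuous) (intro continuous_intros)
    then show "(\<lambda>\<tau>. v \<tau> * sin (l * (t - \<tau>))) integrable_on {0..t}" by (simp add: absolutely_integrable_on_def)
    show "(\<lambda>\<tau>. l * (v \<tau>)\<^sup>2 + 1 / l) integrable_on {0..t}"
      by (intro integrable_add integrable_on_mult_right v2t) auto
    show "norm (v \<tau> * sin (l * (t - \<tau>))) \<le> l * (v \<tau>)\<^sup>2 + 1 / l" for \<tau>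
      unfolding real_norm_def by (intro abs_mult_sin_cos_le abs_le_square_plus l)
  qed
  also have "integral {0..t} (\<lambda>\<tau>. l * (v \<tau>)\<^sup>2 + 1 / l) = l * integral {0..t} (\<lambda>\<tau>. (v \<tau>)\<^sup>2) + t * (1 / l)"
    using t by (subst Henstock_Kurzweil_Integration.integral_add) (auto intro!: integrable_on_mult_right v2t)
  also have "\<dots> \<le> l * G + t * (1 / l)"
    using integral_subset_le[OF sub v2t v2] G l by (intro add_right_mono mult_left_mono) auto
  finally have "\<bar>sin_conv l v t\<bar> \<le> l * G + T * (1 / l)"
    using l mult_right_mono[of t T "1 / l"] t by simp
  then have "1 / l * \<bar>sin_conv l v t\<bar> \<le> 1 / l * (l * G + T * (1 / l))"
    using l by (intro mult_left_mono) auto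
  also have "\<dots> = G + T / l\<^sup>2" using l by (simp add: distrib_left power2_eq_square)
  finally have I3: "\<bar>1 / l * sin_conv l v t\<bar> \<le> G + T / l\<^sup>2"
    using l by (simp add: abs_mult)
  show "\<bar>modeP'' l a b v t\<bar> \<le> 3 * M + (B + 1 + T) / l\<^sup>2 + b\<^sup>2 + G"
    unfolding modeP''_def
    by (rule abs_add3_le[OF abs_mult_sin_cos_le(2)[OF c(5)] abs_mult_sin_cos_le(1)[OF c(6)] I3]) (simp add: add_divide_distrib)
qed

text \<open>
  The function \<open>\<phi>1\<close> is tied to the continuous function \<open>\<phi>1'\<close> only through its integrals, because it will be a
  two-sided derivative \<open>f\<^sub>n'\<close>, whose value at the end point \<open>-T\<close> is arbitrary.
\<close>

lemma modeM_bounds: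
  assumes l: "0 < l" and \<phi>: "continuous_on {-T..0} \<phi>" and M: "\<And>\<tau>. \<tau> \<in> {-T..0} \<Longrightarrow> \<bar>\<phi> \<tau>\<bar> \<le> M"
    and \<phi>1: "\<And>t. t \<in> {-T..0} \<Longrightarrow> exp_conv (l\<^sup>2) \<phi>1 t = exp_conv (l\<^sup>2) \<phi>1' t"
    and \<phi>1': "continuous_on {-T..0} \<phi>1'" and B: "\<And>\<tau>. \<tau> \<in> {-T..0} \<Longrightarrow> \<bar>\<phi>1' \<tau>\<bar> \<le> B"
    and a: "\<bar>a\<bar> \<le> M" and b: "\<bar>b\<bar> \<le> B"
    and v: "v absolutely_integrable_on {-T..0}" and v2: "(\<lambda>t. (v t)\<^sup>2) integrable_on {-T..0}"
    and G: "integral {-T..0} (\<lambda>t. (v t)\<^sup>2) \<le> G" and t: "t \<in> {-T..0}"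
  shows "\<bar>modeM l a b \<phi> t\<bar> \<le> (M + B) / l\<^sup>2 + T * M"
    and "\<bar>modeM' l a b \<phi>1 t\<bar> \<le> 2 * M + 2 * (B / l\<^sup>2)"
    and "\<bar>modeM'' l a b v t\<bar> \<le> 2 * M + (B + 1) / l\<^sup>2 + G"
proof -
  note c = mode_coefficient_bounds[OF l a b]
  have M0: "0 \<le> M" and B0: "0 \<le> B" using a b by linarith+
  have e1: "exp (l\<^sup>2 * (t - \<tau>)) \<le> 1" if "t \<le> \<tau>" for \<tau> using that by (simp add: mult_nonneg_nonpos)
  have abs_exp: "\<bar>y * exp z\<bar> \<le> N" if "\<bar>y\<bar> \<le> N" "z \<le> 0" for y z N :: real
    using mult_mono[of "\<bar>y\<bar>" N "exp z" 1] that by (simp add: abs_mult)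
  have lt: "l\<^sup>2 * t \<le> 0" using t by (simp add: mult_nonneg_nonpos)
  have sub: "{t..0} \<subseteq> {-T..0}" using t by auto
  have "((\<lambda>\<tau>. exp (L * (t - \<tau>))) has_integral (- exp (L * (t - 0)) / L - - exp (L * (t - t)) / L)) {t..0}"
    if "0 < L" for L :: real
    using t that by (intro fundamental_theorem_of_calculus)
      (auto simp: has_real_derivative_iff_has_vector_derivative[symmetric] intro!: derivative_eq_intros)
  from this[of "l\<^sup>2"] l have ex: "(\<lambda>\<tau>. exp (l\<^sup>2 * (t - \<tau>))) integrable_on {t..0}" "integral {t..0} (\<lambda>\<tau>. exp (l\<^sup>2 * (t - \<tau>))) \<le> 1 / l\<^sup>2"
    by (auto simp: integral_unique)
  have "norm (exp_conv (l\<^sup>2) \<phi> t) \<le> M * (0 - t)"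
    using t by (intro integral_bound continuous_intros continuous_on_subset[OF \<phi> sub])
      (auto intro!: abs_exp M simp: mult_nonneg_nonpos)
  also have "\<dots> \<le> T * M" using t M0 mult_right_mono[of "-t" T M] by (simp add: mult.commute)
  finally have I: "\<bar>exp_conv (l\<^sup>2) \<phi> t\<bar> \<le> T * M" by simp
  show "\<bar>modeM l a b \<phi> t\<bar> \<le> (M + B) / l\<^sup>2 + T * M"
    unfolding modeM_def by (rule order_trans[OF abs_triangle_ineq4 add_mono[OF abs_exp[OF c(1) lt] I]])
  have "norm (exp_conv (l\<^sup>2) \<phi>1' t) \<le> integral {t..0} (\<lambda>\<tau>. B * exp (l\<^sup>2 * (t - \<tau>)))"
  proof (rule integral_norm_bound_integral)
    show "(\<lambda>\<tau>. \<phi>1' \<tau> * exp (l\<^sup>2 * (t - \<tau>))) integrable_on {t..0}"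
      by (intro integrable_continuous_real continuous_intros continuous_on_subset[OF \<phi>1' sub])
    show "(\<lambda>\<tau>. B * exp (l\<^sup>2 * (t - \<tau>))) integrable_on {t..0}" by (intro integrable_on_mult_right ex)
    show "norm (\<phi>1' \<tau> * exp (l\<^sup>2 * (t - \<tau>))) \<le> B * exp (l\<^sup>2 * (t - \<tau>))" if "\<tau> \<in> {t..0}" for \<tau>
      using B[of \<tau>] that t by (simp add: abs_mult mult_right_mono)
  qed
  also have "integral {t..0} (\<lambda>\<tau>. B * exp (l\<^sup>2 * (t - \<tau>))) \<le> B * (1 / l\<^sup>2)"
    unfolding integral_mult_right by (intro mult_left_mono ex B0)
  finally have I': "\<bar>exp_conv (l\<^sup>2) \<phi>1' t\<bar> \<le> B / l\<^sup>2" by simp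
  have "\<bar>modeM' l a b \<phi>1 t\<bar> \<le> 2 * M + B / l\<^sup>2 + B / l\<^sup>2"
    unfolding modeM'_def \<phi>1[OF t] by (rule order_trans[OF abs_triangle_ineq4 add_mono[OF abs_exp[OF c(4) lt] I']])
  then show "\<bar>modeM' l a b \<phi>1 t\<bar> \<le> 2 * M + 2 * (B / l\<^sup>2)" by simp
  have v2t: "(\<lambda>t. (v t)\<^sup>2) integrable_on {t..0}" by (rule integrable_on_subinterval[OF v2 sub])
  have "norm (exp_conv (l\<^sup>2) v t) \<le> integral {t..0} (\<lambda>\<tau>. (v \<tau>)\<^sup>2 + exp (l\<^sup>2 * (t - \<tau>)))"
  proof (rule integral_norm_bound_integral)
    have "v absolutely_integrable_on {t..0}" using absolutely_integrable_on_subinterval[OF v sub] .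
    then have "(\<lambda>\<tau>. v \<tau> * exp (l\<^sup>2 * (t - \<tau>))) absolutely_integrable_on {t..0}"
      by (rule absolutely_integrable_mult_continuous) (intro continuous_intros)
    then show "(\<lambda>\<tau>. v \<tau> * exp (l\<^sup>2 * (t - \<tau>))) integrable_on {t..0}" by (simp add: absolutely_integrable_on_def)
    show "(\<lambda>\<tau>. (v \<tau>)\<^sup>2 + exp (l\<^sup>2 * (t - \<tau>))) integrable_on {t..0}"
      by (intro integrable_add ex v2t)
    show "norm (v \<tau> * exp (l\<^sup>2 * (t - \<tau>))) \<le> (v \<tau>)\<^sup>2 + exp (l\<^sup>2 * (t - \<tau>))" if "\<tau> \<in> {t..0}" for \<tau>
    proof -
      define E where "E = exp (l\<^sup>2 * (t - \<tau>))"
      have E: "0 < E" "E \<le> 1" using e1[of \<tau>] that by (auto simp: E_def)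
      have "E * \<bar>v \<tau>\<bar> \<le> E * (1 * (v \<tau>)\<^sup>2 + 1 / 1)"
        using E by (intro mult_left_mono abs_le_square_plus) auto
      also have "\<dots> \<le> (v \<tau>)\<^sup>2 + E" using E mult_right_mono[of E 1 "(v \<tau>)\<^sup>2"] by (simp add: distrib_left)
      finally show ?thesis by (simp add: abs_mult E_def mult.commute)
    qed
  qed
  also have "\<dots> = integral {t..0} (\<lambda>\<tau>. (v \<tau>)\<^sup>2) + integral {t..0} (\<lambda>\<tau>. exp (l\<^sup>2 * (t - \<tau>)))"
    by (intro Henstock_Kurzweil_Integration.integral_add ex v2t)
  also have "\<dots> \<le> G + 1 / l\<^sup>2"
    using integral_subset_le[OF sub v2t v2] G ex by simp
  finally have I: "\<bar>exp_conv (l\<^sup>2) v t\<bar> \<le> G + 1 / l\<^sup>2" by simp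
  have "\<bar>modeM'' l a b v t\<bar> \<le> 2 * M + B / l\<^sup>2 + (G + 1 / l\<^sup>2)"
    unfolding modeM''_def by (rule order_trans[OF abs_triangle_ineq4 add_mono[OF abs_exp[OF c(5) lt] I]])
  then show "\<bar>modeM'' l a b v t\<bar> \<le> 2 * M + (B + 1) / l\<^sup>2 + G" by (simp add: add_divide_distrib)
qed

section \<open>Series of modes\<close>

lemma abs_X_mult_le: "\<bar>c\<bar> \<le> K \<Longrightarrow> norm (X p n x * c) \<le> sqrt \<bar>2 / p\<bar> * K"
  unfolding real_norm_def abs_mult by (intro mult_mono abs_X_le) auto

lemma abs_unif_convergent_X:
  assumes S: "S \<subseteq> UNIV \<times> I" and K: "\<And>n t. 1 \<le> n \<Longrightarrow> t \<in> I \<Longrightarrow> \<bar>m n t\<bar> \<le> K n" and s: "summable (\<lambda>n. K (Suc n))"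
  shows "abs_unif_convergent S (\<lambda>n x t. X p n x * m n t)"
  unfolding abs_unif_convergent_def
proof
  have sK: "summable (\<lambda>n. sqrt \<bar>2 / p\<bar> * K (Suc n))" by (intro summable_mult s)
  have bound: "norm (X p (Suc n) x * m (Suc n) t) \<le> sqrt \<bar>2 / p\<bar> * K (Suc n)" if "(x, t) \<in> S" for n x t
    using that S by (intro abs_X_mult_le K) auto
  show "\<forall>(x, t)\<in>S. summable (\<lambda>n. \<bar>X p (Suc n) x * m (Suc n) t\<bar>)"
  proof clarify
    fix x t assume "(x, t) \<in> S"
    then show "summable (\<lambda>n. \<bar>X p (Suc n) x * m (Suc n) t\<bar>)"
      using bound by (intro summable_comparison_test'[OF sK, of 0]) auto
  qed
  have "uniformly_convergent_on S (\<lambda>N z. \<Sum>n<N. X p (Suc n) (fst z) * m (Suc n) (snd z))"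
    by (rule Weierstrass_m_test'[OF _ sK]) (use bound in auto)
  moreover have "(\<lambda>N (x, t). \<Sum>n=1..N. X p n x * m n t) = (\<lambda>N z. \<Sum>n<N. X p (Suc n) (fst z) * m (Suc n) (snd z))"
  proof (intro ext, clarify)
    fix N x t
    have "(\<Sum>n=1..N. X p n x * m n t) = (\<Sum>n<N. X p (Suc n) x * m (Suc n) t)"
      by (rule sum.reindex_bij_witness[of _ Suc "\<lambda>n. n - 1"]) auto
    then show "(\<Sum>n=1..N. X p n x * m n t) = (\<Sum>n<N. X p (Suc n) (fst (x, t)) * m (Suc n) (snd (x, t)))" by simp
  qed
  ultimately show "uniformly_convergent_on S (\<lambda>N (x, t). \<Sum>n=1..N. X p n x * m n t)" by simp
qed

lemma summable_X_mult:
  assumes "\<And>n. 1 \<le> n \<Longrightarrow> \<bar>c n\<bar> \<le> K n" and s: "summable (\<lambda>n. K (Suc n))"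
  shows "summable (\<lambda>n. X p (Suc n) x * c (Suc n))"
  by (rule summable_comparison_test'[OF summable_mult[OF s, of "sqrt \<bar>2 / p\<bar>"], of 0])
    (rule abs_X_mult_le, rule assms(1), simp)

lemma ser_X_has_derivative:
  assumes t: "t \<in> {c<..<d}" and D: "\<And>n t. 1 \<le> n \<Longrightarrow> t \<in> {c<..<d} \<Longrightarrow> (m n has_real_derivative m' n t) (at t)"
    and K: "\<And>n t. 1 \<le> n \<Longrightarrow> t \<in> {c<..<d} \<Longrightarrow> \<bar>m n t\<bar> \<le> K n" and K': "\<And>n t. 1 \<le> n \<Longrightarrow> t \<in> {c<..<d} \<Longrightarrow> \<bar>m' n t\<bar> \<le> K n"
    and s: "summable (\<lambda>n. K (Suc n))"
  shows "((\<lambda>t. ser (\<lambda>n x t. X p n x * m n t) x t) has_real_derivative ser (\<lambda>n x t. X p n x * m' n t) x t) (at t)"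
  unfolding ser_def
proof (rule has_field_derivative_series'(2)[where S = "{c<..<d}"])
  show "((\<lambda>t. X p (Suc n) x * m (Suc n) t) has_field_derivative X p (Suc n) x * m' (Suc n) s) (at s within {c<..<d})"
    if "s \<in> {c<..<d}" for n s
    using that by (intro DERIV_cmult has_field_derivative_at_within[OF D]) auto
  show "uniformly_convergent_on {c<..<d} (\<lambda>n t. \<Sum>i<n. X p (Suc i) x * m' (Suc i) t)"
    by (rule Weierstrass_m_test'[OF _ summable_mult[OF s, of "sqrt \<bar>2 / p\<bar>"]]) (intro abs_X_mult_le K', auto)
  show "summable (\<lambda>n. X p (Suc n) x * m (Suc n) t)"
    using K t by (intro summable_X_mult[OF _ s]) auto
qed (use t in \<open>auto simp: interior_open\<close>)

lemma ser_X_continuous: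
  assumes cont: "\<And>n. 1 \<le> n \<Longrightarrow> continuous_on I (m n)"
    and K: "\<And>n t. 1 \<le> n \<Longrightarrow> t \<in> I \<Longrightarrow> \<bar>m n t\<bar> \<le> K n" and s: "summable (\<lambda>n. K (Suc n))"
  shows "continuous_on I (\<lambda>t. ser (\<lambda>n x t. X p n x * m n t) x t)"
proof -
  have "uniform_limit I (\<lambda>N t. \<Sum>n<N. X p (Suc n) x * m (Suc n) t) (\<lambda>t. \<Sum>n. X p (Suc n) x * m (Suc n) t) sequentially"
    by (rule Weierstrass_m_test[OF _ summable_mult[OF s, of "sqrt \<bar>2 / p\<bar>"]]) (intro abs_X_mult_le K, auto)
  then show ?thesis unfolding ser_def
    by (rule uniform_limit_theorem[rotated]) (auto intro!: always_eventually continuous_intros cont)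
qed

lemma has_second_derivativeI:
  assumes S: "open S" "a \<in> S" and 1: "\<And>s. s \<in> S \<Longrightarrow> (g has_real_derivative g1 s) (at s)" and 2: "(g1 has_real_derivative d) (at a)"
  shows "has_second_derivative g d a"
  unfolding has_second_derivative_def
proof
  show "\<forall>\<^sub>F s in nhds a. g field_differentiable at s"
    using eventually_nhds_in_open[OF S] by eventually_elim (use 1 in \<open>auto simp: field_differentiable_def\<close>)
  show "(deriv g has_real_derivative d) (at a)"
    by (rule has_field_derivative_transform_within_open[OF 2 S]) (use 1 in \<open>auto intro: DERIV_imp_deriv[symmetric]\<close>)
qed

text \<open>
  Each differentiation in \<open>x\<close> costs a factor \<open>lam p n\<close>, so the coefficients, multiplied by its first two powers,
  must stay summable.
\<close>

lemma X_series_second_derivative: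
  fixes c K :: "nat \<Rightarrow> real"
  assumes K0: "\<And>n. 1 \<le> n \<Longrightarrow> \<bar>c n\<bar> \<le> K n" and K1: "\<And>n. 1 \<le> n \<Longrightarrow> \<bar>lam p n * c n\<bar> \<le> K n"
    and K2: "\<And>n. 1 \<le> n \<Longrightarrow> \<bar>(lam p n)\<^sup>2 * c n\<bar> \<le> K n" and s: "summable (\<lambda>n. K (Suc n))"
  shows "has_second_derivative (\<lambda>y. \<Sum>n. X p (Suc n) y * c (Suc n)) (\<Sum>n. X p (Suc n) x * (- (lam p (Suc n))\<^sup>2 * c (Suc n))) x"
proof (rule has_second_derivativeI[OF open_UNIV UNIV_I])
  let ?X' = "\<lambda>n y. sqrt (2 / p) * cos (lam p n * y)"
  have X': "(X p n has_real_derivative ?X' n y * lam p n) (at y)"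
    and X'': "(?X' n has_real_derivative - (X p n y) * lam p n) (at y)" for n y
    unfolding X_def[abs_def] by (auto intro!: derivative_eq_intros)
  have X'_le: "norm (?X' n y * r) \<le> sqrt \<bar>2 / p\<bar> * k" if "\<bar>r\<bar> \<le> k" for n y r k
  proof -
    have "\<bar>?X' n y\<bar> \<le> sqrt \<bar>2 / p\<bar> * 1"
      unfolding abs_mult by (intro mult_mono) (auto simp: real_sqrt_abs2 abs_le_iff simp flip: real_sqrt_abs')
    then show ?thesis unfolding real_norm_def abs_mult[of "?X' n y"] using that by (intro mult_mono) auto
  qed
  note sK = summable_mult[OF s, of "sqrt \<bar>2 / p\<bar>"]
  show "((\<lambda>y. \<Sum>n. X p (Suc n) y * c (Suc n)) has_real_derivative (\<Sum>n. ?X' (Suc n) y * (lam p (Suc n) * c (Suc n)))) (at y)" for y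
  proof (rule has_field_derivative_series'(2)[where S = UNIV])
    show "((\<lambda>y. X p (Suc n) y * c (Suc n)) has_field_derivative ?X' (Suc n) y * (lam p (Suc n) * c (Suc n))) (at y within UNIV)" for n y
      using DERIV_cmult_right[OF X'] by (simp only: mult.assoc)
    show "uniformly_convergent_on UNIV (\<lambda>n y. \<Sum>i<n. ?X' (Suc i) y * (lam p (Suc i) * c (Suc i)))"
      by (rule Weierstrass_m_test'[OF _ sK]) (intro X'_le K1, auto)
    show "summable (\<lambda>n. X p (Suc n) y * c (Suc n))" by (rule summable_X_mult[OF K0 s])
  qed auto
  show "((\<lambda>y. \<Sum>n. ?X' (Suc n) y * (lam p (Suc n) * c (Suc n))) has_real_derivative
      (\<Sum>n. X p (Suc n) x * (- (lam p (Suc n))\<^sup>2 * c (Suc n)))) (at x)"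
  proof (rule has_field_derivative_series'(2)[where S = UNIV])
    show "((\<lambda>y. ?X' (Suc n) y * (lam p (Suc n) * c (Suc n))) has_field_derivative X p (Suc n) y * (- (lam p (Suc n))\<^sup>2 * c (Suc n))) (at y within UNIV)" for n y
      by (rule DERIV_cong[OF DERIV_cmult_right[OF X'']]) (simp add: power2_eq_square mult_ac)
    show "uniformly_convergent_on UNIV (\<lambda>n y. \<Sum>i<n. X p (Suc i) y * (- (lam p (Suc i))\<^sup>2 * c (Suc i)))"
      by (rule Weierstrass_m_test'[OF _ sK]) (intro abs_X_mult_le, use K2 in auto)
    show "summable (\<lambda>n. ?X' (Suc n) x * (lam p (Suc n) * c (Suc n)))"
      by (rule summable_comparison_test'[OF sK, of 0]) (intro X'_le K1, auto)
  qed auto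
qed

lemma has_second_derivative_transform:
  assumes S: "open S" "a \<in> S" and eq: "\<And>s. s \<in> S \<Longrightarrow> g s = h s" and g: "has_second_derivative g d a"
  shows "has_second_derivative h d a"
proof -
  have ev: "\<forall>\<^sub>F s in nhds a. s \<in> S" by (rule eventually_nhds_in_open[OF S])
  have gh: "\<forall>\<^sub>F r in nhds s. g r = h r" if "s \<in> S" for s
    using eventually_nhds_in_open[OF S(1) that] by eventually_elim (rule eq)
  have "\<forall>\<^sub>F s in nhds a. h field_differentiable at s"
    using ev g[unfolded has_second_derivative_def, THEN conjunct1]
  proof eventually_elim
    case (elim s)
    then show ?case unfolding field_differentiable_def using DERIV_cong_ev[OF refl gh[OF elim(1)] refl] by blast
  qed
  moreover have "(deriv h has_real_derivative d) (at a)"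
    by (rule has_field_derivative_transform_within_open[OF g[unfolded has_second_derivative_def, THEN conjunct2] S])
      (intro deriv_cong_ev gh refl)
  ultimately show ?thesis unfolding has_second_derivative_def by blast
qed

lemma conjugate_at_0I:
  assumes T: "0 < T" and P: "continuous_on {0..T} gP" "\<And>t. t \<in> {0<..<T} \<Longrightarrow> g t = gP t"
    and M: "continuous_on {-T..0} gM" "\<And>t. t \<in> {-T<..<0} \<Longrightarrow> g t = gM t" and eq: "gP 0 = gM 0"
  shows "conjugate_at_0 g"
  unfolding conjugate_at_0_def
proof (intro exI conjI)
  have "(gP \<longlongrightarrow> gP 0) (at_right 0)"
    using P(1) T unfolding continuous_on_def by (auto simp: at_within_Icc_at_right dest: bspec[of _ _ 0])
  moreover have "\<forall>\<^sub>F t in at_right 0. gP t = g t"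
    using eventually_at_right_less[of "0::real"] eventually_at_right_real[OF T] by eventually_elim (use P(2) in auto)
  ultimately show "(g \<longlongrightarrow> gP 0) (at_right 0)" by (rule Lim_transform_eventually)
  have "(gM \<longlongrightarrow> gM 0) (at_left 0)"
    using M(1) T unfolding continuous_on_def by (auto simp: at_within_Icc_at_left dest: bspec[of _ _ 0])
  moreover have "\<forall>\<^sub>F t in at_left 0. gM t = g t"
    using eventually_at_left_real[of "-T" 0] T by (auto elim!: eventually_mono simp: M(2))
  ultimately show "(g \<longlongrightarrow> gP 0) (at_left 0)" unfolding eq by (rule Lim_transform_eventually)
qed

text \<open>
  A common bound of all modes of one frequency, with constants large enough for every estimate in
  \<open>modeP_bounds\<close> and \<open>modeM_bounds\<close>, and for the \<open>x\<close>-derivatives, which need one more \<open>M\<close>.  Here \<open>M\<close> bounds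
  \<open>f\<^sub>n\<close>, \<open>B\<close> bounds \<open>f\<^sub>n'\<close>, \<open>b = f\<^sub>n' 0\<close>, and \<open>G\<close> is the integral of \<open>(f\<^sub>n'')\<^sup>2\<close>.
\<close>

definition mode_majorant :: "real \<Rightarrow> real \<Rightarrow> real \<Rightarrow> real \<Rightarrow> real \<Rightarrow> real \<Rightarrow> real" where
  "mode_majorant T M B l b G =
     (5 + T) * M + (1 + T) * (M / l) + 2 * (M / l\<^sup>2) + (2 * B + 1 + T) / l\<^sup>2 + b\<^sup>2 + G"

lemma mode_majorant_ge:
  assumes "0 \<le> T" "0 \<le> M" "0 \<le> B" "0 < l" "0 \<le> G"
  shows "2 * ((M + B) / l\<^sup>2) + T * (M / l) \<le> mode_majorant T M B l b G" (is ?g1)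
    and "M / l + 2 * (B / l\<^sup>2) + (2 + T) * M \<le> mode_majorant T M B l b G" (is ?g2)
    and "3 * M + (B + 1 + T) / l\<^sup>2 + b\<^sup>2 + G + M \<le> mode_majorant T M B l b G" (is ?g3)
    and "(M + B) / l\<^sup>2 + T * M \<le> mode_majorant T M B l b G" (is ?g4)
    and "2 * M + 2 * (B / l\<^sup>2) + M \<le> mode_majorant T M B l b G" (is ?g5)
    and "2 * M + (B + 1) / l\<^sup>2 + G \<le> mode_majorant T M B l b G" (is ?g6)
proof -
  define y z q r \<tau> where "y = M / l" and "z = M / l\<^sup>2" and "q = B / l\<^sup>2" and "r = 1 / l\<^sup>2" and "\<tau> = T / l\<^sup>2"
  define tm ty bb where "tm = T * M" and "ty = T * y" and "bb = b\<^sup>2"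
  have nn: "0 \<le> y" "0 \<le> z" "0 \<le> q" "0 \<le> r" "0 \<le> \<tau>" "0 \<le> tm" "0 \<le> ty" "0 \<le> bb"
    using assms by (simp_all add: y_def z_def q_def r_def \<tau>_def tm_def ty_def bb_def)
  have K: "mode_majorant T M B l b G = 5 * M + tm + y + ty + 2 * z + 2 * q + r + \<tau> + bb + G"
    by (simp add: mode_majorant_def y_def z_def q_def r_def \<tau>_def tm_def ty_def bb_def add_divide_distrib distrib_right)
  have e: "(M + B) / l\<^sup>2 = z + q" "(B + 1 + T) / l\<^sup>2 = q + r + \<tau>" "(B + 1) / l\<^sup>2 = q + r" "B / l\<^sup>2 = q" "M / l = y"
    "(2 + T) * M = 2 * M + tm" "T * y = ty" "T * M = tm" "b\<^sup>2 = bb"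
    by (simp_all add: y_def z_def q_def r_def \<tau>_def tm_def ty_def bb_def add_divide_distrib distrib_right)
  note nn' = nn assms(2,5)
  show ?g1 unfolding K e distrib_left using nn' by linarith
  show ?g2 unfolding K e distrib_left using nn' by linarith
  show ?g3 unfolding K e distrib_left using nn' by linarith
  show ?g4 unfolding K e distrib_left using nn' by linarith
  show ?g5 unfolding K e distrib_left using nn' by linarith
  show ?g6 unfolding K e distrib_left using nn' by linarith
qed

lemma inverse_lam_le:
  assumes "0 < p" "1 \<le> n"
  shows "1 / lam p n \<le> p / pi"
  using assms by (simp add: lam_def field_simps)

lemma summable_mode_majorant:
  assumes p: "0 < p" and M0: "\<And>n. 0 \<le> M (Suc n)" and M: "summable (\<lambda>n. M (Suc n))"
    and b: "summable (\<lambda>n. (b (Suc n))\<^sup>2)" and G: "summable (\<lambda>n. G (Suc n))"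
  shows "summable (\<lambda>n. mode_majorant T (M (Suc n)) B (lam p (Suc n)) (b (Suc n)) (G (Suc n)))"
proof -
  have inv: "0 \<le> 1 / lam p (Suc n)" "1 / lam p (Suc n) \<le> p / pi" for n
    using lam_pos[OF p, of "Suc n"] inverse_lam_le[OF p, of "Suc n"] by auto
  have Ml: "summable (\<lambda>n. M (Suc n) / lam p (Suc n))"
  proof (rule summable_comparison_test'[OF summable_mult[OF M, of "p / pi"], of 0])
    show "norm (M (Suc n) / lam p (Suc n)) \<le> p / pi * M (Suc n)" for n
      using mult_left_mono[OF inv(2) M0, of n n] inv(1)[of n] M0[of n] by (simp add: abs_mult mult.commute)
  qed
  have "summable (\<lambda>n. M (Suc n) / lam p (Suc n) / lam p (Suc n))"
  proof (rule summable_comparison_test'[OF summable_mult[OF Ml, of "p / pi"], of 0])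
    show "norm (M (Suc n) / lam p (Suc n) / lam p (Suc n)) \<le> p / pi * (M (Suc n) / lam p (Suc n))" for n
      using mult_left_mono[OF inv(2), of "M (Suc n) / lam p (Suc n)" n] inv(1)[of n] M0[of n] by (simp add: abs_mult mult.commute)
  qed
  then have Ml2: "summable (\<lambda>n. M (Suc n) / (lam p (Suc n))\<^sup>2)" by (simp add: power2_eq_square)
  have "summable (\<lambda>n. (p / pi)\<^sup>2 * (1 / real (Suc n) ^ 2))"
    using summable_Suc_iff[of "\<lambda>n. 1 / real n ^ 2"] inverse_power_summable[of 2, where 'a = real]
    by (intro summable_mult) (simp add: inverse_eq_divide)
  moreover have "(p / pi)\<^sup>2 * (1 / real (Suc n) ^ 2) = 1 / (lam p (Suc n))\<^sup>2" for n
    using p by (simp only: lam_def power_divide power_mult_distrib) simp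
  ultimately have l2: "summable (\<lambda>n. 1 / (lam p (Suc n))\<^sup>2)" by simp
  have "summable (\<lambda>n. (5 + T) * M (Suc n) + (1 + T) * (M (Suc n) / lam p (Suc n)) + 2 * (M (Suc n) / (lam p (Suc n))\<^sup>2)
     + (2 * B + 1 + T) * (1 / (lam p (Suc n))\<^sup>2) + (b (Suc n))\<^sup>2 + G (Suc n))"
    by (intro summable_add summable_mult M Ml Ml2 l2 b G)
  then show ?thesis by (simp add: mode_majorant_def)
qed

lemma uP_term_eq: "uP_term p f = (\<lambda>n x t. X p n x * modeP (lam p n) (fc p f n 0) (fc1 p f n 0) (fc p f n) t)"
  and utP_term_eq: "utP_term p f = (\<lambda>n x t. X p n x * modeP' (lam p n) (fc p f n 0) (fc1 p f n 0) (fc p f n) t)"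
  and uttP_term_eq: "uttP_term p f = (\<lambda>n x t. X p n x * modeP'' (lam p n) (fc p f n 0) (fc1 p f n 0) (fc2 p f n) t)"
  and uM_term_eq: "uM_term p f = (\<lambda>n x t. X p n x * modeM (lam p n) (fc p f n 0) (fc1 p f n 0) (fc p f n) t)"
  and utM_term_eq: "utM_term p f = (\<lambda>n x t. X p n x * modeM' (lam p n) (fc p f n 0) (fc1 p f n 0) (fc1 p f n) t)"
  and uttM_term_eq: "uttM_term p f = (\<lambda>n x t. X p n x * modeM'' (lam p n) (fc p f n 0) (fc1 p f n 0) (fc2 p f n) t)"
  by (simp_all add: fun_eq_iff Let_def uP_term_def utP_term_def uttP_term_def uM_term_def utM_term_def uttM_term_def
      modeP_def modeP'_def modeP''_def modeM_def modeM'_def modeM''_def)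

lemma uxxP_term_eq: "uxxP_term p f = (\<lambda>n x t. X p n x * (modeP'' (lam p n) (fc p f n 0) (fc1 p f n 0) (fc2 p f n) t - fc p f n t))"
proof (intro ext)
  have "X p n x * (A - f0 + D + I) = X p n x * (A + D + I - f0)" for A D I f0 :: real and n x
    by (simp add: algebra_simps)
  then show "uxxP_term p f n x t = X p n x * (modeP'' (lam p n) (fc p f n 0) (fc1 p f n 0) (fc2 p f n) t - fc p f n t)" for n x t
    unfolding uxxP_term_def modeP''_def Let_def .
qed

lemma uxxM_term_eq: "uxxM_term p f = (\<lambda>n x t. X p n x * (fc p f n t - modeM' (lam p n) (fc p f n 0) (fc1 p f n 0) (fc1 p f n) t))"
proof (intro ext)
  have "X p n x * ((b - 2 * a) / k * E + f0 + I) = X p n x * (f0 - ((2 * a - b) / k * E - I))" for a b k E I f0 :: real and n x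
    by (simp add: algebra_simps diff_divide_distrib)
  then show "uxxM_term p f n x t = X p n x * (fc p f n t - modeM' (lam p n) (fc p f n 0) (fc1 p f n 0) (fc1 p f n) t)" for n x t
    unfolding uxxM_term_def modeM'_def Let_def .
qed

section \<open>The solution of the conjugation problem\<close>

lemma Om_plus_eq: "0 < T \<Longrightarrow> Om_plus p T = {0<..<p} \<times> {0<..<T}"
  and Om_minus_eq: "0 < T \<Longrightarrow> Om_minus p T = {0<..<p} \<times> {-T<..<0}"
  by (auto simp: Om_plus_def Om_minus_def Om_def)

text \<open>
  The equal right-hand sides are the conjugation conditions.
\<close>

lemma modes_at_0:
  "modeP l a b \<phi> 0 = ((1 - l\<^sup>2) * a - b) / (l\<^sup>2 * (l\<^sup>2 + 1))"
  "modeM l a b \<phi> 0 = ((1 - l\<^sup>2) * a - b) / (l\<^sup>2 * (l\<^sup>2 + 1))"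
  "modeP' l a b \<phi> 0 = (2 * a - b) / (l\<^sup>2 + 1)"
  "modeM' l a b \<phi> 0 = (2 * a - b) / (l\<^sup>2 + 1)"
  "modeP'' l a b \<phi> 0 = (2 * l\<^sup>2 * a + b) / (l\<^sup>2 + 1)"
  "modeM'' l a b \<phi> 0 = (2 * l\<^sup>2 * a + b) / (l\<^sup>2 + 1)"
  by (simp_all add: modeP_def modeM_def modeP'_def modeM'_def modeP''_def modeM''_def)

lemma X_boundary: "0 < p \<Longrightarrow> X p n 0 = 0" "0 < p \<Longrightarrow> X p n p = 0"
  by (simp_all add: X_def lam_def sin_npi)

theorem theorem2:
  fixes p T \<alpha> :: real and f fx ft :: "real \<Rightarrow> real \<Rightarrow> real"
  assumes "0 < p" and "0 < T"
    and "C1_closure (Om p T) f fx ft"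
    and "\<exists>g. L2_on (Om p T) g \<and> weak_tt_derivative (Om p T) f g"
    and "\<forall>t\<in>{-T..T}. f 0 t = 0 \<and> f p t = 0"
    and "0 < \<alpha>" and "\<alpha> < 1"
    and "\<exists>L. \<forall>t\<in>{-T..T}. \<forall>x\<in>{0..p}. \<forall>y\<in>{0..p}. \<bar>fx x t - fx y t\<bar> \<le> L * \<bar>x - y\<bar> powr \<alpha>"
  shows
    "abs_unif_convergent (closure (Om_plus p T)) (uP_term p f) \<and>
     abs_unif_convergent (closure (Om_plus p T)) (utP_term p f) \<and>
     abs_unif_convergent (closure (Om_plus p T)) (uttP_term p f) \<and>
     abs_unif_convergent (closure (Om_plus p T)) (uxxP_term p f) \<and>
     abs_unif_convergent (closure (Om_minus p T)) (uM_term p f) \<and>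
     abs_unif_convergent (closure (Om_minus p T)) (utM_term p f) \<and>
     abs_unif_convergent (closure (Om_minus p T)) (uxxM_term p f) \<and>
     abs_unif_convergent (closure (Om_minus p T)) (uttM_term p f) \<and>
     (\<forall>(x, t)\<in>Om_plus p T.
        ((\<lambda>s. ser (uP_term p f) x s) has_real_derivative ser (utP_term p f) x t) (at t) \<and>
        has_second_derivative (\<lambda>s. ser (uP_term p f) x s) (ser (uttP_term p f) x t) t \<and>
        has_second_derivative (\<lambda>y. ser (uP_term p f) y t) (ser (uxxP_term p f) x t) x) \<and>
     (\<forall>(x, t)\<in>Om_minus p T.
        ((\<lambda>s. ser (uM_term p f) x s) has_real_derivative ser (utM_term p f) x t) (at t) \<and>
        has_second_derivative (\<lambda>s. ser (uM_term p f) x s) (ser (uttM_term p f) x t) t \<and>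
        has_second_derivative (\<lambda>y. ser (uM_term p f) y t) (ser (uxxM_term p f) x t) x) \<and>
     (\<forall>(x, t)\<in>Om_plus p T. \<exists>utt uxx.
        has_second_derivative (\<lambda>s. u p f x s) utt t \<and>
        has_second_derivative (\<lambda>y. u p f y t) uxx x \<and> utt - uxx = f x t) \<and>
     (\<forall>(x, t)\<in>Om_minus p T. \<exists>ut uxx.
        ((\<lambda>s. u p f x s) has_real_derivative ut) (at t) \<and>
        has_second_derivative (\<lambda>y. u p f y t) uxx x \<and> ut + uxx = f x t) \<and>
     (\<forall>t\<in>{-T<..<T}. u p f 0 t = 0 \<and> u p f p t = 0) \<and>
     (\<forall>x\<in>{0<..<p}.
        conjugate_at_0 (\<lambda>t. u p f x t) \<and>
        conjugate_at_0 (\<lambda>t. deriv (\<lambda>s. u p f x s) t) \<and>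
        conjugate_at_0 (\<lambda>t. deriv (deriv (\<lambda>s. u p f x s)) t))"
proof -
  note p = \<open>0 < p\<close> and T = \<open>0 < T\<close> and bdry = \<open>\<forall>t\<in>{-T..T}. f 0 t = 0 \<and> f p t = 0\<close>
  have f: "continuous_on ({0..p} \<times> {-T..T}) (\<lambda>(x, t). f x t)"
    and fx: "continuous_on ({0..p} \<times> {-T..T}) (\<lambda>(x, t). fx x t)"
    and ft: "continuous_on ({0..p} \<times> {-T..T}) (\<lambda>(x, t). ft x t)"
    and D: "\<And>x t. x \<in> {0<..<p} \<Longrightarrow> t \<in> {-T<..<T} \<Longrightarrow> ((\<lambda>y. f y t) has_real_derivative fx x t) (at x) \<and>
          ((\<lambda>s. f x s) has_real_derivative ft x t) (at t)"
    using assms(3) unfolding C1_closure_def closure_Om[OF p T] by (auto simp: Om_def)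
  obtain L where L: "\<And>t x y. t \<in> {-T..T} \<Longrightarrow> x \<in> {0..p} \<Longrightarrow> y \<in> {0..p} \<Longrightarrow> \<bar>fx x t - fx y t\<bar> \<le> L * \<bar>x - y\<bar> powr \<alpha>"
    using assms(8) by blast
  have bounded: "\<exists>B. \<forall>t\<in>{-T..T}. \<forall>x\<in>{0..p}. \<bar>g x t\<bar> \<le> B"
    if "continuous_on ({0..p} \<times> {-T..T}) (\<lambda>(x, t). g x t)" for g :: "real \<Rightarrow> real \<Rightarrow> real"
  proof -
    have "bounded ((\<lambda>(x, t). g x t) ` ({0..p} \<times> {-T..T}))"
      by (intro compact_imp_bounded compact_continuous_image that compact_Times compact_Icc)
    then show ?thesis unfolding bounded_iff by fastforce
  qed
  obtain Bx where Bx: "\<And>t x. t \<in> {-T..T} \<Longrightarrow> x \<in> {0..p} \<Longrightarrow> \<bar>fx x t\<bar> \<le> Bx" using bounded[OF fx] by blast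
  obtain Bt where Bt: "\<And>t x. t \<in> {-T..T} \<Longrightarrow> x \<in> {0..p} \<Longrightarrow> \<bar>ft x t\<bar> \<le> Bt" using bounded[OF ft] by blast
  define F where "F n t = integral {0..p} (\<lambda>x. ft x t * X p n x)" for n t
  define M where "M n = sqrt (2 / p) / lam p n * ((p / n) * Bx + p * (L * (p / n) powr \<alpha>))" for n
  define B where "B = Bt * sqrt \<bar>2 / p\<bar> * p"
  let ?l = "lam p" and ?\<phi> = "fc p f" and ?\<phi>1 = "fc1 p f" and ?\<phi>2 = "fc2 p f"
  let ?a = "\<lambda>n. ?\<phi> n 0" and ?b = "\<lambda>n. ?\<phi>1 n 0"
  have c\<phi>: "continuous_on {-T..T} (?\<phi> n)" for n
    using continuous_on_coefficient[OF f, of n] by (simp add: fc_def[abs_def])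
  have cF: "continuous_on {-T..T} (F n)" for n
    using continuous_on_coefficient[OF ft, of n] by (simp add: F_def[abs_def])
  have D\<phi>: "(?\<phi> n has_real_derivative F n t) (at t)" if "t \<in> {-T<..<T}" for n t
    unfolding F_def by (rule fc_has_derivative[OF p f ft _ that]) (use D in blast)
  have \<phi>1: "?\<phi>1 n t = F n t" if "t \<in> {-T<..<T}" for n t
    unfolding fc1_def by (rule DERIV_imp_deriv[OF D\<phi>[OF that]])
  have b: "?b n = F n 0" for n using \<phi>1[of 0 n] T by simp
  have M: "\<bar>?\<phi> n t\<bar> \<le> M n" if n: "1 \<le> n" and t: "t \<in> {-T..T}" for n t
  proof -
    have "\<bar>?\<phi> n s\<bar> \<le> M n" if s: "s \<in> {-T<..<T}" for s
    proof -
      have s': "s \<in> {-T..T}" using s by auto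
      show ?thesis unfolding fc_def M_def
        by (rule abs_coefficient_le_Hoelder[OF p n continuous_on_slice[OF f s'] continuous_on_slice[OF fx s']])
          (use D Bx L bdry s s' in auto)
    qed
    \<comment> \<open>The partial derivatives are only given for \<open>\<bar>t\<bar> < T\<close>; the bound reaches the end points by continuity.\<close>
    then have "norm (?\<phi> n t) \<le> M n"
      using c\<phi>[of n] t T by (intro continuous_on_closure_norm_le[of "{-T<..<T}"]) auto
    then show ?thesis by simp
  qed
  have B: "\<bar>F n t\<bar> \<le> B" if t: "t \<in> {-T..T}" for n t
    unfolding F_def B_def by (rule abs_coefficient_le[OF p continuous_on_slice[OF ft t]]) (use Bt t in auto)
  have sM: "summable (\<lambda>n. M (Suc n))"
    unfolding M_def by (rule summable_Hoelder_bound[OF p \<open>0 < \<alpha>\<close>])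
  have sb: "summable (\<lambda>n. (?b (Suc n))\<^sup>2)"
    unfolding b F_def by (rule summable_square_coefficients[OF p continuous_on_slice[OF ft]]) (use T in auto)
  obtain w where w: "\<And>n. w n absolutely_integrable_on {-T..T}"
    and w2: "\<And>n. (\<lambda>t. (w n t)\<^sup>2) integrable_on {-T..T}"
    and sG: "summable (\<lambda>n. integral {-T..T} (\<lambda>t. (w (Suc n) t)\<^sup>2))"
    and parts: "\<And>n. parts_on (-T) T (F n) (w n)"
  proof (rule weak_tt_coefficients[OF p T _ assms(4) c\<phi> cF])
    show "continuous_on (closure (Om p T)) (\<lambda>(x, t). f x t)" unfolding closure_Om[OF p T] by (rule f)
    show "(?\<phi> n has_real_derivative F n t) (at t)" if "t \<in> {-T<..<T}" for n t by (rule D\<phi>[OF that])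
  qed (rule that)
  define G where "G n = integral {-T..T} (\<lambda>t. (w n t)\<^sup>2)" for n
  define K where "K n = mode_majorant T (M n) B (?l n) (?b n) (G n)" for n
  have sG': "summable (\<lambda>n. G (Suc n))" using sG by (simp add: G_def)
  have M0: "0 \<le> M n" if "1 \<le> n" for n using M[OF that, of 0] T by (simp add: order_trans[OF abs_ge_zero])
  have B0: "0 \<le> B" using B[of 0 0] T by (simp add: order_trans[OF abs_ge_zero])
  have G0: "0 \<le> G n" for n unfolding G_def by (intro Henstock_Kurzweil_Integration.integral_nonneg w2) simp
  have sK: "summable (\<lambda>n. K (Suc n))"
    unfolding K_def by (rule summable_mode_majorant[OF p _ sM sb sG']) (simp add: M0)
  have l: "0 < ?l n" if "1 \<le> n" for n using lam_pos[OF p that] .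
  have K_ge: "2 * ((M n + B) / (?l n)\<^sup>2) + T * (M n / ?l n) \<le> K n"
      "M n / ?l n + 2 * (B / (?l n)\<^sup>2) + (2 + T) * M n \<le> K n"
      "3 * M n + (B + 1 + T) / (?l n)\<^sup>2 + (?b n)\<^sup>2 + G n + M n \<le> K n"
      "(M n + B) / (?l n)\<^sup>2 + T * M n \<le> K n"
      "2 * M n + 2 * (B / (?l n)\<^sup>2) + M n \<le> K n"
      "2 * M n + (B + 1) / (?l n)\<^sup>2 + G n \<le> K n" if n: "1 \<le> n" for n
    unfolding K_def by (rule mode_majorant_ge[OF less_imp_le[OF T] M0[OF n] B0 l[OF n] G0])+
  have a_le: "\<bar>?a n\<bar> \<le> M n" if "1 \<le> n" for n using M[OF that, of 0] T by simp
  have b_le: "\<bar>?b n\<bar> \<le> B" for n using B[of 0 n] T by (simp add: b)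
  \<comment> \<open>By \<open>parts_on\<close> with \<open>h = 1\<close>, \<open>f\<^sub>n'\<close> is an indefinite integral of \<open>w n\<close>; the end points are put aside, as two-sided derivatives say nothing there.\<close>
  have neg2: "negligible ({t \<in> {-T<..<T}. ?\<phi>2 n t \<noteq> w n t} \<union> {-T, T})" for n
  proof (intro negligible_Un)
    show "negligible {t \<in> {-T<..<T}. ?\<phi>2 n t \<noteq> w n t}"
      unfolding fc2_def
    proof (rule negligible_deriv_neq_of_indefinite_integral[where F = "F n" and c = "F n (-T)"])
      show "w n integrable_on {-T..T}" using w by (simp add: absolutely_integrable_on_def)
      show "integral {-T..t} (w n) = F n t - F n (-T)" if "t \<in> {-T<..<T}" for t
        using parts_onD[OF parts, of "\<lambda>_. 1" "\<lambda>_. 0" "-T" t n] that by (simp add: smooth_const)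
    qed (rule \<phi>1)
  qed simp
  have \<phi>2_w: "integral {r..s} (\<lambda>\<tau>. ?\<phi>2 n \<tau> * h \<tau>) = integral {r..s} (\<lambda>\<tau>. w n \<tau> * h \<tau>)"
    if "-T \<le> r" "s \<le> T" for n r s h
    by (rule integral_spike[OF neg2[of n]]) (use that in auto)
  have \<phi>1_F: "integral {r..s} (\<lambda>\<tau>. ?\<phi>1 n \<tau> * h \<tau>) = integral {r..s} (\<lambda>\<tau>. F n \<tau> * h \<tau>)"
    if "-T \<le> r" "s \<le> T" for n r s h
    by (rule integral_spike[of "{-T, T}"]) (use that \<phi>1 in auto)
  have smooth_sin': "smooth (\<lambda>\<tau>. sin (l * (t - \<tau>)))" and smooth_exp': "smooth (\<lambda>\<tau>. exp (l * (t - \<tau>)))" for l t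
  proof -
    have "smooth (\<lambda>\<tau>. sin (- l * \<tau> + l * t))" "smooth (\<lambda>\<tau>. exp (- l * \<tau> + l * t))"
      by (intro smooth_affine smooth_sin smooth_exp)+
    then show "smooth (\<lambda>\<tau>. sin (l * (t - \<tau>)))" "smooth (\<lambda>\<tau>. exp (l * (t - \<tau>)))"
      by (simp_all add: algebra_simps)
  qed
  have d_sin: "((\<lambda>\<tau>. sin (l * (t - \<tau>))) has_real_derivative - l * cos (l * (t - \<tau>))) (at \<tau>)"
    and d_cos: "((\<lambda>\<tau>. cos (l * (t - \<tau>))) has_real_derivative l * sin (l * (t - \<tau>))) (at \<tau>)"
    and d_exp: "((\<lambda>\<tau>. exp (l * (t - \<tau>))) has_real_derivative - l * exp (l * (t - \<tau>))) (at \<tau>)" for l t \<tau> :: real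
    by (auto intro!: derivative_eq_intros)

  \<comment> \<open>For \<open>t \<ge> 0\<close> the kernel \<open>h\<close> in the integrations by parts is \<open>cos\<close> or \<open>sin\<close> of \<open>l (t - \<tau>)\<close>.\<close>
  let ?P = "\<lambda>n. modeP (?l n) (?a n) (?b n) (?\<phi> n)" and ?P' = "\<lambda>n. modeP' (?l n) (?a n) (?b n) (?\<phi> n)"
    and ?P'' = "\<lambda>n. modeP'' (?l n) (?a n) (?b n) (?\<phi>2 n)"
  have subP: "{0..T} \<subseteq> {-T..T}" and subM: "{-T..0} \<subseteq> {-T..T}" using T by auto
  have c\<phi>P: "continuous_on {0..T} (?\<phi> n)" and c\<phi>M: "continuous_on {-T..0} (?\<phi> n)" and cFM: "continuous_on {-T..0} (F n)" for n
    using c\<phi> cF subP subM continuous_on_subset by blast+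
  have P''_w: "?P'' n t = modeP'' (?l n) (?a n) (?b n) (w n) t" if "t \<in> {0..T}" for n t
    unfolding modeP''_def using \<phi>2_w[of 0 t n] that T by simp
  have P''_eq: "?P'' n t = - (?l n)\<^sup>2 * ?P n t + ?\<phi> n t" if n: "1 \<le> n" and t: "t \<in> {0..T}" for n t
    unfolding P''_w[OF t]
  proof (rule modeP''_eq[OF l[OF n], where ?\<phi>1.0 = "F n"])
    have "cos_conv (?l n) (F n) t =
        ?\<phi> n t * cos (?l n * (t - t)) - ?\<phi> n 0 * cos (?l n * (t - 0)) - integral {0..t} (\<lambda>\<tau>. ?\<phi> n \<tau> * (?l n * sin (?l n * (t - \<tau>))))"
      by (rule integral_by_parts_interior[OF _ continuous_on_subset[OF c\<phi>] D\<phi> d_cos])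
        (use t in \<open>auto intro!: continuous_intros\<close>)
    also have "integral {0..t} (\<lambda>\<tau>. ?\<phi> n \<tau> * (?l n * sin (?l n * (t - \<tau>)))) = ?l n * sin_conv (?l n) (?\<phi> n) t"
      unfolding mult.left_commute[of "?\<phi> n _"] by (rule integral_mult_right)
    finally show "cos_conv (?l n) (F n) t = ?\<phi> n t - ?a n * cos (?l n * t)
        - ?l n * sin_conv (?l n) (?\<phi> n) t" by simp
    have "sin_conv (?l n) (w n) t =
        F n t * sin (?l n * (t - t)) - F n 0 * sin (?l n * (t - 0)) - integral {0..t} (\<lambda>\<tau>. F n \<tau> * (- ?l n * cos (?l n * (t - \<tau>))))"
      by (rule parts_onD[OF parts smooth_sin' d_sin]) (use t T in auto)
    also have "integral {0..t} (\<lambda>\<tau>. F n \<tau> * (- ?l n * cos (?l n * (t - \<tau>)))) = - ?l n * cos_conv (?l n) (F n) t"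
      unfolding mult.left_commute[of "F n _"] by (rule integral_mult_right)
    finally show "sin_conv (?l n) (w n) t = - ?b n * sin (?l n * t)
        + ?l n * cos_conv (?l n) (F n) t" by (simp add: b)
  qed
  have wP: "w n absolutely_integrable_on {0..T}" "(\<lambda>t. (w n t)\<^sup>2) integrable_on {0..T}" "integral {0..T} (\<lambda>t. (w n t)\<^sup>2) \<le> G n"
    and wM: "w n absolutely_integrable_on {-T..0}" "(\<lambda>t. (w n t)\<^sup>2) integrable_on {-T..0}" "integral {-T..0} (\<lambda>t. (w n t)\<^sup>2) \<le> G n" for n
  proof -
    show "w n absolutely_integrable_on {0..T}" "w n absolutely_integrable_on {-T..0}"
      using absolutely_integrable_on_subinterval[OF w] subP subM by blast+
    show *: "(\<lambda>t. (w n t)\<^sup>2) integrable_on {0..T}" "(\<lambda>t. (w n t)\<^sup>2) integrable_on {-T..0}"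
      using integrable_on_subinterval[OF w2] subP subM by blast+
    show "integral {0..T} (\<lambda>t. (w n t)\<^sup>2) \<le> G n" "integral {-T..0} (\<lambda>t. (w n t)\<^sup>2) \<le> G n"
      unfolding G_def by (intro integral_subset_le subP subM * w2; simp)+
  qed
  have MP: "\<bar>?\<phi> n t\<bar> \<le> M n" if "1 \<le> n" "t \<in> {0..T}" for n t using M[OF that(1)] that(2) T by auto
  have MM: "\<bar>?\<phi> n t\<bar> \<le> M n" if "1 \<le> n" "t \<in> {-T..0}" for n t using M[OF that(1)] that(2) T by auto
  have P_le: "\<bar>?P n t\<bar> \<le> K n" "\<bar>?P' n t\<bar> \<le> K n" "\<bar>?P'' n t\<bar> \<le> K n" "\<bar>?P'' n t - ?\<phi> n t\<bar> \<le> K n"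
    if n: "1 \<le> n" and t: "t \<in> {0..T}" for n t
  proof -
    note bd = modeP_bounds[OF l[OF n] c\<phi>P MP[OF n] a_le[OF n] b_le wP t]
    show "\<bar>?P n t\<bar> \<le> K n" by (rule order_trans[OF bd(1) K_ge(1)[OF n]])
    show "\<bar>?P' n t\<bar> \<le> K n" by (rule order_trans[OF bd(2) K_ge(2)[OF n]])
    have "\<bar>?P'' n t\<bar> \<le> 3 * M n + (B + 1 + T) / (?l n)\<^sup>2 + (?b n)\<^sup>2 + G n"
      unfolding P''_w[OF t] by (rule bd(3))
    then show "\<bar>?P'' n t\<bar> \<le> K n" "\<bar>?P'' n t - ?\<phi> n t\<bar> \<le> K n"
      using K_ge(3)[OF n] MP[OF n t] M0[OF n] by linarith+
  qed
  have within_P: "at t within {0..T} = at t" if "t \<in> {0<..<T}" for t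
    by (rule at_within_interior) (use that in simp)
  have within_M: "at t within {-T..0} = at t" if "t \<in> {-T<..<0}" for t
    by (rule at_within_interior) (use that in simp)
  have DP: "(?P n has_real_derivative ?P' n t) (at t)" "(?P' n has_real_derivative ?P'' n t) (at t)"
    if n: "1 \<le> n" and t: "t \<in> {0<..<T}" for n t
  proof -
    have t': "t \<in> {0..T}" using t by auto
    show "(?P n has_real_derivative ?P' n t) (at t)" "(?P' n has_real_derivative ?P'' n t) (at t)"
      using modeP_deriv[where a = "?a n" and b = "?b n" and \<phi> = "?\<phi> n", OF l[OF n] c\<phi>P t'] P''_eq[OF n t'] unfolding within_P[OF t] by simp_all
  qed
  have cP: "continuous_on {0..T} (?P n)" "continuous_on {0..T} (?P' n)" "continuous_on {0..T} (?P'' n)" if n: "1 \<le> n" for n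
  proof -
    show c: "continuous_on {0..T} (?P n)" and "continuous_on {0..T} (?P' n)"
      using modeP_deriv[OF l[OF n] c\<phi>P] by (intro DERIV_continuous_on; blast)+
    have "continuous_on {0..T} (\<lambda>t. - (?l n)\<^sup>2 * ?P n t + ?\<phi> n t)" by (intro continuous_intros c c\<phi>P)
    then show "continuous_on {0..T} (?P'' n)" by (rule continuous_on_eq) (simp add: P''_eq[OF n])
  qed

  \<comment> \<open>For \<open>t \<le> 0\<close> the kernel is \<open>exp (l\<^sup>2 (t - \<tau>))\<close>; the first-order equation already determines the second derivative.\<close>
  let ?N = "\<lambda>n. modeM (?l n) (?a n) (?b n) (?\<phi> n)" and ?N' = "\<lambda>n. modeM' (?l n) (?a n) (?b n) (?\<phi>1 n)"
    and ?N'' = "\<lambda>n. modeM'' (?l n) (?a n) (?b n) (?\<phi>2 n)"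
  have N''_w: "?N'' n t = modeM'' (?l n) (?a n) (?b n) (w n) t" if "t \<in> {-T..0}" for n t
    unfolding modeM''_def using \<phi>2_w[of t 0 n] that T by simp
  have N'_F: "?N' n t = modeM' (?l n) (?a n) (?b n) (F n) t" if "t \<in> {-T..0}" for n t
    unfolding modeM'_def using \<phi>1_F[of t 0 n] that T by simp
  have N'_eq: "?N' n t = (?l n)\<^sup>2 * ?N n t + ?\<phi> n t" if n: "1 \<le> n" and t: "t \<in> {-T..0}" for n t
    unfolding N'_F[OF t]
  proof (rule modeM'_eq[OF l[OF n]])
    have "exp_conv ((?l n)\<^sup>2) (F n) t =
        ?\<phi> n 0 * exp ((?l n)\<^sup>2 * (t - 0)) - ?\<phi> n t * exp ((?l n)\<^sup>2 * (t - t)) - integral {t..0} (\<lambda>\<tau>. ?\<phi> n \<tau> * (- (?l n)\<^sup>2 * exp ((?l n)\<^sup>2 * (t - \<tau>))))"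
      by (rule integral_by_parts_interior[OF _ continuous_on_subset[OF c\<phi>] D\<phi> d_exp])
        (use t T in \<open>auto intro!: continuous_intros\<close>)
    also have "integral {t..0} (\<lambda>\<tau>. ?\<phi> n \<tau> * (- (?l n)\<^sup>2 * exp ((?l n)\<^sup>2 * (t - \<tau>)))) = - (?l n)\<^sup>2 * exp_conv ((?l n)\<^sup>2) (?\<phi> n) t"
      unfolding mult.left_commute[of "?\<phi> n _"] by (rule integral_mult_right)
    finally show "exp_conv ((?l n)\<^sup>2) (F n) t = ?a n * exp ((?l n)\<^sup>2 * t) - ?\<phi> n t
        + (?l n)\<^sup>2 * exp_conv ((?l n)\<^sup>2) (?\<phi> n) t" by simp
  qed
  have N''_eq: "?N'' n t = (?l n)\<^sup>2 * ?N' n t + F n t" if n: "1 \<le> n" and t: "t \<in> {-T..0}" for n t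
    unfolding N''_w[OF t] N'_F[OF t]
  proof (rule modeM''_eq)
    have "exp_conv ((?l n)\<^sup>2) (w n) t =
        F n 0 * exp ((?l n)\<^sup>2 * (t - 0)) - F n t * exp ((?l n)\<^sup>2 * (t - t)) - integral {t..0} (\<lambda>\<tau>. F n \<tau> * (- (?l n)\<^sup>2 * exp ((?l n)\<^sup>2 * (t - \<tau>))))"
      by (rule parts_onD[OF parts smooth_exp' d_exp]) (use t T in auto)
    also have "integral {t..0} (\<lambda>\<tau>. F n \<tau> * (- (?l n)\<^sup>2 * exp ((?l n)\<^sup>2 * (t - \<tau>)))) = - (?l n)\<^sup>2 * exp_conv ((?l n)\<^sup>2) (F n) t"
      unfolding mult.left_commute[of "F n _"] by (rule integral_mult_right)
    finally show "exp_conv ((?l n)\<^sup>2) (w n) t = ?b n * exp ((?l n)\<^sup>2 * t) - F n t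
        + (?l n)\<^sup>2 * exp_conv ((?l n)\<^sup>2) (F n) t" by (simp add: b)
  qed
  have N_le: "\<bar>?N n t\<bar> \<le> K n" "\<bar>?N' n t\<bar> \<le> K n" "\<bar>?N'' n t\<bar> \<le> K n" "\<bar>?\<phi> n t - ?N' n t\<bar> \<le> K n"
    if n: "1 \<le> n" and t: "t \<in> {-T..0}" for n t
  proof -
    have BM: "\<bar>F n \<tau>\<bar> \<le> B" if "\<tau> \<in> {-T..0}" for \<tau> using B[of \<tau> n] that T by auto
    have \<phi>1_FM: "exp_conv ((?l n)\<^sup>2) (?\<phi>1 n) t = exp_conv ((?l n)\<^sup>2) (F n) t"
      if "t \<in> {-T..0}" for t by (rule \<phi>1_F) (use that T in auto)
    note bd = modeM_bounds[OF l[OF n] c\<phi>M MM[OF n] \<phi>1_FM cFM BM a_le[OF n] b_le wM t]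
    show "\<bar>?N n t\<bar> \<le> K n" by (rule order_trans[OF bd(1) K_ge(4)[OF n]])
    have "\<bar>?N' n t\<bar> \<le> 2 * M n + 2 * (B / (?l n)\<^sup>2)" by (rule bd(2))
    then show "\<bar>?N' n t\<bar> \<le> K n" "\<bar>?\<phi> n t - ?N' n t\<bar> \<le> K n"
      using K_ge(5)[OF n] MM[OF n t] M0[OF n] by linarith+
    show "\<bar>?N'' n t\<bar> \<le> K n" unfolding N''_w[OF t] by (rule order_trans[OF bd(3) K_ge(6)[OF n]])
  qed
  have cN: "continuous_on {-T..0} (?N n)" "continuous_on {-T..0} (?N' n)" "continuous_on {-T..0} (?N'' n)" if n: "1 \<le> n" for n
  proof -
    show c: "continuous_on {-T..0} (?N n)" using modeM_deriv[OF c\<phi>M] by (intro DERIV_continuous_on; blast)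
    have "continuous_on {-T..0} (\<lambda>t. (?l n)\<^sup>2 * ?N n t + ?\<phi> n t)" by (intro continuous_intros c c\<phi>M)
    then show c': "continuous_on {-T..0} (?N' n)" by (rule continuous_on_eq) (simp add: N'_eq[OF n])
    have "continuous_on {-T..0} (\<lambda>t. (?l n)\<^sup>2 * ?N' n t + F n t)" by (intro continuous_intros c' cFM)
    then show "continuous_on {-T..0} (?N'' n)" by (rule continuous_on_eq) (simp add: N''_eq[OF n])
  qed
  have DN: "(?N n has_real_derivative ?N' n t) (at t)" "(?N' n has_real_derivative ?N'' n t) (at t)"
    if n: "1 \<le> n" and t: "t \<in> {-T<..<0}" for n t
  proof -
    have t': "t \<in> {-T..0}" using t by auto
    show d: "(?N n has_real_derivative ?N' n t) (at t)"
      using modeM_deriv[where l = "?l n" and a = "?a n" and b = "?b n" and \<phi> = "?\<phi> n", OF c\<phi>M t'] N'_eq[OF n t'] unfolding within_M[OF t] by simp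
    have "((\<lambda>t. (?l n)\<^sup>2 * ?N n t + ?\<phi> n t) has_real_derivative (?l n)\<^sup>2 * ?N' n t + F n t) (at t)"
      by (intro DERIV_add DERIV_cmult d D\<phi>) (use t T in auto)
    then show "(?N' n has_real_derivative ?N'' n t) (at t)"
      unfolding N''_eq[OF n t']
      by (rule has_field_derivative_transform_within_open[of _ _ _ "{-T<..<0}"]) (use t N'_eq[OF n] in auto)
  qed

  have clP: "closure (Om_plus p T) \<subseteq> UNIV \<times> {0..T}" and clM: "closure (Om_minus p T) \<subseteq> UNIV \<times> {-T..0}"
    using p T by (auto simp: Om_plus_eq Om_minus_eq closure_Times)
  have conv: "abs_unif_convergent (closure (Om_plus p T)) (uP_term p f)"
     "abs_unif_convergent (closure (Om_plus p T)) (utP_term p f)"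
     "abs_unif_convergent (closure (Om_plus p T)) (uttP_term p f)"
     "abs_unif_convergent (closure (Om_plus p T)) (uxxP_term p f)"
     "abs_unif_convergent (closure (Om_minus p T)) (uM_term p f)"
     "abs_unif_convergent (closure (Om_minus p T)) (utM_term p f)"
     "abs_unif_convergent (closure (Om_minus p T)) (uxxM_term p f)"
     "abs_unif_convergent (closure (Om_minus p T)) (uttM_term p f)"
    unfolding uP_term_eq utP_term_eq uttP_term_eq uxxP_term_eq uM_term_eq utM_term_eq uxxM_term_eq uttM_term_eq
    by (rule abs_unif_convergent_X[OF clP _ sK] abs_unif_convergent_X[OF clM _ sK]; erule (1) P_le N_le)+
  \<comment> \<open>The first \<open>x\<close>-derivative of the series is controlled by the second, since the frequencies are at least \<open>\<pi> / p\<close>.\<close>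
  have lam_le: "\<bar>?l n * c\<bar> \<le> p / pi * K n" if n: "1 \<le> n" and c: "\<bar>(?l n)\<^sup>2 * c\<bar> \<le> K n" for n c
  proof -
    have "\<bar>?l n * c\<bar> = 1 / ?l n * \<bar>(?l n)\<^sup>2 * c\<bar>" using l[OF n] by (simp add: abs_mult power2_eq_square)
    also have "\<dots> \<le> p / pi * K n" using l[OF n] p by (intro mult_mono inverse_lam_le n c) auto
    finally show ?thesis .
  qed
  have xx: "has_second_derivative (\<lambda>y. \<Sum>n. X p (Suc n) y * c (Suc n)) (\<Sum>n. X p (Suc n) x * (- (?l (Suc n))\<^sup>2 * c (Suc n))) x"
    if "\<And>n. 1 \<le> n \<Longrightarrow> \<bar>c n\<bar> \<le> K n" "\<And>n. 1 \<le> n \<Longrightarrow> \<bar>(?l n)\<^sup>2 * c n\<bar> \<le> K n" for c x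
  proof (rule X_series_second_derivative[where K = "\<lambda>n. (1 + p / pi) * K n"])
    have K0: "0 \<le> K n" "0 \<le> p / pi * K n" if "1 \<le> n" for n
      using P_le(1)[OF that, of 0] T p by (simp_all add: order_trans[OF abs_ge_zero])
    show "\<bar>c n\<bar> \<le> (1 + p / pi) * K n" if "1 \<le> n" for n
      using \<open>\<And>n. 1 \<le> n \<Longrightarrow> \<bar>c n\<bar> \<le> K n\<close>[OF that] K0[OF that] by (simp add: distrib_right)
    show "\<bar>?l n * c n\<bar> \<le> (1 + p / pi) * K n" if "1 \<le> n" for n
      using lam_le[OF that \<open>\<And>n. 1 \<le> n \<Longrightarrow> \<bar>(?l n)\<^sup>2 * c n\<bar> \<le> K n\<close>[OF that]] K0[OF that] by (simp add: distrib_right)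
    show "\<bar>(?l n)\<^sup>2 * c n\<bar> \<le> (1 + p / pi) * K n" if "1 \<le> n" for n
      using \<open>\<And>n. 1 \<le> n \<Longrightarrow> \<bar>(?l n)\<^sup>2 * c n\<bar> \<le> K n\<close>[OF that] K0[OF that] by (simp add: distrib_right)
    show "summable (\<lambda>n. (1 + p / pi) * K (Suc n))" by (intro summable_mult sK)
  qed
  have derP: "((\<lambda>s. ser (uP_term p f) x s) has_real_derivative ser (utP_term p f) x t) (at t)"
       "((\<lambda>s. ser (utP_term p f) x s) has_real_derivative ser (uttP_term p f) x t) (at t)" if t: "t \<in> {0<..<T}" for x t
    unfolding uP_term_eq utP_term_eq uttP_term_eq
    by (rule ser_X_has_derivative[OF t _ _ _ sK]; (erule (1) DP | rule P_le; simp))+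
  have derM: "((\<lambda>s. ser (uM_term p f) x s) has_real_derivative ser (utM_term p f) x t) (at t)"
       "((\<lambda>s. ser (utM_term p f) x s) has_real_derivative ser (uttM_term p f) x t) (at t)" if t: "t \<in> {-T<..<0}" for x t
    unfolding uM_term_eq utM_term_eq uttM_term_eq
    by (rule ser_X_has_derivative[OF t _ _ _ sK]; (erule (1) DN | rule N_le; simp))+
  have xxP: "has_second_derivative (\<lambda>y. ser (uP_term p f) y t) (ser (uxxP_term p f) x t) x" if t: "t \<in> {0..T}" for x t
  proof -
    have eq: "?P'' n t - ?\<phi> n t = - (?l n)\<^sup>2 * ?P n t" if "1 \<le> n" for n using P''_eq[OF that t] by simp
    have "\<bar>(?l n)\<^sup>2 * ?P n t\<bar> \<le> K n" if "1 \<le> n" for n using P_le(4)[OF that t] eq[OF that] by simp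
    from xx[of "\<lambda>n. ?P n t", OF P_le(1)[OF _ t] this, of x]
    show ?thesis unfolding ser_def uP_term_eq uxxP_term_eq using eq by simp
  qed
  have xxM: "has_second_derivative (\<lambda>y. ser (uM_term p f) y t) (ser (uxxM_term p f) x t) x" if t: "t \<in> {-T..0}" for x t
  proof -
    have eq: "?\<phi> n t - ?N' n t = - (?l n)\<^sup>2 * ?N n t" if "1 \<le> n" for n using N'_eq[OF that t] by simp
    have "\<bar>(?l n)\<^sup>2 * ?N n t\<bar> \<le> K n" if "1 \<le> n" for n using N_le(4)[OF that t] eq[OF that] by simp
    from xx[of "\<lambda>n. ?N n t", OF N_le(1)[OF _ t] this, of x]
    show ?thesis unfolding ser_def uM_term_eq uxxM_term_eq using eq by simp
  qed
  have ttP: "has_second_derivative (\<lambda>s. ser (uP_term p f) x s) (ser (uttP_term p f) x t) t" if t: "t \<in> {0<..<T}" for x t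
    by (rule has_second_derivativeI[OF open_greaterThanLessThan t derP(1) derP(2)[OF t]])
  have ttM: "has_second_derivative (\<lambda>s. ser (uM_term p f) x s) (ser (uttM_term p f) x t) t" if t: "t \<in> {-T<..<0}" for x t
    by (rule has_second_derivativeI[OF open_greaterThanLessThan t derM(1) derM(2)[OF t]])
  have f_sums: "(\<lambda>n. X p (Suc n) x * ?\<phi> (Suc n) t) sums f x t" if x: "x \<in> {0<..<p}" and t: "t \<in> {-T..T}" for x t
    unfolding fc_def
  proof (rule sine_series_sums[OF p continuous_on_slice[OF f t] _ x])
    show "summable (\<lambda>n. \<bar>integral {0..p} (\<lambda>x. f x t * X p (Suc n) x)\<bar>)"
      by (rule summable_comparison_test'[OF sM, of 0]) (use M[OF _ t] in \<open>auto simp: fc_def\<close>)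
  qed
  have uP: "u p f x t = ser (uP_term p f) x t" if "0 \<le> t" for x t using that by (simp add: u_def)
  have uM: "u p f x t = ser (uM_term p f) x t" if "t < 0" for x t using that by (simp add: u_def)
  have pdeP: "ser (uttP_term p f) x t - ser (uxxP_term p f) x t = f x t" if x: "x \<in> {0<..<p}" and t: "t \<in> {0..T}" for x t
  proof -
    have "summable (\<lambda>n. X p (Suc n) x * ?P'' (Suc n) t)" "summable (\<lambda>n. X p (Suc n) x * (?P'' (Suc n) t - ?\<phi> (Suc n) t))"
      by (rule summable_X_mult[OF _ sK], erule P_le[OF _ t])+
    then have "ser (uttP_term p f) x t - ser (uxxP_term p f) x t = (\<Sum>n. X p (Suc n) x * ?\<phi> (Suc n) t)"
      unfolding ser_def uttP_term_eq uxxP_term_eq by (simp add: suminf_diff right_diff_distrib)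
    then show ?thesis using sums_unique[OF f_sums[OF x]] t T by simp
  qed
  have pdeM: "ser (utM_term p f) x t + ser (uxxM_term p f) x t = f x t" if x: "x \<in> {0<..<p}" and t: "t \<in> {-T..0}" for x t
  proof -
    have "summable (\<lambda>n. X p (Suc n) x * ?N' (Suc n) t)" "summable (\<lambda>n. X p (Suc n) x * (?\<phi> (Suc n) t - ?N' (Suc n) t))"
      by (rule summable_X_mult[OF _ sK], erule N_le[OF _ t])+
    then have "ser (utM_term p f) x t + ser (uxxM_term p f) x t = (\<Sum>n. X p (Suc n) x * ?\<phi> (Suc n) t)"
      unfolding ser_def utM_term_eq uxxM_term_eq by (simp add: suminf_add right_diff_distrib)
    then show ?thesis using sums_unique[OF f_sums[OF x]] t T by simp
  qed
  have eqP: "\<forall>(x, t)\<in>Om_plus p T. \<exists>utt uxx.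
        has_second_derivative (\<lambda>s. u p f x s) utt t \<and>
        has_second_derivative (\<lambda>y. u p f y t) uxx x \<and> utt - uxx = f x t"
  proof clarify
    fix x t assume "(x, t) \<in> Om_plus p T"
    then have x: "x \<in> {0<..<p}" and t: "t \<in> {0<..<T}" and t': "t \<in> {0..T}" using T by (auto simp: Om_plus_eq)
    have "has_second_derivative (\<lambda>s. u p f x s) (ser (uttP_term p f) x t) t"
      by (rule has_second_derivative_transform[OF open_greaterThanLessThan t _ ttP[OF t]]) (simp add: uP)
    moreover have "has_second_derivative (\<lambda>y. u p f y t) (ser (uxxP_term p f) x t) x"
      using xxP[OF t'] t by (simp add: uP)
    ultimately show "\<exists>utt uxx. has_second_derivative (\<lambda>s. u p f x s) utt t \<and>
        has_second_derivative (\<lambda>y. u p f y t) uxx x \<and> utt - uxx = f x t" using pdeP[OF x t'] by blast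
  qed
  have eqM: "\<forall>(x, t)\<in>Om_minus p T. \<exists>ut uxx.
        ((\<lambda>s. u p f x s) has_real_derivative ut) (at t) \<and>
        has_second_derivative (\<lambda>y. u p f y t) uxx x \<and> ut + uxx = f x t"
  proof clarify
    fix x t assume "(x, t) \<in> Om_minus p T"
    then have x: "x \<in> {0<..<p}" and t: "t \<in> {-T<..<0}" and t': "t \<in> {-T..0}" using T by (auto simp: Om_minus_eq)
    have "((\<lambda>s. u p f x s) has_real_derivative ser (utM_term p f) x t) (at t)"
      by (rule has_field_derivative_transform_within_open[OF derM(1)[OF t] open_greaterThanLessThan t]) (simp add: uM)
    moreover have "has_second_derivative (\<lambda>y. u p f y t) (ser (uxxM_term p f) x t) x"
      using xxM[OF t'] t by (simp add: uM)
    ultimately show "\<exists>ut uxx. ((\<lambda>s. u p f x s) has_real_derivative ut) (at t) \<and>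
        has_second_derivative (\<lambda>y. u p f y t) uxx x \<and> ut + uxx = f x t" using pdeM[OF x t'] by blast
  qed
  have contP: "continuous_on {0..T} (\<lambda>t. ser (uP_term p f) x t)" "continuous_on {0..T} (\<lambda>t. ser (utP_term p f) x t)"
      "continuous_on {0..T} (\<lambda>t. ser (uttP_term p f) x t)" for x
    unfolding uP_term_eq utP_term_eq uttP_term_eq
    by (rule ser_X_continuous[OF _ _ sK]; (erule cP | erule (1) P_le))+
  have contM: "continuous_on {-T..0} (\<lambda>t. ser (uM_term p f) x t)" "continuous_on {-T..0} (\<lambda>t. ser (utM_term p f) x t)"
      "continuous_on {-T..0} (\<lambda>t. ser (uttM_term p f) x t)" for x
    unfolding uM_term_eq utM_term_eq uttM_term_eq
    by (rule ser_X_continuous[OF _ _ sK]; (erule cN | erule (1) N_le))+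
  have match: "ser (uP_term p f) x 0 = ser (uM_term p f) x 0" "ser (utP_term p f) x 0 = ser (utM_term p f) x 0"
      "ser (uttP_term p f) x 0 = ser (uttM_term p f) x 0" for x
    unfolding uP_term_eq utP_term_eq uttP_term_eq uM_term_eq utM_term_eq uttM_term_eq ser_def by (simp_all only: modes_at_0)
  have duP: "deriv (u p f x) t = ser (utP_term p f) x t" if t: "t \<in> {0<..<T}" for x t
    by (rule DERIV_imp_deriv, rule has_field_derivative_transform_within_open[OF derP(1)[OF t] open_greaterThanLessThan t])
      (simp add: uP)
  have duM: "deriv (u p f x) t = ser (utM_term p f) x t" if t: "t \<in> {-T<..<0}" for x t
    by (rule DERIV_imp_deriv, rule has_field_derivative_transform_within_open[OF derM(1)[OF t] open_greaterThanLessThan t])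
      (simp add: uM)
  have dduP: "deriv (deriv (u p f x)) t = ser (uttP_term p f) x t" if t: "t \<in> {0<..<T}" for x t
    by (rule DERIV_imp_deriv, rule has_field_derivative_transform_within_open[OF derP(2)[OF t] open_greaterThanLessThan t])
      (simp add: duP)
  have dduM: "deriv (deriv (u p f x)) t = ser (uttM_term p f) x t" if t: "t \<in> {-T<..<0}" for x t
    by (rule DERIV_imp_deriv, rule has_field_derivative_transform_within_open[OF derM(2)[OF t] open_greaterThanLessThan t])
      (simp add: duM)
  have conj: "\<forall>x\<in>{0<..<p}. conjugate_at_0 (\<lambda>t. u p f x t) \<and>
        conjugate_at_0 (\<lambda>t. deriv (\<lambda>s. u p f x s) t) \<and>
        conjugate_at_0 (\<lambda>t. deriv (deriv (\<lambda>s. u p f x s)) t)"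
  proof (intro ballI conjI)
    fix x
    show "conjugate_at_0 (\<lambda>t. u p f x t)"
      by (rule conjugate_at_0I[OF T contP(1) _ contM(1) _ match(1)]) (simp_all add: uP uM)
    show "conjugate_at_0 (\<lambda>t. deriv (\<lambda>s. u p f x s) t)"
      by (rule conjugate_at_0I[OF T contP(2) _ contM(2) _ match(2)]) (simp_all add: duP duM)
    show "conjugate_at_0 (\<lambda>t. deriv (deriv (\<lambda>s. u p f x s)) t)"
      by (rule conjugate_at_0I[OF T contP(3) _ contM(3) _ match(3)]) (simp_all add: dduP dduM)
  qed
  have boundary: "\<forall>t\<in>{-T<..<T}. u p f 0 t = 0 \<and> u p f p t = 0"
    unfolding u_def uP_term_eq uM_term_eq ser_def using X_boundary[OF p] by simp
  have dP: "\<forall>(x, t)\<in>Om_plus p T.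
        ((\<lambda>s. ser (uP_term p f) x s) has_real_derivative ser (utP_term p f) x t) (at t) \<and>
        has_second_derivative (\<lambda>s. ser (uP_term p f) x s) (ser (uttP_term p f) x t) t \<and>
        has_second_derivative (\<lambda>y. ser (uP_term p f) y t) (ser (uxxP_term p f) x t) x"
    unfolding Om_plus_eq[OF T] using derP(1) ttP xxP by auto
  have dM: "\<forall>(x, t)\<in>Om_minus p T.
        ((\<lambda>s. ser (uM_term p f) x s) has_real_derivative ser (utM_term p f) x t) (at t) \<and>
        has_second_derivative (\<lambda>s. ser (uM_term p f) x s) (ser (uttM_term p f) x t) t \<and>
        has_second_derivative (\<lambda>y. ser (uM_term p f) y t) (ser (uxxM_term p f) x t) x"
    unfolding Om_minus_eq[OF T] using derM(1) ttM xxM by auto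
  show ?thesis using conv dP dM eqP eqM boundary conj by (intro conjI)
qed

end
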